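(* Let $k\ge1$, $K=3k+2$. For integers $0\le a\le k$ and $0\le b<k$, \begin{align*} \tilde\chi^K_{a,b}(q)&=\sum_{\substack{\lambda_1,\dots,\lambda_k\ge0\\ \mu_1,\dots,\mu_{k-1}\ge0}}\frac{q^{\lambda_k^2+\sum_{i=a+1}^k\lambda_i+\sum_{i=b+1}^{k-1}\mu_i}}{(q;q)_{\lambda_1}}\prod_{i=1}^{k-1}q^{\lambda_i^2-\lambda_i\mu_i+\mu_i^2}\binom{\lambda_i}{\lambda_{i+1}}_q\binom{\lambda_i-\lambda_{i+1}+\mu_{i+1}+\delta_{b,i}}{\mu_i}_q\\ &\quad-\chi(ab>0)\sum_{\substack{\lambda_1,\dots,\lambda_k\ge0\\ \mu_1,\dots,\mu_{k-1}\ge0}}\frac{q^{1+\lambda_k^2+\sum_{i=a}^k\lambda_i+\sum_{i=b}^{k-1}\mu_i}}{(q;q)_{\lambda_1}}\prod_{i=1}^{k-1}q^{\lambda_i^2-\lambda_i\mu_i+\mu_i^2}\binom{\lambda_i}{\lambda_{i+1}}_q\binom{\lambda_i-\lambda_{i+1}+\mu_{i+1}+\delta_{b-1,i}}{\mu_i}_q, \end{align*} and moreover \[\tilde\chi^K_{k,k}(q)=\sum_{\substack{\lambda_1,\dots,\lambda_k\ge0\\ \mu_1,\dots,\mu_{k-1}\ge0}}\frac{q^{\lambda_k^2}}{(q;q)_{\lambda_1}}\prod_{i=1}^{k-1}q^{\lambda_i^2-\lambda_i\mu_i+\mu_i^2}\binom{\lambda_i}{\lambda_{i+1}}_q\binom{\lambda_i-\lambda_{i+1}+\mu_{i+1}}{\mu_i}_q,\]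 where in all sums $\lambda_{k+1}:=0$ and $\mu_k:=2\lambda_k$.
   Context: $(a;q)_n=\prod_{j=0}^{n-1}(1-aq^j)$, $(a;q)_\infty=\prod_{j\ge0}(1-aq^j)$; $\binom{n}{m}_q=\frac{(q;q)_n}{(q;q)_m(q;q)_{n-m}}$ for $0\le m\le n$ and $0$ otherwise. $\delta_{i,j}$ is the Kronecker delta, $\chi(\cdot)$ the indicator function. $\theta(z;q)=(z;q)_\infty(q/z;q)_\infty$, $\theta(z_1,\dots,z_n;q)=\prod\theta(z_i;q)$. For integers $a,b\ge0$ with $a+b\le K-3$, $\tilde\chi^K_{a,b}(q):=\frac{(q^K;q^K)_\infty^2}{(q;q)_\infty^2}\theta(q^{a+1},q^{b+1},q^{a+b+2};q^K)$. *)

theory Defs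
  imports "HOL-Analysis.Analysis"
begin

definition qpoch :: "complex \<Rightarrow> complex \<Rightarrow> nat \<Rightarrow> complex" where
  "qpoch a q n = (\<Prod>j<n. 1 - a * q ^ j)"

definition qpoch_inf :: "complex \<Rightarrow> complex \<Rightarrow> complex" where
  "qpoch_inf a q = (\<Prod>j. 1 - a * q ^ j)"

definition theta :: "complex \<Rightarrow> complex \<Rightarrow> complex" where
  "theta z q = qpoch_inf z q * qpoch_inf (q / z) q"

definition qbinom :: "complex \<Rightarrow> int \<Rightarrow> int \<Rightarrow> complex" where
  "qbinom q n m = (if 0 \<le> m \<and> m \<le> n
     then qpoch q q (nat n) / (qpoch q q (nat m) * qpoch q q (nat (n - m))) else 0)"

definition chitilde :: "nat \<Rightarrow> nat \<Rightarrow> nat \<Rightarrow> complex \<Rightarrow> complex" where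
  "chitilde K a b q =
     (qpoch_inf (q ^ K) (q ^ K))\<^sup>2 / (qpoch_inf q q)\<^sup>2 *
     (theta (q ^ (a + 1)) (q ^ K) * theta (q ^ (b + 1)) (q ^ K) * theta (q ^ (a + b + 2)) (q ^ K))"

text \<open>Index set: lambda = (lambda_1..lambda_k), mu = (mu_1..mu_{k-1}) encoded as
  functions nat => nat vanishing outside these ranges (so lambda_{k+1} = 0).\<close>
definition idx :: "nat \<Rightarrow> ((nat \<Rightarrow> nat) \<times> (nat \<Rightarrow> nat)) set" where
  "idx k = {(l, m). (\<forall>i. (i < 1 \<or> k < i) \<longrightarrow> l i = 0) \<and> (\<forall>i. (i < 1 \<or> k \<le> i) \<longrightarrow> m i = 0)}"

definition mu_ext :: "nat \<Rightarrow> (nat \<Rightarrow> nat) \<Rightarrow> (nat \<Rightarrow> nat) \<Rightarrow> nat \<Rightarrow> nat" where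
  "mu_ext k l m i = (if i = k then 2 * l k else m i)"

definition core :: "nat \<Rightarrow> complex \<Rightarrow> (nat \<Rightarrow> int) \<Rightarrow> (nat \<Rightarrow> nat) \<Rightarrow> (nat \<Rightarrow> nat) \<Rightarrow> complex" where
  "core k q d l m =
     (\<Prod>i\<in>{1..k-1}.
        q powi (int (l i)^2 - int (l i) * int (m i) + int (m i)^2)
        * qbinom q (int (l i)) (int (l (i + 1)))
        * qbinom q (int (l i) - int (l (i + 1)) + int (mu_ext k l m (i + 1)) + d i) (int (m i)))
     / qpoch q q (l 1)"

definition kdelta :: "nat \<Rightarrow> nat \<Rightarrow> int" where
  "kdelta j i = (if j = i then 1 else 0)"

end

theory Submission
  imports Defs
begin

text \<open>
  The proof runs an A2 Bailey chain. Put \<open>\<Phi>(r,s) = (q)\<^sub>n / \<Prod>\<^sub>l (q)\<^bsub>r+\<alpha>l\<^esub> (q)\<^bsub>n-r-\<alpha>l\<^esub>\<close>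
  with \<open>n = r+s+i+j\<close> and \<open>\<alpha>1+\<alpha>2+\<alpha>3 = 2i+j\<close>. This is a joint eigenfunction of two q-Toda Hamiltonians.
  The Bailey step (multiply by \<open>q^(r^2-rs+s^2+ir+js)\<close>, then convolve with \<open>1/((q)\<^sub>r (q)\<^sub>s)\<close>) commutes
  with both of them, and a joint eigenfunction is determined by its leading value; so \<open>\<Phi>\<close> is an
  eigenfunction of the Bailey step, with a Gaussian eigenvalue.

  The seed \<open>q^(2rs) / ((q)\<^sub>r (q)\<^sub>s (q)\<^bsub>r+s+1\<^esub>)\<close> is a signed Gaussian sum of such functions over vectors
  whose entries are distinct modulo 3: translating the summation vector by (1,1,-2) gives a recurrence for
  the sum which the seed satisfies too. Applying k Bailey steps of types (1,1), (1,0) and (0,0), with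
  partial fractions at each change of type, and letting r and s tend to infinity turns the difference of
  the two multisums into a double sum over the A2 root lattice. The A2 Macdonald identity, obtained by
  multiplying three Jacobi triple products, evaluates it.

  Finally the q-Chu-Vandermonde sum trades the factors \<open>1/(q)\<^bsub>M(i)-M(i+1)\<^esub>\<close> of the Bailey chain for the
  q-binomial coefficients in the variables \<open>\<mu>\<^sub>i\<close>.
\<close>

section \<open>Reciprocal q-factorials\<close>

text \<open>Origin of \<open>K = 3 * k + 2\<close>: where the signed coefficient is nonzero,
  \<open>nn v w = 3 * t + 1\<close>. The seed then contributes \<open>q^(2 * t)\<close> and every
  Bailey step, whatever its type, \<open>q^(3 * t)\<close>, up to powers of \<open>q\<close> with
  exponents linear in \<open>v\<close>, \<open>w\<close>. The linear parts depend on the types and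
  assemble to the theta arguments \<open>q^(a+1)\<close> and \<open>q^(b+1)\<close>.

  The obstacle is that different types have different eigenfunctions. Passing from one type to
  another is impossible term by term; it works only for the whole sum, after antisymmetrizing over
  permutations of the vector. From (1,1) to (1,0) this costs nothing. From (1,0) to (0,0) an extra
  factor \<open>1 - q^(r+v)\<close> is needed, and supplying it is the purpose of the subtracted
  multisum.

  On the multisum side, the Kronecker delta marks the place where the second component of the type
  changes. The innermost q-Chu-Vandermonde sum closes only if the seed parameter equals the second
  component of the innermost step: \<open>seed 1\<close> for \<open>b < k\<close>,
  \<open>seed 0\<close> for \<open>b = k\<close>. Hence a = b = k is a separate formula, without
  subtraction.\<close>

text \<open>The value 0 at negative arguments makes the recurrence \<open>rq_rec\<close> valid for all integers.\<close>

definition rq :: "complex \<Rightarrow> int \<Rightarrow> complex" where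
  "rq q n = (if n < 0 then 0 else 1 / qpoch q q (nat n))"

text \<open>The value 1 at negative arguments is harmless: in \<open>tri\<close> one of
  \<open>x\<close>, \<open>n - x\<close> is negative when \<open>n < 0\<close>, so a factor
  \<open>rq\<close> vanishes.\<close>

definition qfac :: "complex \<Rightarrow> int \<Rightarrow> complex" where
  "qfac q n = qpoch q q (nat n)"

text \<open>For \<open>n >= 0\<close> this is the product of three q-binomial coefficients over
  \<open>n\<close>, divided by (q)_n^2. It is zero as soon as an entry leaves the range from 0 to
  \<open>n\<close>, so sums over lattice vectors need no explicit bounds.\<close>

definition tri :: "complex \<Rightarrow> int \<Rightarrow> int \<Rightarrow> int \<Rightarrow> int \<Rightarrow> complex" where
  "tri q n x y z = qfac q n * (rq q x * rq q (n - x)) * (rq q y * rq q (n - y)) * (rq q z * rq q (n - z))"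

lemma rq_neg [simp]: "n < 0 \<Longrightarrow> rq q n = 0"
  by (simp add: rq_def)

lemma rq_0 [simp]: "rq q 0 = 1"
  by (simp add: rq_def qpoch_def)

lemma qpoch_Suc: "qpoch a q (Suc n) = qpoch a q n * (1 - a * q ^ n)"
  by (simp add: qpoch_def)

lemma tri_perm: "tri q n y x z = tri q n x y z" "tri q n x z y = tri q n x y z"
  by (simp_all add: tri_def mult_ac)

lemma tri_nonzeroD:
  assumes "tri q n x y z \<noteq> 0"
  shows "0 \<le> x" "x \<le> n" "0 \<le> y" "y \<le> n" "0 \<le> z" "z \<le> n"
  using assms by (auto simp: tri_def rq_def split: if_splits)

text \<open>Negative powers of \<open>q\<close> occur throughout, so \<open>q\<close> is nonzero
  here; the value \<open>q = 0\<close> is treated separately at the end.\<close>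

locale nome =
  fixes q :: complex
  assumes q_nz [simp]: "q \<noteq> 0" and q_lt: "norm q < 1"
begin

section \<open>Integer powers of q and lowering relations for \<open>tri\<close>\<close>

lemma powi_neq_1:
  assumes "n \<noteq> 0"
  shows "q powi n \<noteq> 1"
proof
  assume 1: "q powi n = 1"
  have pos: "q ^ Suc m \<noteq> 1" for m
  proof
    assume "q ^ Suc m = 1"
    hence "norm q ^ Suc m = 1" by (metis norm_one norm_power)
    moreover have "norm q ^ Suc m < 1" using q_lt by (intro power_Suc_less_one) (use q_nz in auto)
    ultimately show False by simp
  qed
  have "q ^ nat \<bar>n\<bar> = 1" using 1 by (auto simp: power_int_def abs_if field_simps split: if_splits)
  moreover obtain m where "nat \<bar>n\<bar> = Suc m" using assms by (metis gr0_conv_Suc zero_less_abs_iff zero_less_nat_eq)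
  ultimately show False using pos[of m] by simp
qed

lemma powi_inj: "q powi m = q powi n \<longleftrightarrow> m = n"
proof
  assume "q powi m = q powi n"
  hence "q powi (m - n) = 1" using q_nz by (simp add: power_int_diff)
  thus "m = n" using powi_neq_1[of "m - n"] by auto
qed simp

lemma powi_add: "q powi (m + n) = q powi m * q powi n"
  using q_nz by (simp add: power_int_add)

lemma powi_diff: "q powi (m - n) = q powi m / q powi n"
  using q_nz by (simp add: power_int_diff)

lemma qfac_nz [simp]: "qfac q n \<noteq> 0"
proof -
  have "1 - q * q ^ j \<noteq> 0" for j
    using powi_neq_1[of "int (Suc j)"] unfolding power_int_of_nat by simp
  thus ?thesis by (simp add: qfac_def qpoch_def)
qed

lemma rq_rec: "rq q (n - 1) = (1 - q powi n) * rq q n"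
proof -
  consider "n < 0" | "n = 0" | "n > 0" by linarith
  thus ?thesis
  proof cases
    case 3
    then obtain m where m: "n = int (Suc m)" by (metis gr0_conv_Suc zero_less_imp_eq_int)
    have "qpoch q q (Suc m) \<noteq> 0" using qfac_nz[of n] unfolding qfac_def m nat_int .
    moreover have "int (Suc m) - 1 = int m" by simp
    ultimately show ?thesis unfolding m rq_def power_int_of_nat nat_int
      by (simp add: qpoch_Suc divide_simps)
  qed simp_all
qed

lemma qfac_rec: "n \<ge> 1 \<Longrightarrow> qfac q n = (1 - q powi n) * qfac q (n - 1)"
proof -
  assume "n \<ge> 1"
  then obtain m where m: "n = int (Suc m)" by (metis gr0_conv_Suc zero_less_imp_eq_int int_one_le_iff_zero_less)
  have "int (Suc m) - 1 = int m" by simp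
  thus ?thesis unfolding m qfac_def power_int_of_nat nat_int by (simp add: qpoch_Suc)
qed

text \<open>Lowering \<open>n\<close> alone shortens \<open>n - y\<close>; lowering \<open>y\<close>
  along with \<open>n\<close> shortens \<open>y\<close> instead. The four variants differ in how
  many entries are lowered: three or none occur in the Hamiltonian, one and two in the changes of
  type.\<close>

lemma tri_lower1:
  assumes "n \<ge> 1"
  shows "(1 - q powi n) * tri q (n - 1) (x - 1) y z =
    (1 - q powi x) * (1 - q powi (n - y)) * (1 - q powi (n - z)) * tri q n x y z"
proof -
  have e: "n - 1 - (x - 1) = n - x" "n - 1 - y = (n - y) - 1" "n - 1 - z = (n - z) - 1" by simp_all
  show ?thesis unfolding tri_def e rq_rec qfac_rec[OF assms] by (simp only: mult_ac)
qed

lemma tri_lower2: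
  assumes "n \<ge> 1"
  shows "(1 - q powi n) * tri q (n - 1) (x - 1) (y - 1) z =
    (1 - q powi x) * (1 - q powi y) * (1 - q powi (n - z)) * tri q n x y z"
proof -
  have e: "n - 1 - (x - 1) = n - x" "n - 1 - (y - 1) = n - y" "n - 1 - z = (n - z) - 1" by simp_all
  show ?thesis unfolding tri_def e rq_rec qfac_rec[OF assms] by (simp only: mult_ac)
qed

lemma tri_lower3:
  assumes "n \<ge> 1"
  shows "(1 - q powi n) * tri q (n - 1) (x - 1) (y - 1) (z - 1) =
    (1 - q powi x) * (1 - q powi y) * (1 - q powi z) * tri q n x y z"
proof -
  have e: "n - 1 - (x - 1) = n - x" "n - 1 - (y - 1) = n - y" "n - 1 - (z - 1) = n - z" by simp_all
  show ?thesis unfolding tri_def e rq_rec qfac_rec[OF assms] by (simp only: mult_ac)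
qed

lemma tri_lower0:
  assumes "n \<ge> 1"
  shows "(1 - q powi n) * tri q (n - 1) x y z =
    (1 - q powi (n - x)) * (1 - q powi (n - y)) * (1 - q powi (n - z)) * tri q n x y z"
proof -
  have e: "n - 1 - x = (n - x) - 1" "n - 1 - y = (n - y) - 1" "n - 1 - z = (n - z) - 1" by simp_all
  show ?thesis unfolding tri_def e rq_rec qfac_rec[OF assms] by (simp only: mult_ac)
qed


section \<open>The Bailey step and the q-Toda Hamiltonian\<close>

text \<open>One definition serves for both commuting Hamiltonians: the second arises by exchanging
  \<open>i\<close> with \<open>j\<close> and \<open>r\<close> with \<open>s\<close>.\<close>

definition toda :: "int \<Rightarrow> int \<Rightarrow> (int \<Rightarrow> int \<Rightarrow> complex) \<Rightarrow> int \<Rightarrow> int \<Rightarrow> complex" where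
  "toda i j g r s = q powi (-r) * (g r s - g (r - 1) s) + q powi (i + r - s) * (g r s - g r (s - 1))
     + q powi (i + j + s) * g r s"

lemma toda_tri:
  assumes abc: "a + b + c = 2 * i + j"
  shows "toda i j (\<lambda>r s. tri q (r + s + i + j) (r + a) (r + b) (r + c)) r s =
    (q powi a + q powi b + q powi c) * tri q (r + s + i + j) (r + a) (r + b) (r + c)"
proof -
  define n where "n = r + s + i + j"
  define P where "P = tri q n (r + a) (r + b) (r + c)"
  have d1: "tri q (r - 1 + s + i + j) (r - 1 + a) (r - 1 + b) (r - 1 + c) =
      tri q (n - 1) (r + a - 1) (r + b - 1) (r + c - 1)"
    by (simp add: n_def algebra_simps)
  have d2: "tri q (r + (s - 1) + i + j) (r + a) (r + b) (r + c) = tri q (n - 1) (r + a) (r + b) (r + c)"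
    by (simp add: n_def algebra_simps)
  consider "n < 0" | "n = 0" | "n \<ge> 1" by linarith
  thus ?thesis
  proof cases
    case 1
    have z: "tri q n' x y z = 0" if "n' < 0" for n' x y z
      using that tri_nonzeroD(1,2)[of q n' x y z] by linarith
    have "tri q (n - 1) x y z = 0" "tri q n x y z = 0" for x y z using 1 by (auto intro: z)
    thus ?thesis unfolding toda_def d1 d2 n_def[symmetric] by simp
  next
    case 2
    \<comment> \<open>At \<open>n = 0\<close> the factor \<open>1 - q^n\<close> cannot be cancelled.
      The only nonzero value has all entries 0, and there the three coefficients of the Hamiltonian
      are themselves the three summands of the eigenvalue.\<close>
    have z: "tri q (n - 1) x y z = 0" for x y z
      using 2 tri_nonzeroD(1,2)[of q "n - 1" x y z] by linarith
    show ?thesis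
    proof (cases "P = 0")
      case True
      thus ?thesis unfolding toda_def d1 d2 z n_def[symmetric] P_def by simp
    next
      case False
      from tri_nonzeroD[OF this[unfolded P_def]] 2 have x: "a = -r" "b = -r" "c = -r" by linarith+
      have y: "i + r - s = -r" "i + j + s = -r" using x abc 2 unfolding n_def by linarith+
      show ?thesis unfolding toda_def d1 d2 z y unfolding x by (simp only: diff_zero distrib_right)
    qed
  next
    case 3
    define R S A B C I J where defs: "R = q powi r" "S = q powi s" "A = q powi a" "B = q powi b"
      "C = q powi c" "I = q powi i" "J = q powi j"
    have nz: "R \<noteq> 0" "S \<noteq> 0" "A \<noteq> 0" "B \<noteq> 0" "C \<noteq> 0" "I \<noteq> 0" "J \<noteq> 0" by (simp_all add: defs)
    have "A * B * C = q powi (2 * i + j)" unfolding defs powi_add[symmetric] abc ..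
    also have "\<dots> = I * I * J" unfolding defs powi_add[symmetric] by simp
    finally have ABC: "A * B * C = I * I * J" .
    define N where "N = R * S * I * J"
    have N: "q powi n = N" by (simp add: n_def defs N_def powi_add)
    have N1: "1 - N \<noteq> 0" using powi_neq_1[of n] 3 N by auto
    define P1 where "P1 = tri q (n - 1) (r + a - 1) (r + b - 1) (r + c - 1)"
    define P2 where "P2 = tri q (n - 1) (r + a) (r + b) (r + c)"
    have e1: "(1 - N) * P1 = (1 - R * A) * (1 - R * B) * (1 - R * C) * P"
      using tri_lower3[OF 3, of "r + a" "r + b" "r + c"] unfolding N P1_def P_def
      by (simp add: powi_add defs)
    \<comment> \<open>Because \<open>a + b + c = 2 * i + j\<close>, the exponent
      \<open>n - r - a\<close> equals \<open>s + b + c - i\<close>.\<close>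
    have sa: "q powi (n - (r + a)) = S * B * C / I" "q powi (n - (r + b)) = S * A * C / I"
        "q powi (n - (r + c)) = S * A * B / I"
      unfolding defs powi_add[symmetric] powi_diff[symmetric]
      by (rule arg_cong[where f="power_int q"]; use abc in \<open>simp add: n_def\<close>)+
    have e2: "(1 - N) * P2 = (1 - S * B * C / I) * (1 - S * A * C / I) * (1 - S * A * B / I) * P"
      using tri_lower0[OF 3, of "r + a" "r + b" "r + c"] unfolding N P2_def P_def sa by simp
    \<comment> \<open>\<open>E1\<close> is the claimed eigenvalue. \<open>E2\<close> enters through
      both differences, with the factors \<open>-R\<close> and \<open>I * R / S * T = R\<close>, and
      cancels; the remaining terms combine to \<open>(1 - N) * E1\<close> since
      \<open>N = R * S * I * J\<close>.\<close>
    define E1 E2 where E: "E1 = A + B + C" "E2 = A * B + B * C + C * A"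
    have "(1 - R * A) * (1 - R * B) * (1 - R * C) = 1 - R * E1 + R * R * E2 - R * R * R * (A * B * C)"
      unfolding E by (simp add: algebra_simps)
    hence c1: "(1 - N) - (1 - R * A) * (1 - R * B) * (1 - R * C)
        = R * (E1 - S * I * J - R * E2 + R * R * (I * I * J))"
      unfolding ABC N_def by (simp add: algebra_simps)
    define T where "T = S / I"
    have IT: "I * T = S" using nz by (simp add: T_def)
    have "(1 - S * B * C / I) * (1 - S * A * C / I) * (1 - S * A * B / I)
        = (1 - T * (B * C)) * (1 - T * (A * C)) * (1 - T * (A * B))"
      by (simp add: T_def mult.assoc)
    also have "\<dots> = 1 - T * E2 + T * T * (A * B * C) * E1 - T * T * T * (A * B * C) * (A * B * C)"
      unfolding E by (simp add: algebra_simps)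
    also have "\<dots> = 1 - T * E2 + (I * T) * (I * T) * J * E1 - (I * T) * (I * T) * (I * T) * I * J * J"
      unfolding ABC by (simp add: mult_ac)
    finally have c2: "(1 - N) - (1 - S * B * C / I) * (1 - S * A * C / I) * (1 - S * A * B / I)
        = T * (E2 - R * I * I * J - I * J * S * E1 + I * I * J * J * S * S)"
    proof -
      assume "(1 - S * B * C / I) * (1 - S * A * C / I) * (1 - S * A * B / I)
        = 1 - T * E2 + (I * T) * (I * T) * J * E1 - (I * T) * (I * T) * (I * T) * I * J * J"
      thus ?thesis unfolding N_def IT[symmetric] by (simp add: algebra_simps)
    qed
    have T: "I * R / S * T = R" using nz by (simp add: T_def)
    have "(1 - N) * (x * (P - P1) + y * (P - P2) + z * P)
       = x * ((1 - N) * P - (1 - N) * P1) + y * ((1 - N) * P - (1 - N) * P2) + z * ((1 - N) * P)" for x y z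
      by (simp add: algebra_simps)
    hence "(1 - N) * (inverse R * (P - P1) + I * R / S * (P - P2) + I * J * S * P)
       = inverse R * ((1 - N) * P - (1 - N) * P1) + I * R / S * ((1 - N) * P - (1 - N) * P2) + I * J * S * ((1 - N) * P)" .
    also have "\<dots> = inverse R * ((1 - N) - (1 - R * A) * (1 - R * B) * (1 - R * C)) * P
        + I * R / S * ((1 - N) - (1 - S * B * C / I) * (1 - S * A * C / I) * (1 - S * A * B / I)) * P + I * J * S * ((1 - N) * P)"
      unfolding e1 e2 by (simp only: left_diff_distrib mult.assoc)
    also have "\<dots> = (inverse R * R) * (E1 - S * I * J - R * E2 + R * R * (I * I * J)) * P
        + (I * R / S * T) * (E2 - R * I * I * J - I * J * S * E1 + I * I * J * J * S * S) * P + I * J * S * ((1 - N) * P)"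
      unfolding c1 c2 by (simp only: mult.assoc)
    also have "\<dots> = (1 - N) * (E1 * P)"
      using nz unfolding T N_def by (simp add: algebra_simps)
    also have "\<dots> = (1 - N) * ((A + B + C) * P)" by (simp add: E)
    finally have "inverse R * (P - P1) + I * R / S * (P - P2) + I * J * S * P = (A + B + C) * P"
      using N1 by simp
    thus ?thesis unfolding toda_def d1 d2 P1_def[symmetric] P2_def[symmetric] n_def[symmetric] P_def[symmetric]
      by (simp add: powi_add powi_diff power_int_minus flip: defs)
  qed
qed

section \<open>Truncated convolution and its commutation with the Hamiltonian\<close>

definition qconv :: "(int \<Rightarrow> complex) \<Rightarrow> int \<Rightarrow> complex" where
  "qconv h L = (\<Sum>r\<in>{0..L}. rq q (L - r) * h r)"

lemma qconv_add: "qconv (\<lambda>r. f r + g r) L = qconv f L + qconv g L"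
  by (simp add: qconv_def distrib_left sum.distrib)

lemma qconv_diff: "qconv (\<lambda>r. f r - g r) L = qconv f L - qconv g L"
  by (simp add: qconv_def right_diff_distrib sum_subtractf)

lemma qconv_cmult: "qconv (\<lambda>r. c * f r) L = c * qconv f L"
  by (simp add: qconv_def sum_distrib_left mult_ac)

lemma qconv_cong: "(\<And>r. 0 \<le> r \<Longrightarrow> r \<le> L \<Longrightarrow> f r = g r) \<Longrightarrow> qconv f L = qconv g L"
  by (simp add: qconv_def)

lemma qconv_pred: "qconv h (L - 1) = (\<Sum>r\<in>{0..L}. rq q (L - 1 - r) * h r)"
  unfolding qconv_def
  by (rule sum.mono_neutral_left) (auto simp: rq_def)

lemma qconv_shift: "h (-1) = 0 \<Longrightarrow> qconv h (L - 1) = qconv (\<lambda>r. h (r - 1)) L"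
proof -
  assume h: "h (-1) = 0"
  have "qconv (\<lambda>r. h (r - 1)) L = (\<Sum>r\<in>{1..L}. rq q (L - r) * h (r - 1))"
    unfolding qconv_def by (rule sum.mono_neutral_right) (use h in \<open>auto simp: not_le intro: Nat.gr0I\<close>, smt (verit) h)
  also have "\<dots> = qconv h (L - 1)"
    unfolding qconv_def by (rule sum.reindex_bij_witness[of _ "\<lambda>r. r + 1" "\<lambda>r. r - 1"]) (auto simp: algebra_simps)
  finally show ?thesis by simp
qed

text \<open>The difference in \<open>L\<close> acts on the kernel alone:
  \<open>rq q (L - r) - rq q (L - r - 1)\<close> is \<open>q^(L - r) * rq q (L - r)\<close>. So a
  difference operator outside the convolution becomes a multiplication inside.\<close>

lemma qconv_minus_pred: "q powi (-L) * (qconv h L - qconv h (L - 1)) = qconv (\<lambda>r. q powi (-r) * h r) L"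
proof -
  have "qconv h L - qconv h (L - 1) = (\<Sum>r\<in>{0..L}. q powi (L - r) * rq q (L - r) * h r)"
    unfolding qconv_pred unfolding qconv_def sum_subtractf[symmetric]
  proof (rule sum.cong[OF refl])
    fix r assume "r \<in> {0..L}"
    have "rq q (L - 1 - r) = (1 - q powi (L - r)) * rq q (L - r)"
      using rq_rec[of "L - r"] by (simp add: algebra_simps)
    thus "rq q (L - r) * h r - rq q (L - 1 - r) * h r = q powi (L - r) * rq q (L - r) * h r"
      by (simp only:) (simp add: algebra_simps)
  qed
  thus ?thesis
    by (simp add: qconv_def sum_distrib_left powi_diff power_int_minus field_simps)
qed

text \<open>The dual rule, multiplication outside becoming a difference inside, by applying
  \<open>qconv_minus_pred\<close> to \<open>q^r * h r\<close>. The condition at -1 removes the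
  boundary term of the shift.\<close>

lemma powi_qconv:
  assumes "h (-1) = 0"
  shows "q powi L * qconv h L = qconv (\<lambda>r. q powi r * h r - q powi (r - 1) * h (r - 1)) L"
proof -
  have "q powi (-L) * (qconv (\<lambda>r. q powi r * h r) L - qconv (\<lambda>r. q powi r * h r) (L - 1)) = qconv h L"
    unfolding qconv_minus_pred by (rule qconv_cong) (simp add: power_int_minus)
  hence "q powi L * qconv h L = qconv (\<lambda>r. q powi r * h r) L - qconv (\<lambda>r. q powi r * h r) (L - 1)"
    by (auto simp: power_int_minus field_simps)
  also have "qconv (\<lambda>r. q powi r * h r) (L - 1) = qconv (\<lambda>r. q powi (r - 1) * h (r - 1)) L"
    by (rule qconv_shift) (use assms in simp)
  finally show ?thesis by (simp add: qconv_diff)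
qed

definition bstep :: "int \<Rightarrow> int \<Rightarrow> (int \<Rightarrow> int \<Rightarrow> complex) \<Rightarrow> int \<Rightarrow> int \<Rightarrow> complex" where
  "bstep i j g L M = qconv (\<lambda>r. qconv (\<lambda>s. q powi (r\<^sup>2 - r * s + s\<^sup>2 + i * r + j * s) * g r s) M) L"

lemma bstep_swap: "bstep i j g L M = bstep j i (\<lambda>r s. g s r) M L"
proof -
  have "bstep i j g L M = (\<Sum>r\<in>{0..L}. \<Sum>s\<in>{0..M}. rq q (L - r) * rq q (M - s) * (q powi (r\<^sup>2 - r * s + s\<^sup>2 + i * r + j * s) * g r s))"
    by (simp add: bstep_def qconv_def sum_distrib_left mult_ac)
  also have "\<dots> = (\<Sum>s\<in>{0..M}. \<Sum>r\<in>{0..L}. rq q (L - r) * rq q (M - s) * (q powi (r\<^sup>2 - r * s + s\<^sup>2 + i * r + j * s) * g r s))"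
    by (rule sum.swap)
  also have "\<dots> = bstep j i (\<lambda>r s. g s r) M L"
    by (simp add: bstep_def qconv_def sum_distrib_left mult_ac add_ac) (simp add: algebra_simps)
  finally show ?thesis .
qed

text \<open>Pulling the three terms of the Hamiltonian through the convolutions turns
  multiplications into differences and conversely, so the shifts appear in other terms than before.
  The Gaussian exponent is made so that this mismatch is repaired when a shift passes through
  it.\<close>

lemma bstep_toda:
  assumes "\<And>r s. r < 0 \<or> s < 0 \<Longrightarrow> g r s = 0"
  shows "toda i j (bstep i j g) L M = bstep i j (toda i j g) L M"
proof -
  define g' where "g' = (\<lambda>r s. q powi (r\<^sup>2 - r * s + s\<^sup>2 + i * r + j * s) * g r s)"
  have g0: "g' r s = 0" if "r < 0 \<or> s < 0" for r s using assms[OF that] by (simp add: g'_def)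
  define G where "G = bstep i j g"
  have G: "G L M = qconv (\<lambda>r. qconv (g' r) M) L" for L M by (simp add: G_def bstep_def g'_def)
  have t1: "q powi (-L) * (G L M - G (L - 1) M) = qconv (\<lambda>r. qconv (\<lambda>s. q powi (-r) * g' r s) M) L"
    unfolding G qconv_minus_pred qconv_cmult ..
  have "q powi (i + L - M) * (G L M - G L (M - 1)) = q powi i * (q powi L * qconv (\<lambda>r. q powi (-M) * (qconv (g' r) M - qconv (g' r) (M - 1))) L)"
    unfolding G qconv_cmult qconv_diff by (simp add: powi_add powi_diff power_int_minus divide_simps)
  also have "\<dots> = q powi i * (qconv (\<lambda>r. q powi r * qconv (\<lambda>s. q powi (-s) * g' r s) M - q powi (r - 1) * qconv (\<lambda>s. q powi (-s) * g' (r - 1) s) M) L)"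
    unfolding qconv_minus_pred by (subst powi_qconv) (simp_all add: g0 qconv_def)
  also have "\<dots> = qconv (\<lambda>r. qconv (\<lambda>s. q powi i * (q powi r * (q powi (-s) * g' r s) - q powi (r - 1) * (q powi (-s) * g' (r - 1) s))) M) L"
    by (simp add: qconv_cmult qconv_diff)
  finally have t2: "q powi (i + L - M) * (G L M - G L (M - 1)) = \<dots>" .
  have "q powi (i + j + M) * G L M = q powi (i + j) * qconv (\<lambda>r. q powi M * qconv (g' r) M) L"
    unfolding G by (simp add: powi_add qconv_cmult)
  also have "\<dots> = qconv (\<lambda>r. qconv (\<lambda>s. q powi (i + j) * (q powi s * g' r s - q powi (s - 1) * g' r (s - 1))) M) L"
    by (subst powi_qconv) (simp_all add: g0 qconv_cmult)
  finally have t3: "q powi (i + j + M) * G L M = \<dots>" .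
  show ?thesis
    unfolding toda_def G_def[symmetric] t1 t2 t3 unfolding qconv_add[symmetric] bstep_def
  proof (intro qconv_cong, goal_cases)
    case (1 r s)
    \<comment> \<open>The shift in \<open>r\<close> required by the first term of the Hamiltonian is
      supplied by its second term; likewise \<open>e2\<close> takes the shift in \<open>s\<close>
      from the third term.\<close>
    have e1: "q powi (-r) * (q powi (r\<^sup>2 - r * s + s\<^sup>2 + i * r + j * s) * g (r - 1) s)
      = q powi i * (q powi (r - 1) * (q powi (-s) * g' (r - 1) s))"
      unfolding g'_def mult.assoc[symmetric] powi_add[symmetric]
      by (simp add: algebra_simps power2_eq_square)
    have e2: "q powi (i + r - s) * (q powi (r\<^sup>2 - r * s + s\<^sup>2 + i * r + j * s) * g r (s - 1))
      = q powi (i + j) * (q powi (s - 1) * g' r (s - 1))"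
      unfolding g'_def mult.assoc[symmetric] powi_add[symmetric]
      by (simp add: algebra_simps power2_eq_square)
    define E where "E = q powi (r\<^sup>2 - r * s + s\<^sup>2 + i * r + j * s)"
    have "E * toda i j g r s = q powi (-r) * (E * g r s) - q powi (-r) * (E * g (r - 1) s)
        + q powi (i + r - s) * (E * g r s) - q powi (i + r - s) * (E * g r (s - 1)) + q powi (i + j + s) * (E * g r s)"
      by (simp add: toda_def algebra_simps)
    also have "\<dots> = q powi (-r) * g' r s + q powi i * (q powi r * (q powi (-s) * g' r s) - q powi (r - 1) * (q powi (-s) * g' (r - 1) s))
        + q powi (i + j) * (q powi s * g' r s - q powi (s - 1) * g' r (s - 1))"
    proof -
      have e3: "q powi (i + r - s) * (E * g r s) = q powi i * (q powi r * (q powi (-s) * g' r s))"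
        unfolding g'_def E_def mult.assoc[symmetric] powi_add[symmetric] by (simp add: algebra_simps)
      have e4: "q powi (i + j + s) * (E * g r s) = q powi (i + j) * (q powi s * g' r s)"
        unfolding g'_def E_def mult.assoc[symmetric] powi_add[symmetric] by (simp add: algebra_simps)
      have e5: "E * g r s = g' r s" by (simp add: E_def g'_def)
      show ?thesis unfolding e3 e4 e1[folded E_def] e2[folded E_def] unfolding e5
        by (simp add: right_diff_distrib)
    qed
    finally show ?case unfolding toda_def E_def by simp
  qed
qed

section \<open>Uniqueness of joint eigenfunctions and the eigenvalue of the Bailey step\<close>

lemma tri_support:
  assumes "tri q (r + s + i + j) (r + a) (r + b) (r + c) \<noteq> 0"
  shows "r \<ge> - a" "r \<ge> - b" "r \<ge> - c" "s \<ge> a - i - j" "s \<ge> b - i - j" "s \<ge> c - i - j"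
  using tri_nonzeroD[OF assms] by linarith+

text \<open>Equal elementary symmetric functions mean equal monic cubics, so \<open>x\<close> is a
  root of the cubic with roots \<open>A\<close>, \<open>B\<close>, \<open>C\<close>.\<close>

lemma root_of_equal_symmetric_functions:
  fixes x y z A B C :: complex
  assumes "x + y + z = A + B + C" "x * y * z = A * B * C" "x * y + y * z + z * x = A * B + B * C + C * A"
  shows "x = A \<or> x = B \<or> x = C"
proof -
  have "(x - A) * (x - B) * (x - C) = x^3 - (A + B + C) * x^2 + (A * B + B * C + C * A) * x - A * B * C"
    by (simp add: algebra_simps power2_eq_square power3_eq_cube)
  also have "\<dots> = 0" unfolding assms[symmetric] by (simp add: algebra_simps power2_eq_square power3_eq_cube)
  finally show ?thesis by simp
qed

text \<open>
  At a minimal point of the support the two eigenvalue equations and the product relation force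
  \<open>{-r, i+r-s, i+j+s} = {a, b, c}\<close>, which happens only at the leading point.
\<close>

lemma toda_unique:
  assumes abc: "a + b + c = 2 * i + j" "c \<le> b" "b \<le> a"
    and h1: "\<And>r s. toda i j g r s = (q powi a + q powi b + q powi c) * g r s"
    and h2: "\<And>r s. toda j i (\<lambda>s r. g r s) s r = (q powi (i + j - a) + q powi (i + j - b) + q powi (i + j - c)) * g r s"
    and supp: "\<And>r s. r < - c \<or> s < a - i - j \<Longrightarrow> g r s = 0"
    and lead: "g (- c) (a - i - j) = 0"
  shows "g r s = 0"
proof (induction "nat (r + c) + nat (s - (a - i - j))" arbitrary: r s rule: less_induct)
  case less
  show ?case
  proof (rule ccontr)
    assume nz: "g r s \<noteq> 0"
    with supp have rs: "r \<ge> - c" "s \<ge> a - i - j" by (metis not_le)+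
    \<comment> \<open>By the induction hypothesis, or by the support condition on the boundary, both
      neighbours vanish, so the Hamiltonians act at this point by mere multiplication.\<close>
    have z1: "g (r - 1) s = 0" using less[of "r - 1" s] rs supp[of "r - 1" s] by (cases "r = - c") auto
    have z2: "g r (s - 1) = 0" using less[of r "s - 1"] rs supp[of r "s - 1"] by (cases "s = a - i - j") auto
    define x y z where xyz: "x = q powi (-r)" "y = q powi (i + r - s)" "z = q powi (i + j + s)"
    define A B C where ABC: "A = q powi a" "B = q powi b" "C = q powi c"
    have "(x + y + z) * g r s = (A + B + C) * g r s"
      using h1[of r s] unfolding toda_def z1 z2 xyz ABC by (simp add: algebra_simps)
    hence 1: "x + y + z = A + B + C" using nz by simp
    have 2: "x * y * z = A * B * C" unfolding xyz ABC powi_add[symmetric] abc by simp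
    have "(q powi (-s) + q powi (j + s - r) + q powi (i + j + r)) * g r s =
       (q powi (i + j - a) + q powi (i + j - b) + q powi (i + j - c)) * g r s"
      using h2[of s r] unfolding toda_def z1 z2 by (simp add: algebra_simps)
    hence "q powi (-s) + q powi (j + s - r) + q powi (i + j + r) =
       q powi (i + j - a) + q powi (i + j - b) + q powi (i + j - c)" using nz by simp
    \<comment> \<open>Since \<open>i + j - a = b + c - i\<close>, multiplication by
      \<open>q^i\<close> turns the second eigenvalue into the second elementary symmetric function
      of \<open>A\<close>, \<open>B\<close>, \<open>C\<close>.\<close>
    hence "q powi i * (q powi (-s) + q powi (j + s - r) + q powi (i + j + r)) =
       q powi i * (q powi (i + j - a) + q powi (i + j - b) + q powi (i + j - c))" by simp
    hence "q powi (i-s) + q powi (i + j + s - r) + q powi (2 * i + j + r) =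
       q powi (b + c) + q powi (a + c) + q powi (a + b)"
    proof -
      have x: "b + c = i + (i + j - a)" "a + c = i + (i + j - b)" "a + b = i + (i + j - c)" using abc(1) by simp_all
      assume "q powi i * (q powi (-s) + q powi (j + s - r) + q powi (i + j + r)) =
       q powi i * (q powi (i + j - a) + q powi (i + j - b) + q powi (i + j - c))"
      thus ?thesis unfolding x unfolding distrib_left powi_add[symmetric] by (simp add: algebra_simps)
    qed
    hence 3: "x * y + y * z + z * x = A * B + B * C + C * A"
      unfolding xyz ABC powi_add[symmetric] by (simp add: algebra_simps)
    have "x = A \<or> x = B \<or> x = C" using root_of_equal_symmetric_functions 1 2 3 by blast
    \<comment> \<open>From \<open>-r <= c\<close> and \<open>c <= b <= a\<close>, equality with any
      of the three exponents forces equality with \<open>c\<close>; the next case is the mirror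
      image with \<open>a\<close>.\<close>
    hence "-r = c" unfolding xyz ABC powi_inj using rs abc(2,3) by linarith
    moreover have "z = A \<or> z = B \<or> z = C"
      by (rule root_of_equal_symmetric_functions[of z x y]) (use 1 2 3 in \<open>simp_all add: algebra_simps\<close>)
    hence "i + j + s = a" unfolding xyz ABC powi_inj using rs abc(2,3) by linarith
    ultimately show False using lead nz by (metis add_diff_cancel_left' diff_diff_add minus_minus)
  qed
qed

text \<open>The two sides are eigenfunctions with the same eigenvalues and agree at the leading
  point \<open>(-c, a - i - j)\<close>, so their difference is zero by \<open>toda_unique\<close>.
  The sign conditions on \<open>c\<close> and \<open>a\<close> put the whole support into
  \<open>r, s >= 0\<close>, so the truncation of the sums at 0 loses nothing and the step commutes
  with both Hamiltonians.\<close>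

lemma bstep_tri_sorted:
  assumes abc: "a + b + c = 2 * i + j" "c \<le> b" "b \<le> a" "c \<le> 0" "i + j \<le> a"
    and e: "2 * e = a\<^sup>2 + b\<^sup>2 + c\<^sup>2 - 2 * i\<^sup>2 - 2 * i * j - j\<^sup>2"
  shows "bstep i j (\<lambda>r s. tri q (r + s + i + j) (r + a) (r + b) (r + c)) L M =
    q powi e * tri q (L + M + i + j) (L + a) (L + b) (L + c)"
proof -
  define P where "P = (\<lambda>r s. tri q (r + s + i + j) (r + a) (r + b) (r + c))"
  define g where "g = (\<lambda>r s. bstep i j P r s - q powi e * P r s)"
  have P0: "P r s = 0" if "r < - c \<or> s < a - i - j" for r s
    using tri_support[of r s i j a b c] that abc unfolding P_def by linarith
  have P0': "P r s = 0" if "r < 0 \<or> s < 0" for r s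
    using P0[of r s] that abc by linarith
  have S0: "bstep i j P r s = 0" if "r < - c \<or> s < a - i - j" for r s
  proof -
    have "P x y = 0" if "x \<le> r" "y \<le> s" for x y
      by (rule P0) (use that \<open>r < - c \<or> s < a - i - j\<close> in linarith)
    thus ?thesis by (simp add: bstep_def qconv_def)
  qed
  have Pswap: "P r s = tri q (s + r + j + i) (s + (i + j - a)) (s + (i + j - b)) (s + (i + j - c))" for r s
    unfolding P_def tri_def by (simp add: algebra_simps)
  have tP: "toda i j P r s = (q powi a + q powi b + q powi c) * P r s" for r s
    unfolding P_def by (rule toda_tri[OF abc(1)])
  have tP': "toda j i (\<lambda>s r. P r s) s r = (q powi (i + j - a) + q powi (i + j - b) + q powi (i + j - c)) * P r s" for r s
    unfolding Pswap by (rule toda_tri) (use abc in simp)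
  have lin: "toda i j (\<lambda>r s. f r s - c * h r s) r s = toda i j f r s - c * toda i j h r s" for i j f h c r s
    by (simp add: toda_def algebra_simps)
  have scale: "bstep i j (\<lambda>r s. c * f r s) L M = c * bstep i j f L M" for i j c f L M
    unfolding bstep_def by (simp add: qconv_def sum_distrib_left mult_ac)
  have "g r s = 0" for r s
  proof (rule toda_unique[OF abc(1-3)])
    show "toda i j g r s = (q powi a + q powi b + q powi c) * g r s" for r s
    proof -
      have "toda i j (bstep i j P) r s = bstep i j (toda i j P) r s"
        by (rule bstep_toda) (use P0' in blast)
      also have "toda i j P = (\<lambda>r s. (q powi a + q powi b + q powi c) * P r s)"
        by (intro ext tP)
      finally show ?thesis unfolding g_def lin tP scale by (simp add: algebra_simps)
    qed
    have sw: "(\<lambda>s r. bstep i j P r s) = bstep j i (\<lambda>s r. P r s)"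
      by (intro ext, rule bstep_swap)
    have "toda j i (\<lambda>s r. bstep i j P r s) s r = bstep j i (toda j i (\<lambda>s r. P r s)) s r" for r s
      unfolding sw by (rule bstep_toda) (use P0' in blast)
    moreover have "toda j i (\<lambda>s r. P r s) = (\<lambda>s r. (q powi (i + j - a) + q powi (i + j - b) + q powi (i + j - c)) * P r s)"
      by (intro ext tP')
    ultimately have "toda j i (\<lambda>s r. bstep i j P r s) s r = (q powi (i + j - a) + q powi (i + j - b) + q powi (i + j - c)) * bstep i j P r s" for r s
      by (simp only: scale flip: bstep_swap[of i j])
    thus "toda j i (\<lambda>s r. g r s) s r = (q powi (i + j - a) + q powi (i + j - b) + q powi (i + j - c)) * g r s" for r s
      unfolding g_def lin tP' by (simp add: algebra_simps)
    show "g r s = 0" if "r < - c \<or> s < a - i - j" for r s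
      using that by (simp add: g_def S0 P0)
    \<comment> \<open>At the leading point the support leaves a single term of the double sum, with
      kernel factors 1; its Gaussian factor is the eigenvalue.\<close>
    have "bstep i j P (-c) (a - i - j) = q powi (c\<^sup>2 - (-c) * (a - i - j) + (a - i - j)\<^sup>2 + i * (-c) + j * (a - i - j)) * P (-c) (a - i - j)"
    proof -
      have "bstep i j P (-c) (a - i - j) = qconv (\<lambda>s. q powi ((-c)\<^sup>2 - (-c) * s + s\<^sup>2 + i * (-c) + j * s) * P (-c) s) (a - i - j)"
        unfolding bstep_def qconv_def[of _ "-c"]
        by (subst sum.remove[of _ "-c"]) (use abc in \<open>auto intro!: sum.neutral simp: qconv_def P0\<close>)
      also have "\<dots> = q powi ((-c)\<^sup>2 - (-c) * (a - i - j) + (a - i - j)\<^sup>2 + i * (-c) + j * (a - i - j)) * P (-c) (a - i - j)"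
        unfolding qconv_def
        by (subst sum.remove[of _ "a - i - j"]) (use abc in \<open>auto intro!: sum.neutral simp: P0\<close>)
      finally show ?thesis by simp
    qed
    moreover have "c\<^sup>2 - (-c) * (a - i - j) + (a - i - j)\<^sup>2 + i * (-c) + j * (a - i - j) = e"
    proof -
      have b: "b = 2 * i + j - a - c" using abc by simp
      have "2 * (c\<^sup>2 - (-c) * (a - i - j) + (a - i - j)\<^sup>2 + i * (-c) + j * (a - i - j)) = 2 * e"
        unfolding e b by (simp add: algebra_simps power2_eq_square)
      thus ?thesis by (metis mult_cancel_left zero_neq_numeral)
    qed
    ultimately show "g (-c) (a - i - j) = 0" unfolding g_def by simp
  qed
  thus ?thesis unfolding g_def P_def by simp
qed

text \<open>Sorting is no restriction because \<open>tri\<close> is symmetric; the exponent is fixed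
  by its double to avoid a division.\<close>

lemma bstep_tri:
  assumes abc: "a + b + c = 2 * i + j" "min a (min b c) \<le> 0" "i + j \<le> max a (max b c)"
    and e: "2 * e = a\<^sup>2 + b\<^sup>2 + c\<^sup>2 - 2 * i\<^sup>2 - 2 * i * j - j\<^sup>2"
  shows "bstep i j (\<lambda>r s. tri q (r + s + i + j) (r + a) (r + b) (r + c)) L M =
    q powi e * tri q (L + M + i + j) (L + a) (L + b) (L + c)"
proof -
  have p: "tri q n x z y = tri q n x y z" "tri q n y x z = tri q n x y z" "tri q n y z x = tri q n x y z"
    "tri q n z x y = tri q n x y z" "tri q n z y x = tri q n x y z" for n x y z
    by (metis tri_perm)+
  consider "c \<le> b" "b \<le> a" | "b \<le> c" "c \<le> a" | "c \<le> a" "a \<le> b" | "a \<le> c" "c \<le> b" | "a \<le> b" "b \<le> c" | "b \<le> a" "a \<le> c"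
    by linarith
  thus ?thesis
  proof cases
    case 1 show ?thesis by (rule bstep_tri_sorted) (use 1 abc e in auto)
  next
    case 2 show ?thesis using bstep_tri_sorted[of a c b i j e L M] 2 abc e by (auto simp: p)
  next
    case 3 show ?thesis using bstep_tri_sorted[of b a c i j e L M] 3 abc e by (auto simp: p(2))
  next
    case 4 show ?thesis using bstep_tri_sorted[of b c a i j e L M] 4 abc e by (auto simp: p(3))
  next
    case 5 show ?thesis using bstep_tri_sorted[of c b a i j e L M] 5 abc e by (auto simp: p(5))
  next
    case 6 show ?thesis using bstep_tri_sorted[of c a b i j e L M] 6 abc e by (auto simp: p(4))
  qed
qed

end

lemma has_sum_minus:
  fixes f g :: "'a \<Rightarrow> complex"
  assumes "(f has_sum a) A" "(g has_sum b) A"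
  shows "((\<lambda>x. f x - g x) has_sum (a - b)) A"
  using has_sum_add[OF assms(1) has_sum_uminusI[OF assms(2)]] by simp

section \<open>The seed\<close>

text \<open>The nontrivial character modulo 3. The entries \<open>v\<close>, \<open>w\<close>,
  \<open>-v-w\<close> are distinct modulo 3 exactly when 3 does not divide \<open>v - w\<close>, and
  \<open>chi3 (v - w)\<close> is then the sign of the permutation of residues relative to
  (1,0,-1).\<close>

definition chi3 :: "int \<Rightarrow> complex" where
  "chi3 n = (if n mod 3 = 1 then 1 else if n mod 3 = 2 then -1 else 0)"

lemma chi3_minus: "chi3 (- n) = - chi3 n"
proof -
  have "(- n) mod 3 = (if n mod 3 = 0 then 0 else 3 - n mod 3)" by (simp add: zmod_zminus1_eq_if)
  moreover have "n mod 3 \<in> {0, 1, 2}" by auto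
  ultimately show ?thesis by (auto simp: chi3_def)
qed

lemma chi3_add_mult: "chi3 (n + 3 * m) = chi3 n"
  by (simp add: chi3_def)

context nome begin

text \<open>
  The third coordinate of the summation vector is \<open>- v - w\<close>. For \<open>v - w\<close> prime to 3 the division by 3
  in the exponent is exact; otherwise the coefficient vanishes.
\<close>

definition seed_coeff :: "int \<Rightarrow> int \<Rightarrow> complex" where
  "seed_coeff v w = chi3 (v - w) * q powi ((2 * (v\<^sup>2 + v * w + w\<^sup>2) - 2) div 3)"

lemma seed_coeff_swap12: "seed_coeff w v = - seed_coeff v w"
  using chi3_minus[of "v - w"] unfolding seed_coeff_def by (simp add: algebra_simps)

lemma seed_coeff_swap23: "seed_coeff v (- v - w) = - seed_coeff v w"
proof -
  have "v - (- v - w) = - (v - w) + 3 * v" by simp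
  hence "chi3 (v - (- v - w)) = - chi3 (v - w)" by (simp only: chi3_add_mult chi3_minus)
  moreover have "v\<^sup>2 + v * (- v - w) + (- v - w)\<^sup>2 = v\<^sup>2 + v * w + w\<^sup>2"
    by (simp add: algebra_simps power2_eq_square)
  ultimately show ?thesis unfolding seed_coeff_def by (simp only: mult_minus_left)
qed

text \<open>The translation by (1,1,-2) keeps \<open>v - w\<close> and changes the numerator of the
  exponent by a multiple of 3, so the integer division causes no error even where it is not
  exact.\<close>

lemma seed_coeff_translate: "seed_coeff (v + 1) (w + 1) = seed_coeff v w * q powi (2 * (v + w) + 2)"
proof -
  have "2 * ((v + 1)\<^sup>2 + (v + 1) * (w + 1) + (w + 1)\<^sup>2) - 2 = (2 * (v\<^sup>2 + v * w + w\<^sup>2) - 2) + (2 * (v + w) + 2) * 3"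
    by (simp add: algebra_simps power2_eq_square)
  hence "(2 * ((v + 1)\<^sup>2 + (v + 1) * (w + 1) + (w + 1)\<^sup>2) - 2) div 3 = (2 * (v\<^sup>2 + v * w + w\<^sup>2) - 2) div 3 + (2 * (v + w) + 2)"
    by (simp only: div_mult_self1 zero_neq_numeral not_False_eq_True)
  thus ?thesis unfolding seed_coeff_def by (simp only: powi_add mult.assoc add_diff_cancel_right)
qed

lemma summable_tri:
  "(\<lambda>(v, w). f v w * tri q n (a + v) (b + w) (c - v - w)) summable_on UNIV"
proof (rule finite_nonzero_values_imp_summable_on)
  have "{x \<in> UNIV. (case x of (v, w) \<Rightarrow> f v w * tri q n (a + v) (b + w) (c - v - w)) \<noteq> 0} \<subseteq> {-a..n-a} \<times> {-b..n-b}"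
  proof clarify
    fix v w assume "f v w * tri q n (a + v) (b + w) (c - v - w) \<noteq> 0"
    hence "tri q n (a + v) (b + w) (c - v - w) \<noteq> 0" by simp
    from tri_nonzeroD[OF this] show "v \<in> {-a..n-a} \<and> w \<in> {-b..n-b}" by auto
  qed
  thus "finite {x \<in> UNIV. (case x of (v, w) \<Rightarrow> f v w * tri q n (a + v) (b + w) (c - v - w)) \<noteq> 0}"
    by (rule finite_subset) simp
qed

section \<open>Signed Gaussian sums with a linear weight\<close>

abbreviation brt :: "int \<Rightarrow> int \<Rightarrow> int \<Rightarrow> int \<Rightarrow> int \<Rightarrow> int \<times> int \<Rightarrow> complex" where
  "brt a b c r s \<equiv> (\<lambda>(v, w). seed_coeff v w * q powi (a * v + b * w + c * (- v - w)) * tri q (r + s) (r + v) (r + w) (r - v - w))"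

text \<open>The weight \<open>(a, b, c)\<close> behaves like the exponent of an alternant:
  antisymmetry of \<open>seed_coeff\<close> makes the sum antisymmetric in the weight, hence zero
  for repeated entries, and adding a constant to all three entries changes nothing because the
  vector has sum zero.\<close>

definition br :: "int \<Rightarrow> int \<Rightarrow> int \<Rightarrow> int \<Rightarrow> int \<Rightarrow> complex" where
  "br a b c r s = (\<Sum>\<^sub>\<infinity>(v, w). seed_coeff v w * q powi (a * v + b * w + c * (- v - w)) * tri q (r + s) (r + v) (r + w) (r - v - w))"

lemma br_has_sum:
  "((brt a b c r s)
     has_sum br a b c r s) UNIV"
  unfolding br_def by (rule has_sum_infsum[OF summable_tri])

lemma br_swap12: "br b a c r s = - br a b c r s"
proof -
  have "((brt b a c r s)
     has_sum br b a c r s) UNIV" by (rule br_has_sum)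
  also have "?this \<longleftrightarrow> ((\<lambda>(v, w). - (seed_coeff v w * q powi (a * v + b * w + c * (- v - w)) * tri q (r + s) (r + v) (r + w) (r - v - w)))
     has_sum br b a c r s) UNIV"
  proof (rule has_sum_reindex_bij_witness[of _ "\<lambda>(v, w). (w, v)" "\<lambda>(v, w). (w, v)"], goal_cases)
    case (5 x)
    obtain v w where x: "x = (v, w)" by force
    show ?case unfolding x prod.case seed_coeff_swap12[of v w]
      by (simp add: algebra_simps tri_perm(1)[of q "r + s" "r + v" "r + w"])
  qed auto
  finally show ?thesis
    using br_has_sum[of a b c r s, THEN has_sum_uminusI]
    by (auto simp: case_prod_unfold dest: has_sum_unique)
qed

lemma br_swap23: "br a c b r s = - br a b c r s"
proof -
  have "((brt a c b r s)
     has_sum br a c b r s) UNIV" by (rule br_has_sum)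
  also have "?this \<longleftrightarrow> ((\<lambda>(v, w). - (seed_coeff v w * q powi (a * v + b * w + c * (- v - w)) * tri q (r + s) (r + v) (r + w) (r - v - w)))
     has_sum br a c b r s) UNIV"
  proof (rule has_sum_reindex_bij_witness[of _ "\<lambda>(v, w). (v, - v - w)" "\<lambda>(v, w). (v, - v - w)"], goal_cases)
    case (5 x)
    obtain v w where x: "x = (v, w)" by force
    show ?case unfolding x prod.case seed_coeff_swap23
      by (simp add: algebra_simps tri_perm(2)[of q "r + s" "r + v" "r + w"])
  qed auto
  finally show ?thesis
    using br_has_sum[of a b c r s, THEN has_sum_uminusI]
    by (auto simp: case_prod_unfold dest: has_sum_unique)
qed

lemma br_eq_0: "br a a c r s = 0" "br a b b r s = 0" "br a b a r s = 0"
proof -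
  have *: "x = 0" if "x = - x" for x :: complex using that by (simp add: equal_neg_zero)
  show "br a a c r s = 0" by (rule *) (rule br_swap12)
  show "br a b b r s = 0" by (rule *) (rule br_swap23)
  have "br a b a r s = - br a a b r s" by (rule br_swap23)
  also have "br a a b r s = 0" by (rule *) (rule br_swap12)
  finally show "br a b a r s = 0" by simp
qed

text \<open>(1,0,2) is an even permutation of (2,1,0), which is (1,0,-1) raised by 1 in every
  entry.\<close>

lemma br_102: "br 1 0 2 r s = br 1 0 (-1) r s"
proof -
  have "br 1 0 2 r s = br 2 1 0 r s" using br_swap12[of 1 0 2 r s] br_swap12[of 2 0 1 r s] br_swap23[of 0 1 2 r s] br_swap23[of 2 1 0 r s]
     br_swap12[of 0 2 1 r s] by (metis minus_minus br_swap12 br_swap23)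
  also have "\<dots> = br 1 0 (-1) r s"
    unfolding br_def by (simp add: algebra_simps)
  finally show ?thesis .
qed

text \<open>Each summand of the eigenvalue \<open>q^v + q^w + q^(-v-w)\<close> raises one entry of
  the weight by 1.\<close>

lemma br_toda: "toda 0 0 (br a b c) r s = br (a + 1) b c r s + br a (b + 1) c r s + br a b (c + 1) r s"
proof -
  define m where "m = (\<lambda>v w. seed_coeff v w * q powi (a * v + b * w + c * (- v - w)))"
  define t where "t = (\<lambda>v w r s. tri q (r + s) (r + v) (r + w) (r - v - w))"
  have h: "((\<lambda>(v, w). m v w * t v w r s) has_sum br a b c r s) UNIV" for r s
    using br_has_sum[of a b c r s] by (simp add: m_def t_def)
  have "((\<lambda>x. q powi (-r) * ((\<lambda>(v, w). m v w * t v w r s) x - (\<lambda>(v, w). m v w * t v w (r - 1) s) x)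
     + q powi (0 + r - s) * ((\<lambda>(v, w). m v w * t v w r s) x - (\<lambda>(v, w). m v w * t v w r (s - 1)) x)
     + q powi (0 + 0 + s) * (\<lambda>(v, w). m v w * t v w r s) x) has_sum toda 0 0 (br a b c) r s) UNIV"
    unfolding toda_def by (intro has_sum_add has_sum_cmult_right has_sum_minus h)
  also have "?this \<longleftrightarrow> ((\<lambda>x. (brt (a + 1) b c r s) x
      + (brt a (b + 1) c r s) x
      + (brt a b (c + 1) r s) x) has_sum toda 0 0 (br a b c) r s) UNIV"
  proof (rule has_sum_cong, goal_cases)
    case (1 x)
    obtain v w where x: "x = (v, w)" by force
    have e: "toda 0 0 (t v w) r s = (q powi v + q powi w + q powi (- v - w)) * t v w r s"
      using toda_tri[of v w "- v - w" 0 0 r s] unfolding t_def by (simp add: algebra_simps)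
    have "q powi (-r) * (m v w * t v w r s - m v w * t v w (r - 1) s)
        + q powi (0 + r - s) * (m v w * t v w r s - m v w * t v w r (s - 1)) + q powi (0 + 0 + s) * (m v w * t v w r s)
       = m v w * toda 0 0 (t v w) r s"
      unfolding toda_def by (simp add: algebra_simps)
    also have "\<dots> = seed_coeff v w * (q powi (a * v + b * w + c * (- v - w)) * q powi v) * t v w r s
        + seed_coeff v w * (q powi (a * v + b * w + c * (- v - w)) * q powi w) * t v w r s
        + seed_coeff v w * (q powi (a * v + b * w + c * (- v - w)) * q powi (- v - w)) * t v w r s"
      unfolding e m_def by (simp add: algebra_simps)
    finally show ?case unfolding x prod.case powi_add[symmetric] t_def
      by (simp add: algebra_simps)
  qed
  finally show ?thesis
    by (rule has_sum_unique) (intro has_sum_add br_has_sum)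
qed

text \<open>
  Both sides evaluate the same sum, before and after the shift \<open>(v,w) \<mapsto> (v+1,w+1)\<close>; antisymmetry removes
  all but two of the four terms on each side.
\<close>

lemma br_recurrence:
  "(1 - q powi (3 * s - 3)) * br 1 0 (-1) r s =
    q powi (-1) * ((q powi (-1) + q powi (-2) + q powi (-3)) * q powi (2 * r + 2) * br 1 0 (-1) (r + 1) (s - 1)
       - q powi (3 * r) * toda 0 0 (br 1 0 (-1)) (r + 1) (s - 1))"
proof -
  define n where "n = r + s"
  \<comment> \<open>Only the pair of the third coordinate has total \<open>n - 3\<close> instead of
    \<open>n\<close>. Before the translation the missing 3 is charged to
    \<open>n - (r - v - w)\<close>, after it to \<open>r - v - w\<close> with \<open>r\<close>
    replaced by \<open>r + 1\<close>. Either way three lowerings give a cubic in a power of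
    \<open>q\<close>, whose four coefficients produce four weights in the third entry.\<close>
  define G where "G = (\<lambda>v w. seed_coeff v w * q powi (v + 2 * (- v - w)) * (qfac q n * (rq q (r + v) * rq q (n - (r + v)))
     * (rq q (r + w) * rq q (n - (r + w))) * (rq q (r - v - w) * rq q (n - 3 - (r - v - w)))))"
  define X where "X = br 1 0 2 r s - (1 + q powi (-1) + q powi (-2)) * q powi s * br 1 0 1 r s
       + (q powi (-1) + q powi (-2) + q powi (-3)) * q powi (2 * s) * br 1 0 0 r s - q powi (3 * s - 3) * br 1 0 (-1) r s"
  define Y where "Y = q powi (-1) * (br 1 0 0 (r + 1) (s - 1) - (1 + q powi (-1) + q powi (-2)) * q powi (r + 1) * br 1 0 1 (r + 1) (s - 1)
       + (q powi (-1) + q powi (-2) + q powi (-3)) * q powi (2 * (r + 1)) * br 1 0 2 (r + 1) (s - 1) - q powi (3 * r) * br 1 0 3 (r + 1) (s - 1))"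
  have expand: "(1 - u) * (1 - u * q powi (-1)) * (1 - u * q powi (-2))
     = 1 - (1 + q powi (-1) + q powi (-2)) * u + (q powi (-1) + q powi (-2) + q powi (-3)) * u^2 - q powi (-3) * u^3" for u
  proof -
    have "q powi (-3) = q powi (-1) * q powi (-2)" unfolding powi_add[symmetric] by simp
    moreover have "q powi (-2) = q powi (-1) * q powi (-1)" unfolding powi_add[symmetric] by simp
    ultimately show ?thesis by (simp add: algebra_simps power2_eq_square power3_eq_cube)
  qed
  have rq3: "rq q (m - 3) = (1 - q powi m) * (1 - q powi m * q powi (-1)) * (1 - q powi m * q powi (-2)) * rq q m" for m
    using rq_rec[of m] rq_rec[of "m - 1"] rq_rec[of "m - 2"] unfolding powi_add[symmetric] by simp
  have pq: "(q powi m)^2 = q powi (2 * m)" "(q powi m)^3 = q powi (3 * m)" for m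
    by (simp_all add: power2_eq_square power3_eq_cube flip: powi_add)
  have 1: "((\<lambda>(v, w). G v w) has_sum X) UNIV"
  proof -
    have "((\<lambda>x. (brt 1 0 2 r s) x
        - (1 + q powi (-1) + q powi (-2)) * q powi s * (brt 1 0 1 r s) x
        + (q powi (-1) + q powi (-2) + q powi (-3)) * q powi (2 * s) * (brt 1 0 0 r s) x
        - q powi (3 * s - 3) * (brt 1 0 (-1) r s) x) has_sum X) UNIV"
      unfolding X_def by (intro has_sum_add has_sum_minus has_sum_cmult_right br_has_sum)
    also have "?this \<longleftrightarrow> ?thesis"
    proof (rule has_sum_cong, goal_cases)
      case (1 x)
      obtain v w where x: "x = (v, w)" by force
      define c where "c = - v - w"
      define t where "t = tri q (r + s) (r + v) (r + w) (r - v - w)"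
      have "G v w = seed_coeff v w * q powi (v + 2 * c) * ((1 - q powi (s - c)) * (1 - q powi (s - c) * q powi (-1)) * (1 - q powi (s - c) * q powi (-2))) * t"
      proof -
        have i: "n - 3 - (r - v - w) = (s - c) - 3" "n - (r - v - w) = s - c" by (simp_all add: n_def c_def)
        show ?thesis unfolding G_def t_def tri_def n_def[symmetric] i rq3 c_def[symmetric] by (simp only: mult_ac)
      qed
      also have "\<dots> = seed_coeff v w * q powi (v + 2 * c) * t - (1 + q powi (-1) + q powi (-2)) * (seed_coeff v w * (q powi (v + 2 * c) * q powi (s - c)) * t)
         + (q powi (-1) + q powi (-2) + q powi (-3)) * (seed_coeff v w * (q powi (v + 2 * c) * q powi (2 * (s - c))) * t)
         - seed_coeff v w * (q powi (-3) * (q powi (v + 2 * c) * q powi (3 * (s - c)))) * t"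
        unfolding expand pq by (simp add: algebra_simps)
      also have "q powi (v + 2 * c) * q powi (s - c) = q powi s * q powi (v + c)"
        unfolding powi_add[symmetric] by (simp add: algebra_simps)
      also have "q powi (v + 2 * c) * q powi (2 * (s - c)) = q powi (2 * s) * q powi v"
        unfolding powi_add[symmetric] by (simp add: algebra_simps)
      also have "q powi (-3) * (q powi (v + 2 * c) * q powi (3 * (s - c))) = q powi (3 * s - 3) * q powi (v - c)"
        unfolding powi_add[symmetric] by (simp add: algebra_simps)
      finally show ?case unfolding x prod.case t_def[symmetric] by (simp add: c_def mult_ac)
    qed
    finally show ?thesis .
  qed
  have 2: "((\<lambda>(v, w). G (v + 1) (w + 1)) has_sum Y) UNIV"
  proof -
    define r' s' where "r' = r + 1" and "s' = s - 1"
    have "((\<lambda>x. q powi (-1) * ((brt 1 0 0 r' s') x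
        - (1 + q powi (-1) + q powi (-2)) * q powi r' * (brt 1 0 1 r' s') x
        + (q powi (-1) + q powi (-2) + q powi (-3)) * q powi (2 * r') * (brt 1 0 2 r' s') x
        - q powi (3 * r) * (brt 1 0 3 r' s') x)) has_sum Y) UNIV"
      unfolding Y_def r'_def[symmetric] s'_def[symmetric]
      by (intro has_sum_add has_sum_minus has_sum_cmult_right br_has_sum)
    also have "?this \<longleftrightarrow> ?thesis"
    proof (rule has_sum_cong, goal_cases)
      case (1 x)
      obtain v w where x: "x = (v, w)" by force
      define c where "c = - v - w"
      define t where "t = tri q (r' + s') (r' + v) (r' + w) (r' - v - w)"
      have "G (v + 1) (w + 1) = seed_coeff v w * (q powi (2 * (v + w) + 2) * q powi (v + 1 + 2 * (- (v + 1) - (w + 1))))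
         * ((1 - q powi (r' + c)) * (1 - q powi (r' + c) * q powi (-1)) * (1 - q powi (r' + c) * q powi (-2))) * t"
      proof -
        have i: "r + (v + 1) = r' + v" "r + (w + 1) = r' + w" "r - (v + 1) - (w + 1) = (r' + c) - 3"
          "n - 3 - ((r' + c) - 3) = n - (r' + c)" "r' - v - w = r' + c" "r' + s' = n"
          by (simp_all add: r'_def s'_def n_def c_def)
        show ?thesis unfolding G_def t_def tri_def i rq3 seed_coeff_translate by (simp only: mult_ac)
      qed
      also have "q powi (2 * (v + w) + 2) * q powi (v + 1 + 2 * (- (v + 1) - (w + 1))) = q powi (-1) * q powi v"
        unfolding powi_add[symmetric] by (simp add: algebra_simps)
      also have "seed_coeff v w * (q powi (-1) * q powi v)
         * ((1 - q powi (r' + c)) * (1 - q powi (r' + c) * q powi (-1)) * (1 - q powi (r' + c) * q powi (-2))) * t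
         = q powi (-1) * (seed_coeff v w * q powi v * t - (1 + q powi (-1) + q powi (-2)) * (seed_coeff v w * (q powi v * q powi (r' + c)) * t)
         + (q powi (-1) + q powi (-2) + q powi (-3)) * (seed_coeff v w * (q powi v * q powi (2 * (r' + c))) * t)
         - seed_coeff v w * (q powi (-3) * (q powi v * q powi (3 * (r' + c)))) * t)"
        unfolding expand pq by (simp add: algebra_simps)
      also have "q powi v * q powi (r' + c) = q powi r' * q powi (v + c)"
        unfolding powi_add[symmetric] by (simp add: algebra_simps)
      also have "q powi v * q powi (2 * (r' + c)) = q powi (2 * r') * q powi (v + 2 * c)"
        unfolding powi_add[symmetric] by (simp add: algebra_simps)
      also have "q powi (-3) * (q powi v * q powi (3 * (r' + c))) = q powi (3 * r) * q powi (v + 3 * c)"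
        unfolding powi_add[symmetric] by (simp add: algebra_simps r'_def)
      finally show ?case unfolding x prod.case t_def[symmetric] by (simp add: c_def mult_ac)
    qed
    finally show ?thesis .
  qed
  have "((\<lambda>(v, w). G (v + 1) (w + 1)) has_sum X) UNIV \<longleftrightarrow> ((\<lambda>(v, w). G v w) has_sum X) UNIV"
    by (rule has_sum_reindex_bij_witness[of _ "\<lambda>(v, w). (v - 1, w - 1)" "\<lambda>(v, w). (v + 1, w + 1)"]) auto
  with 1 2 have "X = Y" using has_sum_unique by blast
  \<comment> \<open>Of the three weights (2,0,2), (1,1,2), (1,0,3) only the last has distinct
    entries.\<close>
  moreover have "toda 0 0 (br 1 0 (-1)) (r + 1) (s - 1) = br 1 0 3 (r + 1) (s - 1)"
  proof -
    have "br 1 0 (-1) = br 1 0 2" by (intro ext br_102[symmetric])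
    thus ?thesis using br_toda[of 1 0 2 "r + 1" "s - 1"] by (simp add: br_eq_0)
  qed
  moreover have "2 * (r + 1) = 2 * r + 2" by simp
  ultimately show ?thesis unfolding X_def Y_def br_eq_0 br_102 by (simp only: mult_zero_right diff_zero add_0_left add_0_right left_diff_distrib mult_1_left diff_0 add_uminus_conv_diff)
qed


text \<open>\<open>seed 1\<close> with both arguments moved by 1. In these coordinates the expansion
  of type (1,1) becomes one of type (0,0), so the simplest Hamiltonian applies.\<close>

definition bt :: "int \<Rightarrow> int \<Rightarrow> complex" where
  "bt r s = q powi (2 * (r - 1) * (s - 1)) * (rq q (r - 1) * rq q (s - 1) * rq q (r + s - 1))"

lemma bt_recurrence:
  "(1 - q powi (3 * s - 3)) * bt r s =
    q powi (-1) * ((q powi (-1) + q powi (-2) + q powi (-3)) * q powi (2 * r + 2) * bt (r + 1) (s - 1)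
       - q powi (3 * r) * toda 0 0 bt (r + 1) (s - 1))"
proof -
  define R S Z where defs: "R = q powi r" "S = q powi s" "Z = q powi (2 * r * s)"
  \<comment> \<open>Up to powers of \<open>q\<close>, all four values of \<open>bt\<close> in the
    recurrence are polynomial multiples of this common product, so that the claim becomes an
    identity between rational functions of \<open>q\<close>, \<open>R\<close>,
    \<open>S\<close>.\<close>
  define u where "u = rq q r * rq q (s - 1) * rq q (r + s - 1)"
  have nz: "R \<noteq> 0" "S \<noteq> 0" "Z \<noteq> 0" by (simp_all add: defs)
  have r1: "rq q (r - 1) = (1 - R) * rq q r" unfolding defs by (rule rq_rec)
  have s2: "rq q (s - 2) = (1 - S / q) * rq q (s - 1)"
    using rq_rec[of "s - 1"] by (simp add: powi_diff defs)
  have s3: "rq q (s - 3) = (1 - S / q^2) * (1 - S / q) * rq q (s - 1)"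
    using rq_rec[of "s - 2"] s2 by (simp add: powi_diff defs)
  have rs: "rq q (r + s - 2) = (1 - R * S / q) * rq q (r + s - 1)"
    using rq_rec[of "r + s - 1"] by (simp add: powi_diff powi_add defs)
  have w1: "q powi (2 * (r - 1) * (s - 1)) = Z * q^2 / (R^2 * S^2)"
  proof -
    have "2 * (r - 1) * (s - 1) = 2 * r * s + 2 - (r + r + (s + s))" by (simp add: algebra_simps)
    thus ?thesis unfolding defs by (simp only: powi_add powi_diff) (simp add: power2_eq_square)
  qed
  have w2: "q powi (2 * r * (s - 2)) = Z / R^4"
  proof -
    have "2 * r * (s - 2) = 2 * r * s - (r + r + (r + r))" by (simp add: algebra_simps)
    thus ?thesis unfolding defs by (simp only: powi_add powi_diff) (simp add: power4_eq_xxxx)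
  qed
  have w3: "q powi (2 * (r - 1) * (s - 2)) = Z * q^4 / (R^4 * S^2)"
  proof -
    have "2 * (r - 1) * (s - 2) = 2 * r * s + 4 - (r + r + (r + r) + (s + s))" by (simp add: algebra_simps)
    thus ?thesis unfolding defs by (simp only: powi_add powi_diff) (simp add: power4_eq_xxxx power2_eq_square)
  qed
  have w4: "q powi (2 * r * (s - 3)) = Z / R^6"
  proof -
    have "2 * r * (s - 3) = 2 * r * s - (r + r + (r + r) + (r + r))" by (simp add: algebra_simps)
    thus ?thesis unfolding defs by (simp only: powi_add powi_diff) (simp add: eval_nat_numeral)
  qed
  have b1: "bt r s = Z * u * (q^2 / (R^2 * S^2) * (1 - R))"
    unfolding bt_def w1 r1 u_def by simp
  have b2: "bt (r + 1) (s - 1) = Z * u * ((1 - S / q) / R^4)"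
  proof -
    have "bt (r + 1) (s - 1) = q powi (2 * r * (s - 2)) * (rq q r * rq q (s - 2) * rq q (r + s - 1))"
      unfolding bt_def by (simp add: algebra_simps)
    thus ?thesis unfolding w2 s2 u_def by simp
  qed
  have b3: "bt r (s - 1) = Z * u * (q^4 / (R^4 * S^2) * ((1 - R) * (1 - S / q) * (1 - R * S / q)))"
  proof -
    have "bt r (s - 1) = q powi (2 * (r - 1) * (s - 2)) * (rq q (r - 1) * rq q (s - 2) * rq q (r + s - 2))"
      unfolding bt_def by (simp add: algebra_simps)
    thus ?thesis unfolding w3 r1 s2 rs u_def by simp
  qed
  have b4: "bt (r + 1) (s - 2) = Z * u * ((1 - S / q) * (1 - S / q^2) * (1 - R * S / q) / R^6)"
  proof -
    have "bt (r + 1) (s - 2) = q powi (2 * r * (s - 3)) * (rq q r * rq q (s - 3) * rq q (r + s - 2))"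
      unfolding bt_def by (simp add: algebra_simps)
    thus ?thesis unfolding w4 s3 rs u_def by simp
  qed
  have t: "toda 0 0 bt (r + 1) (s - 1) = 1 / (q * R) * (bt (r + 1) (s - 1) - bt r (s - 1))
     + q^2 * R / S * (bt (r + 1) (s - 1) - bt (r + 1) (s - 2)) + S / q * bt (r + 1) (s - 1)"
  proof -
    have "0 + (r + 1) - (s - 1) = 2 + r - s" by simp
    hence a1: "q powi (0 + (r + 1) - (s - 1)) = q^2 * R / S" unfolding defs by (simp only: powi_add powi_diff) simp
    have a2: "q powi (- (r + 1)) = 1 / (q * R)" unfolding defs by (simp only: power_int_minus powi_add) (simp add: field_simps)
    have a3: "q powi (0 + 0 + (s - 1)) = S / q" unfolding defs by (simp only: powi_diff add_0_left) simp
    show ?thesis unfolding toda_def a1 a2 a3 by simp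
  qed
  have p: "q powi (3 * s - 3) = S^3 / q^3" "q powi (2 * r + 2) = q^2 * R^2" "q powi (3 * r) = R^3"
  proof -
    have "3 * s - 3 = s + s + s - 3" "2 * r + 2 = 2 + (r + r)" "3 * r = r + r + r" by simp_all
    note e = this
    show "q powi (3 * s - 3) = S^3 / q^3" unfolding e defs by (simp only: powi_add powi_diff) (simp add: power3_eq_cube)
    show "q powi (2 * r + 2) = q^2 * R^2" unfolding e defs by (simp only: powi_add powi_diff) (simp add: power2_eq_square)
    show "q powi (3 * r) = R^3" unfolding e defs by (simp only: powi_add powi_diff) (simp add: power3_eq_cube)
  qed
  have qi: "q powi (-1) = 1 / q" "q powi (-2) = 1 / q^2" "q powi (-3) = 1 / q^3"
    by (simp_all add: power_int_minus divide_inverse)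
  have "(1 - S^3 / q^3) * (q^2 / (R^2 * S^2) * (1 - R))
     = 1 / q * ((1 / q + 1 / q^2 + 1 / q^3) * (q^2 * R^2) * ((1 - S / q) / R^4)
       - R^3 * (1 / (q * R) * ((1 - S / q) / R^4 - q^4 / (R^4 * S^2) * ((1 - R) * (1 - S / q) * (1 - R * S / q)))
         + q^2 * R / S * ((1 - S / q) / R^4 - (1 - S / q) * (1 - S / q^2) * (1 - R * S / q) / R^6) + S / q * ((1 - S / q) / R^4)))"
    using nz q_nz by (simp add: divide_simps) (simp add: algebra_simps eval_nat_numeral)
  hence "Z * u * ((1 - S^3 / q^3) * (q^2 / (R^2 * S^2) * (1 - R)))
     = Z * u * (1 / q * ((1 / q + 1 / q^2 + 1 / q^3) * (q^2 * R^2) * ((1 - S / q) / R^4)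
       - R^3 * (1 / (q * R) * ((1 - S / q) / R^4 - q^4 / (R^4 * S^2) * ((1 - R) * (1 - S / q) * (1 - R * S / q)))
         + q^2 * R / S * ((1 - S / q) / R^4 - (1 - S / q) * (1 - S / q^2) * (1 - R * S / q) / R^6) + S / q * ((1 - S / q) / R^4))))"
    by simp
  thus ?thesis unfolding t b1 b2 b3 b4 p qi by (simp only: ring_distribs mult_ac)
qed

lemma seed_coeff_diag [simp]: "seed_coeff v v = 0"
  by (simp add: seed_coeff_def chi3_def)

text \<open>With \<open>s = 1\<close> all entries of the vector are at most 1. Sum zero and distinct
  residues modulo 3 then leave the six permutations of (1,0,-1), whose alternating sum is the A2
  Weyl denominator \<open>-(1-q)^2 * (1-q^2) / q^2\<close>.\<close>

lemma br_at_one: "br 1 0 (-1) r 1 = - (q powi (-2) * bt r 1)"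
proof -
  define f where "f = (\<lambda>(v, w). seed_coeff v w * q powi (1 * v + 0 * w + (-1) * (- v - w)) * tri q (r + 1) (r + v) (r + w) (r - v - w))"
  define S :: "(int \<times> int) set" where "S = {(1,0),(0,1),(1,-1),(-1,1),(0,-1),(-1,0)}"
  have f0: "f (v, w) = 0" if "(v, w) \<notin> S" for v w
  proof (rule ccontr)
    assume nz: "f (v, w) \<noteq> 0"
    hence "tri q (r + 1) (r + v) (r + w) (r - v - w) \<noteq> 0" and c: "seed_coeff v w \<noteq> 0" by (auto simp: f_def)
    from tri_nonzeroD[OF this(1)] have b: "v \<le> 1" "w \<le> 1" "- v - w \<le> 1" by auto
    hence "v \<in> {-2,-1,0,1}" "w \<in> {-2,-1,0,1}" by auto
    thus False using b c that by (auto simp: S_def seed_coeff_def chi3_def)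
  qed
  have "br 1 0 (-1) r 1 = infsum f UNIV" by (simp add: br_def f_def)
  also have "\<dots> = infsum f S" by (rule infsum_cong_neutral) (use f0 in auto)
  also have "\<dots> = sum f S" by (simp add: S_def)
  also have "\<dots> = (q powi 2 - q powi 1 - q powi 1 + q powi (-1) + q powi (-1) - q powi (-2)) * tri q (r + 1) (r + 1) r (r - 1)"
  proof -
    have c: "seed_coeff 1 0 = 1" "seed_coeff 0 1 = -1" "seed_coeff 1 (-1) = -1" "seed_coeff (-1) 1 = 1" "seed_coeff 0 (-1) = 1" "seed_coeff (-1) 0 = -1"
      by (simp_all add: seed_coeff_def chi3_def)
    define T where "T = tri q (r + 1) (r + 1) r (r - 1)"
    have "f (1, 0) = q powi 2 * T" "f (0, 1) = - (q powi 1 * T)" "f (1, -1) = - (q powi 1 * T)"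
      "f (-1, 1) = q powi (-1) * T" "f (0, -1) = q powi (-1) * T" "f (-1, 0) = - (q powi (-2) * T)"
      unfolding f_def T_def prod.case c by simp_all (metis tri_perm)+
    thus ?thesis unfolding S_def T_def[symmetric] by (simp add: algebra_simps)
  qed
  also have "tri q (r + 1) (r + 1) r (r - 1) = rq q 1 * rq q 2 * (rq q r * rq q (r - 1))"
  proof (cases "r \<ge> 0")
    case True
    have "qfac q (r + 1) * rq q (r + 1) = 1" using True qfac_nz[of "r + 1"] by (simp add: rq_def qfac_def)
    thus ?thesis by (simp add: tri_def)
  qed (simp add: tri_def)
  also have "(q powi 2 - q powi 1 - q powi 1 + q powi (-1) + q powi (-1) - q powi (-2)) * (rq q 1 * rq q 2 * (rq q r * rq q (r - 1)))
      = - (q powi (-2) * bt r 1)"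
  proof -
    have r12: "rq q 1 = 1 / (1 - q)" "rq q 2 = 1 / ((1 - q) * (1 - q^2))"
      by (simp_all add: rq_def qpoch_def numeral_2_eq_2)
    have nz: "1 - q \<noteq> 0" "1 - q^2 \<noteq> 0" using powi_neq_1[of 1] powi_neq_1[of 2] by auto
    have E: "q powi 2 - q powi 1 - q powi 1 + q powi (-1) + q powi (-1) - q powi (-2) = - ((1 - q) * ((1 - q) * (1 - q^2))) / q^2"
      by (simp add: power_int_minus field_simps eval_nat_numeral)
    have "(q powi 2 - q powi 1 - q powi 1 + q powi (-1) + q powi (-1) - q powi (-2)) * (rq q 1 * rq q 2) = - (1 / q^2)"
      unfolding E r12 using nz by simp
    hence "(q powi 2 - q powi 1 - q powi 1 + q powi (-1) + q powi (-1) - q powi (-2)) * (rq q 1 * rq q 2) * (rq q r * rq q (r - 1))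
       = - (1 / q^2) * (rq q r * rq q (r - 1))" by simp
    thus ?thesis by (simp add: bt_def power_int_minus field_simps)
  qed
  finally show ?thesis .
qed

text \<open>The common recurrence determines the values at \<open>s\<close> from those at
  \<open>s - 1\<close> and \<open>s - 2\<close>, the latter through the Hamiltonian. Its factor
  \<open>1 - q^(3s-3)\<close> vanishes at \<open>s = 1\<close>, which is why that value was computed
  directly; at \<open>s = 0\<close> both sides are zero.\<close>

lemma br_eq_bt: "br 1 0 (-1) r (int m) = - (q powi (-2) * bt r (int m))"
proof (induction m arbitrary: r rule: less_induct)
  case (less m)
  consider "m = 0" | "m = 1" | "m \<ge> 2" by linarith
  thus ?case
  proof cases
    case 1
    have "seed_coeff v w * q powi (1 * v + 0 * w + (-1) * (- v - w)) * tri q r (r + v) (r + w) (r - v - w) = 0" for v w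
    proof (rule ccontr)
      assume "\<not> ?thesis"
      hence "tri q r (r + v) (r + w) (r - v - w) \<noteq> 0" "seed_coeff v w \<noteq> 0" by auto
      from tri_nonzeroD[OF this(1)] have "v = 0" "w = 0" by auto
      thus False using \<open>seed_coeff v w \<noteq> 0\<close> by simp
    qed
    hence "br 1 0 (-1) r 0 = 0" unfolding br_def by (intro infsum_0) auto
    thus ?thesis using 1 by (simp add: bt_def)
  next
    case 2
    thus ?thesis using br_at_one by simp
  next
    case 3
    define s where "s = int m"
    have e: "s - 1 = int (m - 1)" "s - 1 - 1 = int (m - 2)" using 3 by (auto simp: s_def of_nat_diff)
    have IH: "br 1 0 (-1) r' (s - 1) = - (q powi (-2) * bt r' (s - 1))"
      "br 1 0 (-1) r' (s - 1 - 1) = - (q powi (-2) * bt r' (s - 1 - 1))" for r'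
      using less[of "m - 1" r'] less[of "m - 2" r'] 3 unfolding e(2) unfolding e(1) by auto
    have t: "toda 0 0 (br 1 0 (-1)) (r + 1) (s - 1) = - (q powi (-2) * toda 0 0 bt (r + 1) (s - 1))"
      unfolding toda_def IH by (simp add: algebra_simps)
    have lin: "A * (B * (- (z * x)) - C * (- (z * y))) = - (z * (A * (B * x - C * y)))" for A B C x y z :: complex
      by (simp add: algebra_simps)
    have "(1 - q powi (3 * s - 3)) * br 1 0 (-1) r s = - (q powi (-2) * ((1 - q powi (3 * s - 3)) * bt r s))"
      unfolding br_recurrence bt_recurrence t IH by (rule lin)
    moreover have "1 - q powi (3 * s - 3) \<noteq> 0" using powi_neq_1[of "3 * s - 3"] 3 by (auto simp: s_def)
    ultimately show ?thesis unfolding s_def[symmetric]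
      by (metis (no_types, opaque_lifting) mult.left_commute mult_cancel_left mult_minus_right)
  qed
qed

definition seed :: "int \<Rightarrow> int \<Rightarrow> int \<Rightarrow> complex" where
  "seed t r s = q powi (2 * r * s) * (rq q r * rq q s * rq q (r + s + t))"

text \<open>Reversing the weight (1,0,-1) is an odd permutation and cancels the sign in
  \<open>br_eq_bt\<close>; the reversed weight gives the exponent \<open>-2 * v - w\<close>.\<close>

lemma seed_has_sum:
  assumes "s \<ge> 0"
  shows "((\<lambda>(v, w). q^2 * seed_coeff v w * q powi (- 2 * v - w) * tri q (r + s + 2) (r + 1 + v) (r + 1 + w) (r + 1 - v - w))
     has_sum seed 1 r s) UNIV"
proof -
  define m where "m = nat (s + 1)"
  have m: "int m = s + 1" using assms by (simp add: m_def)
  have "br (-1) 0 1 (r + 1) (s + 1) = - br 1 0 (-1) (r + 1) (s + 1)"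
    using br_swap12[of 0 "-1" 1 "r + 1" "s + 1"] br_swap23[of 0 "-1" 1 "r + 1" "s + 1"]
      br_swap12[of 0 1 "-1" "r + 1" "s + 1"] by (metis br_swap12 br_swap23 minus_minus)
  also have "\<dots> = q powi (-2) * seed 1 r s"
    using br_eq_bt[of "r + 1" m] unfolding m by (simp add: bt_def seed_def algebra_simps)
  finally have e: "seed 1 r s = q^2 * br (-1) 0 1 (r + 1) (s + 1)"
    by (simp add: power_int_minus)
  show ?thesis unfolding e using has_sum_cmult_right[OF br_has_sum[of "-1" 0 1 "r + 1" "s + 1"], of "q^2"]
    by (simp add: case_prod_unfold algebra_simps)
qed

end

section \<open>Changing the type of the expansion\<close>

lemma has_sum_finite_sum:
  fixes f :: "'i \<Rightarrow> 'a \<Rightarrow> complex"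
  assumes "finite I" "\<And>i. i \<in> I \<Longrightarrow> (f i has_sum s i) A"
  shows "((\<lambda>x. \<Sum>i\<in>I. f i x) has_sum (\<Sum>i\<in>I. s i)) A"
  using assms by (induction I rule: finite_induct) (auto intro!: has_sum_add)

context nome begin

lemma bstep_has_sum:
  assumes "\<And>r s. 0 \<le> r \<Longrightarrow> 0 \<le> s \<Longrightarrow> ((\<lambda>x. f x r s) has_sum g r s) X"
  shows "((\<lambda>x. bstep i j (f x) L M) has_sum bstep i j g L M) X"
  unfolding bstep_def qconv_def
  by (intro has_sum_finite_sum has_sum_cmult_right assms) auto

text \<open>A power of \<open>q\<close> linear in \<open>r\<close> and \<open>s\<close> can be moved
  between the function and the type of the step.\<close>

lemma bstep_cong:
  assumes "\<And>r s. 0 \<le> r \<Longrightarrow> 0 \<le> s \<Longrightarrow> q powi (i * r + j * s) * f r s = q powi (i' * r + j' * s) * g r s"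
  shows "bstep i j f L M = bstep i' j' g L M"
  unfolding bstep_def
proof (intro qconv_cong)
  fix r s :: int assume "0 \<le> r" "0 \<le> s"
  have "q powi (r\<^sup>2 - r * s + s\<^sup>2 + i * r + j * s) * f r s = q powi (r\<^sup>2 - r * s + s\<^sup>2) * (q powi (i * r + j * s) * f r s)"
    by (simp add: mult.assoc[symmetric] powi_add[symmetric] add.assoc)
  also have "q powi (i * r + j * s) * f r s = q powi (i' * r + j' * s) * g r s" using assms \<open>0 \<le> r\<close> \<open>0 \<le> s\<close> .
  finally show "q powi (r\<^sup>2 - r * s + s\<^sup>2 + i * r + j * s) * f r s = q powi (r\<^sup>2 - r * s + s\<^sup>2 + i' * r + j' * s) * g r s"
    by (simp add: mult.assoc[symmetric] powi_add[symmetric] add.assoc)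
qed

lemma bstep_cmult: "bstep i j (\<lambda>r s. c * f r s) L M = c * bstep i j f L M"
  unfolding bstep_def by (simp add: qconv_def sum_distrib_left mult_ac)

lemma bstep_diff: "bstep i j (\<lambda>r s. f r s - g r s) L M = bstep i j f L M - bstep i j g L M"
  unfolding bstep_def by (simp add: right_diff_distrib qconv_diff)

end

section \<open>Cancellation by symmetrizing over permutations of the vector\<close>

lemma has_sum_reindex_swap12:
  fixes U :: "int \<times> int \<Rightarrow> complex"
  shows "(U has_sum S) UNIV \<Longrightarrow> ((\<lambda>(v, w). U (w, v)) has_sum S) UNIV"
  by (subst (asm) has_sum_reindex_bij_witness[of _ "\<lambda>(v, w). (w, v)" "\<lambda>(v, w). (w, v)" _ "\<lambda>(v, w). U (w, v)" _ S S]) auto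

lemma has_sum_reindex_swap23:
  fixes U :: "int \<times> int \<Rightarrow> complex"
  shows "(U has_sum S) UNIV \<Longrightarrow> ((\<lambda>(v, w). U (v, - v - w)) has_sum S) UNIV"
  by (subst (asm) has_sum_reindex_bij_witness[of _ "\<lambda>(v, w). (v, - v - w)" "\<lambda>(v, w). (v, - v - w)" _ "\<lambda>(v, w). U (v, - v - w)" _ S S]) auto

lemma has_sum_antisym2:
  fixes U :: "int \<times> int \<Rightarrow> complex"
  assumes "(U has_sum S) UNIV" "\<And>v w. U (v, w) + U (v, - v - w) = 0"
  shows "S = 0"
proof -
  have "((\<lambda>x. U x + (\<lambda>(v, w). U (v, - v - w)) x) has_sum (S + S)) UNIV"
    by (intro has_sum_add assms has_sum_reindex_swap23)
  moreover have "(\<lambda>x. U x + (\<lambda>(v, w). U (v, - v - w)) x) = (\<lambda>_. 0)"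
    using assms(2) by (auto simp: fun_eq_iff)
  ultimately have "((\<lambda>_. 0) has_sum (S + S)) (UNIV :: (int \<times> int) set)" by (simp only:)
  hence "S + S = 0" by (rule has_sum_unique[OF _ has_sum_0_simp])
  thus ?thesis by simp
qed

text \<open>Reindexing by the six permutations of \<open>(v, w, -v-w)\<close> gives six sums with
  value \<open>S\<close>, and added together their terms cancel pointwise.\<close>

lemma has_sum_antisym6:
  fixes U :: "int \<times> int \<Rightarrow> complex"
  assumes U: "(U has_sum S) UNIV"
    and "\<And>v w c. v + w + c = 0 \<Longrightarrow> U (v, w) + U (w, v) + U (v, c) + U (c, v) + U (w, c) + U (c, w) = 0"
  shows "S = 0"
proof -
  have 1: "((\<lambda>(v, w). U (w, v)) has_sum S) UNIV" by (rule has_sum_reindex_swap12[OF U])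
  have 2: "((\<lambda>(v, w). U (v, - v - w)) has_sum S) UNIV" by (rule has_sum_reindex_swap23[OF U])
  have 3: "((\<lambda>(v, w). U (- v - w, v)) has_sum S) UNIV" using has_sum_reindex_swap23[OF 1] by simp
  have 4: "((\<lambda>(v, w). U (w, - v - w)) has_sum S) UNIV" using has_sum_reindex_swap12[OF 2] by (simp add: minus_diff_commute)
  have 5: "((\<lambda>(v, w). U (- v - w, w)) has_sum S) UNIV" using has_sum_reindex_swap12[OF 3] by (simp add: minus_diff_commute)
  have "((\<lambda>x. U x + (\<lambda>(v, w). U (w, v)) x + (\<lambda>(v, w). U (v, - v - w)) x + (\<lambda>(v, w). U (- v - w, v)) x
     + (\<lambda>(v, w). U (w, - v - w)) x + (\<lambda>(v, w). U (- v - w, w)) x) has_sum (S + S + S + S + S + S)) UNIV"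
    by (intro has_sum_add U 1 2 3 4 5)
  moreover have "(\<lambda>x. U x + (\<lambda>(v, w). U (w, v)) x + (\<lambda>(v, w). U (v, - v - w)) x + (\<lambda>(v, w). U (- v - w, v)) x
     + (\<lambda>(v, w). U (w, - v - w)) x + (\<lambda>(v, w). U (- v - w, w)) x) = (\<lambda>_. 0)"
    using assms(2) by (auto simp: fun_eq_iff)
  ultimately have "((\<lambda>_. 0) has_sum (S + S + S + S + S + S)) (UNIV :: (int \<times> int) set)" by (simp only:)
  hence "S + S + S + S + S + S = 0" by (rule has_sum_unique[OF _ has_sum_0_simp])
  thus ?thesis by simp
qed

context nome begin

abbreviation tri11 :: "int \<Rightarrow> int \<Rightarrow> int \<Rightarrow> int \<Rightarrow> complex" where
  "tri11 v w r s \<equiv> tri q (r + s + 2) (r + 1 + v) (r + 1 + w) (r + 1 - v - w)"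

abbreviation tri10 :: "int \<Rightarrow> int \<Rightarrow> int \<Rightarrow> int \<Rightarrow> complex" where
  "tri10 v w r s \<equiv> tri q (r + s + 1) (r + v) (r + 1 + w) (r + 1 - v - w)"

abbreviation tri00 :: "int \<Rightarrow> int \<Rightarrow> int \<Rightarrow> int \<Rightarrow> complex" where
  "tri00 v w r s \<equiv> tri q (r + s) (r + v - 1) (r + w) (r + 1 - v - w)"

definition antisym_coeff :: "(int \<Rightarrow> int \<Rightarrow> complex) \<Rightarrow> bool" where
  "antisym_coeff C \<longleftrightarrow> (\<forall>v w. C w v = - C v w \<and> C v (- v - w) = - C v w)"

text \<open>With \<open>x * y * z = 1\<close>, each bracket times its prefactor is an affine
  function of the distinguished variable with coefficients symmetric in \<open>x\<close>,
  \<open>y\<close>, \<open>z\<close>. The alternating sum with \<open>z - y\<close>,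
  \<open>x - z\<close>, \<open>y - x\<close> kills constants and linear terms.\<close>

lemma vandermonde_identity:
  fixes x y z R S :: complex
  assumes xyz: "x * y * z = 1"
  shows "(z - y) * (y * z) * (1 - R * S - (1 - R * x) * (1 - S * (x * z)) * (1 - S * (x * y)))
    + (x - z) * (x * z) * (1 - R * S - (1 - R * y) * (1 - S * (y * z)) * (1 - S * (x * y)))
    + (y - x) * (x * y) * (1 - R * S - (1 - R * z) * (1 - S * (y * z)) * (1 - S * (x * z))) = 0"
proof -
  have e: "(b * c) * (1 - R * S - (1 - R * a) * (1 - S * (a * c)) * (1 - S * (a * b)))
      = S * (b + c) - S\<^sup>2 + R - R * S * (a * (b + c)) + R * S\<^sup>2 * a - R * S * (b * c)" if "a * b * c = 1" for a b c
    using that by algebra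
  have 1: "(y * z) * (1 - R * S - (1 - R * x) * (1 - S * (x * z)) * (1 - S * (x * y)))
      = S * (y + z) - S\<^sup>2 + R - R * S * (x * (y + z)) + R * S\<^sup>2 * x - R * S * (y * z)" by (rule e[OF xyz])
  have 2: "(x * z) * (1 - R * S - (1 - R * y) * (1 - S * (y * z)) * (1 - S * (x * y)))
      = S * (x + z) - S\<^sup>2 + R - R * S * (y * (x + z)) + R * S\<^sup>2 * y - R * S * (x * z)"
    using e[of y x z] xyz by (simp add: mult_ac)
  have 3: "(x * y) * (1 - R * S - (1 - R * z) * (1 - S * (y * z)) * (1 - S * (x * z)))
      = S * (x + y) - S\<^sup>2 + R - R * S * (z * (x + y)) + R * S\<^sup>2 * z - R * S * (x * y)"
    using e[of z x y] xyz by (simp add: mult_ac)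
  show ?thesis unfolding mult.assoc[of "z - y"] mult.assoc[of "x - z"] mult.assoc[of "y - x"]
    unfolding 1 2 3 by (simp add: algebra_simps)
qed

text \<open>The old and the new summand differ, but over the six permutations the coefficients are
  those of one term up to sign, and by \<open>tri_lower1\<close> the six differences add up to a
  multiple of \<open>vandermonde_identity\<close>.\<close>

lemma lower_tri11:
  assumes C: "antisym_coeff C" and rs: "r + s \<ge> 0"
    and h: "((\<lambda>(v, w). C v w * q powi (- 2 * v - w) * tri11 v w r s) has_sum g) UNIV"
  shows "((\<lambda>(v, w). C v w * q powi (- 2 * v - w) * tri10 v w r s) has_sum g) UNIV"
proof -
  define n where "n = r + s + 2"
  have n1: "n \<ge> 1" using rs by (simp add: n_def)
  define f where "f = (\<lambda>v w. C v w * q powi (- 2 * v - w) * tri11 v w r s)"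
  define f' where "f' = (\<lambda>v w. C v w * q powi (- 2 * v - w) * tri10 v w r s)"
  obtain g' where h': "((\<lambda>(v, w). f' v w) has_sum g') UNIV"
    using summable_tri[of "\<lambda>v w. C v w * q powi (- 2 * v - w)" "r + s + 1" r "r + 1" "r + 1"] unfolding f'_def summable_on_def by blast
  have "((\<lambda>x. (\<lambda>(v, w). f v w) x - (\<lambda>(v, w). f' v w) x) has_sum (g - g')) UNIV"
    by (rule has_sum_minus[OF _ h']) (use h in \<open>simp add: f_def\<close>)
  hence "((\<lambda>(v, w). f v w - f' v w) has_sum (g - g')) UNIV" by (simp add: case_prod_unfold)
  hence "g - g' = 0"
  proof (rule has_sum_antisym6)
    fix v w c :: int assume vwc: "v + w + c = 0"
    define T where "T = tri q n (r + 1 + v) (r + 1 + w) (r + 1 + c)"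
    define Tv where "Tv = tri q (n - 1) (r + 1 + v - 1) (r + 1 + w) (r + 1 + c)"
    define Tw where "Tw = tri q (n - 1) (r + 1 + w - 1) (r + 1 + v) (r + 1 + c)"
    define Tc where "Tc = tri q (n - 1) (r + 1 + c - 1) (r + 1 + v) (r + 1 + w)"
    define x y z R S where defs: "x = q powi v" "y = q powi w" "z = q powi c" "R = q powi (r + 1)" "S = q powi (s + 1)"
    have xyz: "x * y * z = 1" unfolding defs powi_add[symmetric] vwc by simp
    have N: "q powi n = R * S" unfolding defs powi_add[symmetric] by (simp add: n_def algebra_simps)
    have N1: "1 - R * S \<noteq> 0" using powi_neq_1[of n] n1 N by auto
    have i: "q powi (n - (r + 1 + v)) = S * (y * z)" "q powi (n - (r + 1 + w)) = S * (x * z)" "q powi (n - (r + 1 + c)) = S * (x * y)"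
      unfolding defs powi_add[symmetric] using vwc by (auto simp: n_def intro!: arg_cong[where f="power_int q"])
    have X: "q powi (r + 1 + v) = R * x" "q powi (r + 1 + w) = R * y" "q powi (r + 1 + c) = R * z"
      unfolding defs powi_add[symmetric] by simp_all
    have perm: "tri q n (r + 1 + w) (r + 1 + v) (r + 1 + c) = T" "tri q n (r + 1 + c) (r + 1 + v) (r + 1 + w) = T"
      unfolding T_def by (metis tri_perm)+
    have Tv: "(1 - R * S) * Tv = (1 - R * x) * (1 - S * (x * z)) * (1 - S * (x * y)) * T"
      using tri_lower1[OF n1, of "r + 1 + v" "r + 1 + w" "r + 1 + c"] unfolding N i X Tv_def T_def .
    have Tw: "(1 - R * S) * Tw = (1 - R * y) * (1 - S * (y * z)) * (1 - S * (x * y)) * T"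
      using tri_lower1[OF n1, of "r + 1 + w" "r + 1 + v" "r + 1 + c"] unfolding N i X Tw_def perm .
    have Tc: "(1 - R * S) * Tc = (1 - R * z) * (1 - S * (y * z)) * (1 - S * (x * z)) * T"
      using tri_lower1[OF n1, of "r + 1 + c" "r + 1 + v" "r + 1 + w"] unfolding N i X Tc_def perm .
    define A where "A = C v w"
    have cs: "c = - v - w" using vwc by auto
    have CC: "C w v = - A" "C v c = - A" "C c v = A" "C w c = A" "C c w = - A"
    proof -
      have s: "C b a = - C a b" "C a (- a - b) = - C a b" for a b using C unfolding antisym_coeff_def by blast+
      show "C w v = - A" unfolding A_def by (rule s)
      show vc: "C v c = - A" unfolding A_def cs by (rule s)
      show "C c v = A" using s(1)[of v c] vc by simp
      have "c = - w - v" using vwc by simp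
      hence "C w c = - C w v" using s(2)[of w v] by simp
      thus wc: "C w c = A" using s(1)[of v w] by (simp add: A_def)
      show "C c w = - A" using s(1)[of w c] wc by simp
    qed
    have p: "q powi (- 2 * a - b) = q powi d * (q powi b * q powi d)" if "a + b + d = 0" for a b d
    proof -
      have "- 2 * a - b = d + (b + d)" using that by linarith
      thus ?thesis by (simp only: powi_add)
    qed
    have ff: "f a b - f' a b = C a b * (q powi d * (q powi b * q powi d)) * (tri q n (r + 1 + a) (r + 1 + b) (r + 1 + d) - tri q (n - 1) (r + 1 + a - 1) (r + 1 + b) (r + 1 + d))"
      if "a + b + d = 0" for a b d
    proof -
      have "r + 1 - a - b = r + 1 + d" "r + a = r + 1 + a - 1" "r + s + 1 = n - 1" using that by (auto simp: n_def)
      thus ?thesis unfolding f_def f'_def p[OF that] n_def[symmetric] by (simp only: right_diff_distrib)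
    qed
    have t: "tri q n (r + 1 + v) (r + 1 + c) (r + 1 + w) = T" "tri q n (r + 1 + w) (r + 1 + c) (r + 1 + v) = T"
       "tri q n (r + 1 + c) (r + 1 + w) (r + 1 + v) = T"
       "tri q (n - 1) (r + 1 + v - 1) (r + 1 + c) (r + 1 + w) = Tv" "tri q (n - 1) (r + 1 + w - 1) (r + 1 + c) (r + 1 + v) = Tw"
       "tri q (n - 1) (r + 1 + c - 1) (r + 1 + w) (r + 1 + v) = Tc"
      unfolding T_def Tv_def Tw_def Tc_def by (metis tri_perm)+
    have F: "f v w - f' v w = A * (z * (y * z)) * (T - Tv)" "f w v - f' w v = - A * (z * (x * z)) * (T - Tw)"
      "f v c - f' v c = - A * (y * (z * y)) * (T - Tv)" "f c v - f' c v = A * (y * (x * y)) * (T - Tc)"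
      "f w c - f' w c = A * (x * (z * x)) * (T - Tw)" "f c w - f' c w = - A * (x * (y * x)) * (T - Tc)"
      using ff[of v w c] ff[of w v c] ff[of v c w] ff[of c v w] ff[of w c v] ff[of c w v] vwc
      unfolding CC perm t A_def[symmetric] defs[symmetric] T_def[symmetric] Tv_def[symmetric] Tw_def[symmetric] Tc_def[symmetric]
      by simp_all
    have "(1 - R * S) * ((f v w - f' v w) + (f w v - f' w v) + (f v c - f' v c) + (f c v - f' c v) + (f w c - f' w c) + (f c w - f' c w))
       = A * ((z - y) * (y * z) * ((1 - R * S) * T - (1 - R * S) * Tv) + (x - z) * (x * z) * ((1 - R * S) * T - (1 - R * S) * Tw)
           + (y - x) * (x * y) * ((1 - R * S) * T - (1 - R * S) * Tc))"
      unfolding F by (simp add: algebra_simps)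
    also have "\<dots> = A * T * ((z - y) * (y * z) * (1 - R * S - (1 - R * x) * (1 - S * (x * z)) * (1 - S * (x * y)))
    + (x - z) * (x * z) * (1 - R * S - (1 - R * y) * (1 - S * (y * z)) * (1 - S * (x * y)))
    + (y - x) * (x * y) * (1 - R * S - (1 - R * z) * (1 - S * (y * z)) * (1 - S * (x * z))))"
      unfolding Tv Tw Tc by (simp only: ring_distribs mult_ac)
    also have "\<dots> = 0" unfolding vandermonde_identity[OF xyz] by simp
    finally show "(case (v, w) of (v, w) \<Rightarrow> f v w - f' v w) + (case (w, v) of (v, w) \<Rightarrow> f v w - f' v w) +
       (case (v, c) of (v, w) \<Rightarrow> f v w - f' v w) + (case (c, v) of (v, w) \<Rightarrow> f v w - f' v w) +
       (case (w, c) of (v, w) \<Rightarrow> f v w - f' v w) + (case (c, w) of (v, w) \<Rightarrow> f v w - f' v w) = 0"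
      using N1 by simp
  qed
  thus ?thesis using h' unfolding f'_def by simp
qed

text \<open>A factor \<open>W v\<close> singles out the first coordinate, so only the exchange of
  the other two is available. Two-term cancellation suffices because lowering two entries by
  \<open>tri_lower2\<close> produces the factor \<open>1 - q^(r+v)\<close> as well.\<close>

lemma lower_tri10:
  assumes C: "antisym_coeff C" and rs: "r + s \<ge> 0"
    and h: "((\<lambda>(v, w). C v w * q powi (- 2 * v - w) * W v * ((1 - q powi (r + v)) * tri10 v w r s)) has_sum g) UNIV"
  shows "((\<lambda>(v, w). C v w * q powi (- 2 * v - w) * W v * tri00 v w r s) has_sum g) UNIV"
proof -
  define n where "n = r + s + 1"
  have n1: "n \<ge> 1" using rs by (simp add: n_def)
  define f where "f = (\<lambda>v w. C v w * q powi (- 2 * v - w) * W v * ((1 - q powi (r + v)) * tri10 v w r s))"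
  define f' where "f' = (\<lambda>v w. C v w * q powi (- 2 * v - w) * W v * tri00 v w r s)"
  obtain g' where h': "((\<lambda>(v, w). f' v w) has_sum g') UNIV"
    using summable_tri[of "\<lambda>v w. C v w * q powi (- 2 * v - w) * W v" "r + s" "r - 1" "r" "r + 1"] unfolding f'_def summable_on_def
    by (auto simp: algebra_simps)
  have "((\<lambda>x. (\<lambda>(v, w). f v w) x - (\<lambda>(v, w). f' v w) x) has_sum (g - g')) UNIV"
    by (rule has_sum_minus[OF _ h']) (use h in \<open>simp add: f_def\<close>)
  hence "((\<lambda>(v, w). f v w - f' v w) has_sum (g - g')) UNIV" by (simp add: case_prod_unfold)
  hence "g - g' = 0"
  proof (rule has_sum_antisym2)
    fix v w :: int
    define c where "c = - v - w"
    define T where "T = tri q n (r + v) (r + 1 + w) (r + 1 + c)"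
    define T2 where "T2 = tri q (n - 1) (r + v - 1) (r + 1 + w - 1) (r + 1 + c)"
    define T3 where "T3 = tri q (n - 1) (r + v - 1) (r + 1 + c - 1) (r + 1 + w)"
    define x y z R N where defs: "x = q powi (r + v)" "y = q powi w" "z = q powi c" "R = q powi (r + 1)" "N = q powi n"
    have nz: "y \<noteq> 0" "z \<noteq> 0" "R \<noteq> 0" by (simp_all add: defs)
    have N1: "1 - N \<noteq> 0" using powi_neq_1[of n] n1 by (auto simp: defs)
    have X: "q powi (r + 1 + w) = R * y" "q powi (r + 1 + c) = R * z" "q powi (n - (r + 1 + w)) = N / (R * y)" "q powi (n - (r + 1 + c)) = N / (R * z)"
      unfolding defs by (simp_all only: powi_add powi_diff)
    have T2: "(1 - N) * T2 = (1 - x) * (1 - R * y) * (1 - N / (R * z)) * T"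
      using tri_lower2[OF n1, of "r + v" "r + 1 + w" "r + 1 + c"] unfolding X T2_def T_def defs(5)[symmetric] defs(1)[symmetric] .
    have perm: "tri q n (r + v) (r + 1 + c) (r + 1 + w) = T" unfolding T_def by (rule tri_perm)
    have T3: "(1 - N) * T3 = (1 - x) * (1 - R * z) * (1 - N / (R * y)) * T"
      using tri_lower2[OF n1, of "r + v" "r + 1 + c" "r + 1 + w"] unfolding X T3_def perm defs(5)[symmetric] defs(1)[symmetric] .
    define A where "A = C v w * q powi (- v) * W v"
    have Cc: "C v c = - C v w" using C unfolding antisym_coeff_def c_def by blast
    have e1: "f v w - f' v w = A * z * ((1 - x) * T - T2)"
    proof -
      have "q powi (- 2 * v - w) = q powi (- v) * z" unfolding defs powi_add[symmetric] by (simp add: c_def)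
      note p = this
      have t: "tri10 v w r s = T" unfolding T_def n_def c_def by (simp add: algebra_simps)
      have t2: "tri00 v w r s = T2" unfolding T2_def n_def c_def by (simp add: algebra_simps)
      show ?thesis unfolding f_def f'_def p t t2 A_def defs(1)[symmetric] right_diff_distrib by (simp only: mult_ac)
    qed
    have e2: "f v c - f' v c = - A * y * ((1 - x) * T - T3)"
    proof -
      have "q powi (- 2 * v - c) = q powi (- v) * y" unfolding defs powi_add[symmetric] by (simp add: c_def)
      note p = this
      have t: "tri q (r + s + 1) (r + v) (r + 1 + c) (r + 1 - v - c) = T" unfolding perm[symmetric] n_def c_def by (simp add: algebra_simps)
      have t3: "tri q (r + s) (r + v - 1) (r + c) (r + 1 - v - c) = T3" unfolding T3_def n_def c_def by (simp add: algebra_simps)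
      show ?thesis unfolding f_def f'_def p t t3 A_def Cc defs(1)[symmetric] right_diff_distrib by (simp only: mult_ac mult_minus_left mult_minus_right)
    qed
    have "(1 - N) * ((f v w - f' v w) + (f v c - f' v c)) = A * (z * ((1 - x) * T * (1 - N) - (1 - N) * T2) - y * ((1 - x) * T * (1 - N) - (1 - N) * T3))"
      unfolding e1 e2 by (simp add: algebra_simps)
    also have "\<dots> = A * (1 - x) * T * (z * ((1 - N) - (1 - R * y) * (1 - N / (R * z))) - y * ((1 - N) - (1 - R * z) * (1 - N / (R * y))))"
    proof -
      have "A * (z * ((1 - x) * T * (1 - N) - (1 - x) * a * b * T) - y * ((1 - x) * T * (1 - N) - (1 - x) * c * d * T))
        = A * (1 - x) * T * (z * ((1 - N) - a * b) - y * ((1 - N) - c * d))" for a b c d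
        by (simp add: algebra_simps)
      thus ?thesis unfolding T2 T3 .
    qed
    \<comment> \<open>Each of the two products equals
      \<open>N / R + R * y * z - N * (y + z)\<close>, which is symmetric in \<open>y\<close> and
      \<open>z\<close>.\<close>
    also have "z * ((1 - N) - (1 - R * y) * (1 - N / (R * z))) - y * ((1 - N) - (1 - R * z) * (1 - N / (R * y))) = 0"
      using nz by (simp add: field_simps)
    finally show "(case (v, w) of (v, w) \<Rightarrow> f v w - f' v w) + (case (v, - v - w) of (v, w) \<Rightarrow> f v w - f' v w) = 0"
      using N1 by (simp add: c_def)
  qed
  thus ?thesis using h' unfolding f'_def by simp
qed


section \<open>The Bailey chain\<close>

text \<open>
  \<open>chain k t a b\<close> is the k-fold sum whose i-th step (counted from the outside) has type
  \<open>([i > a], [i > b])\<close>.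
\<close>

primrec chain :: "nat \<Rightarrow> int \<Rightarrow> nat \<Rightarrow> nat \<Rightarrow> int \<Rightarrow> int \<Rightarrow> complex" where
  "chain 0 t a b = seed t"
| "chain (Suc k) t a b = bstep (if a = 0 then 1 else 0) (if b = 0 then 1 else 0) (chain k t (a - 1) (b - 1))"

lemma chain_swap: "chain k t a b r s = chain k t b a s r"
proof (induction k arbitrary: a b r s)
  case 0
  show ?case by (simp add: seed_def mult_ac add_ac)
next
  case (Suc k)
  have "(\<lambda>r s. chain k t (a - 1) (b - 1) s r) = chain k t (b - 1) (a - 1)"
    by (intro ext Suc.IH)
  thus ?case unfolding chain.simps by (subst bstep_swap) (simp only:)
qed

definition nn :: "int \<Rightarrow> int \<Rightarrow> int" where
  "nn v w = v\<^sup>2 + v * w + w\<^sup>2"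

lemma nn_sym: "nn w v = nn v w" "nn v (- v - w) = nn v w"
  by (simp_all add: nn_def algebra_simps power2_eq_square)

text \<open>For \<open>v = w = 0\<close> all three entries are 1 and the conditions of
  \<open>bstep_tri\<close> on the extreme entries fail. The coefficient vanishes there, and
  \<open>v \<noteq> w\<close> is enough in the other cases.\<close>

lemma bstep_tri11:
  assumes "seed_coeff v w \<noteq> 0"
  shows "bstep 1 1 (\<lambda>r s. tri11 v w r s) L M =
    q powi (nn v w - 1) * tri11 v w L M"
proof -
  have "v \<noteq> w" using assms by auto
  hence mm: "min (1 + v) (min (1 + w) (1 - v - w)) \<le> 0" "1 + 1 \<le> max (1 + v) (max (1 + w) (1 - v - w))" by linarith+
  have e: "2 * (nn v w - 1) = (1 + v)\<^sup>2 + (1 + w)\<^sup>2 + (1 - v - w)\<^sup>2 - 2 * 1\<^sup>2 - 2 * 1 * 1 - 1\<^sup>2"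
    by (simp add: nn_def algebra_simps power2_eq_square)
  have i: "r + 1 + x = r + (1 + x)" "r + 1 - x - y = r + (1 - x - y)" for r x y :: int by simp_all
  show ?thesis unfolding i using bstep_tri[OF _ mm e, of L M] by (simp add: add.assoc)
qed

lemma bstep_tri10:
  "bstep 1 0 (\<lambda>r s. tri10 v w r s) L M =
    q powi (nn v w - v) * tri10 v w L M"
proof -
  have mm: "min v (min (1 + w) (1 - v - w)) \<le> 0" "1 + 0 \<le> max v (max (1 + w) (1 - v - w))" by linarith+
  have e: "2 * (nn v w - v) = v\<^sup>2 + (1 + w)\<^sup>2 + (1 - v - w)\<^sup>2 - 2 * 1\<^sup>2 - 2 * 1 * 0 - 0\<^sup>2"
    by (simp add: nn_def algebra_simps power2_eq_square)
  have i: "r + 1 + x = r + (1 + x)" "r + 1 - x - y = r + (1 - x - y)" for r x y :: int by simp_all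
  show ?thesis unfolding i using bstep_tri[OF _ mm e, of L M] by simp
qed

lemma bstep_tri00:
  "bstep 0 0 (\<lambda>r s. tri00 v w r s) L M =
    q powi (nn v w - 2 * v - w + 1) * tri00 v w L M"
proof -
  have mm: "min (v - 1) (min w (1 - v - w)) \<le> 0" "0 + 0 \<le> max (v - 1) (max w (1 - v - w))" by linarith+
  have e: "2 * (nn v w - 2 * v - w + 1) = (v - 1)\<^sup>2 + w\<^sup>2 + (1 - v - w)\<^sup>2 - 2 * 0\<^sup>2 - 2 * 0 * 0 - 0\<^sup>2"
    by (simp add: nn_def algebra_simps power2_eq_square)
  have i: "r + x - 1 = r + (x - 1)" "r + 1 - x - y = r + (1 - x - y)" for r x y :: int by simp_all
  show ?thesis unfolding i using bstep_tri[OF _ mm e, of L M] by simp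
qed

definition c11 :: "nat \<Rightarrow> int \<Rightarrow> int \<Rightarrow> complex" where
  "c11 k v w = q^2 * seed_coeff v w * q powi (int k * (nn v w - 1))"

text \<open>The extra factor is needed because steps of type (1,0) contribute
  \<open>m * (nn v w - v)\<close>: the invariant part is counted with the coefficient, the part in
  \<open>v\<close> with the weight \<open>W\<close> of \<open>lower_tri10\<close>.\<close>

lemma antisym_c11: "antisym_coeff (\<lambda>v w. c11 k v w * q powi (m * nn v w))"
proof -
  have "c11 k w v * q powi (m * nn w v) = - (c11 k v w * q powi (m * nn v w))" for v w
    unfolding c11_def nn_sym(1)[of w v] seed_coeff_swap12[of w v] by simp
  moreover have "c11 k v (- v - w) * q powi (m * nn v (- v - w)) = - (c11 k v w * q powi (m * nn v w))" for v w
    unfolding c11_def nn_sym(2) seed_coeff_swap23 by simp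
  ultimately show ?thesis unfolding antisym_coeff_def by blast
qed

lemma c11_Suc: "c11 (Suc k) v w = c11 k v w * q powi (nn v w - 1)"
proof -
  have "int (Suc k) * (nn v w - 1) = int k * (nn v w - 1) + (nn v w - 1)" by (simp add: algebra_simps)
  thus ?thesis unfolding c11_def by (simp only: powi_add mult.assoc)
qed

lemma chain_has_sum11:
  assumes "s \<ge> 0"
  shows "((\<lambda>(v, w). c11 k v w * q powi (- 2 * v - w) * tri11 v w r s)
     has_sum chain k 1 0 0 r s) UNIV"
  using assms
proof (induction k arbitrary: r s)
  case 0
  thus ?case using seed_has_sum[of s r] by (simp add: c11_def)
next
  case (Suc k)
  have "((\<lambda>x. bstep 1 1 (\<lambda>r s. (\<lambda>(v, w). c11 k v w * q powi (- 2 * v - w) * tri11 v w r s) x) r s)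
     has_sum bstep 1 1 (chain k 1 0 0) r s) UNIV"
    by (rule bstep_has_sum) (rule Suc.IH)
  also have "?this \<longleftrightarrow> ((\<lambda>(v, w). c11 (Suc k) v w * q powi (- 2 * v - w) * tri11 v w r s)
     has_sum bstep 1 1 (chain k 1 0 0) r s) UNIV"
  proof (rule has_sum_cong, goal_cases)
    case (1 x)
    obtain v w where x: "x = (v, w)" by force
    have "seed_coeff v w \<noteq> 0 \<or> c11 k v w = 0" by (auto simp: c11_def)
    thus ?case unfolding x prod.case bstep_cmult c11_Suc using bstep_tri11[of v w r s] by auto
  qed
  finally show ?case by simp
qed

text \<open>The \<open>k\<close> inner steps have type (1,1), the \<open>m\<close> outer ones type
  (1,0). The type of the expansion changes once, before the first outer step.\<close>

lemma chain_has_sum10: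
  assumes "r \<ge> 0" "s \<ge> 0"
  shows "((\<lambda>(v, w). c11 k v w * q powi (- 2 * v - w) * q powi (int m * (nn v w - v))
      * tri10 v w r s) has_sum chain (k + m) 1 0 m r s) UNIV"
  using assms
proof (induction m arbitrary: r s)
  case 0
  show ?case using lower_tri11[of "c11 k" r s, OF _ _ chain_has_sum11] antisym_c11[of k 0] 0 by simp
next
  case (Suc m)
  have "((\<lambda>x. bstep 1 0 (\<lambda>r s. (\<lambda>(v, w). c11 k v w * q powi (- 2 * v - w) * q powi (int m * (nn v w - v))
      * tri10 v w r s) x) r s)
     has_sum bstep 1 0 (chain (k + m) 1 0 m) r s) UNIV"
    by (rule bstep_has_sum) (rule Suc.IH)
  also have "?this \<longleftrightarrow> ((\<lambda>(v, w). c11 k v w * q powi (- 2 * v - w) * q powi (int (Suc m) * (nn v w - v))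
      * tri10 v w r s) has_sum bstep 1 0 (chain (k + m) 1 0 m) r s) UNIV"
  proof (rule has_sum_cong, goal_cases)
    case (1 x)
    obtain v w where x: "x = (v, w)" by force
    have "q powi (int (Suc m) * (nn v w - v)) = q powi (int m * (nn v w - v)) * q powi (nn v w - v)"
      unfolding powi_add[symmetric] by (simp add: algebra_simps)
    thus ?case unfolding x prod.case bstep_cmult bstep_tri10 by (simp only: mult_ac)
  qed
  finally show ?case by simp
qed

text \<open>
  The factor \<open>1 - q^(r+v)\<close> in the proof is what remains of the subtracted sum; it is exactly what makes
  the passage from type (1,0) to type (0,0) possible.
\<close>

lemma chain_diff_base:
  assumes "L \<ge> 0" "M \<ge> 0"
  shows "((\<lambda>(v, w). c11 k v w * q powi (- 2 * v - w) * q powi (int m * (nn v w - v)) * q powi (nn v w - 2 * v - w + 1)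
      * tri00 v w L M)
     has_sum (chain (Suc (k + m)) 1 1 (Suc m) L M - q * chain (Suc (k + m)) 1 0 m L M)) UNIV"
proof -
  define A where "A = (\<lambda>v w. c11 k v w * q powi (- 2 * v - w) * q powi (int m * (nn v w - v)))"
  define T where "T = (\<lambda>v w r s. tri10 v w r s)"
  define h where "h = (\<lambda>r s. \<Sum>\<^sub>\<infinity>(v, w). A v w * ((1 - q powi (r + v)) * T v w r s))"
  have h: "((\<lambda>(v, w). A v w * ((1 - q powi (r + v)) * T v w r s)) has_sum h r s) UNIV" for r s
    unfolding h_def
    using has_sum_infsum[OF summable_tri[of "\<lambda>v w. A v w * (1 - q powi (r + v))" "r + s + 1" r "r + 1" "r + 1"]]
    by (simp add: T_def mult.assoc)
  have AT: "((\<lambda>(v, w). A v w * T v w r s) has_sum chain (k + m) 1 0 m r s) UNIV" if "r \<ge> 0" "s \<ge> 0" for r s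
    using chain_has_sum10[OF that, of k m] by (simp add: A_def T_def)
  have 1: "((\<lambda>x. bstep 0 0 (\<lambda>r s. (\<lambda>(v, w). A v w * T v w r s) x) L M) has_sum bstep 0 0 (chain (k + m) 1 0 m) L M) UNIV"
    by (rule bstep_has_sum) (rule AT)
  \<comment> \<open>The factor \<open>q^r\<close> makes a (0,0) step into a (1,0) step, with
    eigenvalue \<open>q^(nn v w - v)\<close>. The remaining \<open>q^v\<close> cancels the linear
    part, leaving \<open>q\<close> times the eigenvalue of a (1,1) step: the subtracted chain has
    one more inner step of type (1,1).\<close>
  have 2: "((\<lambda>x. bstep 0 0 (\<lambda>r s. (\<lambda>(v, w). A v w * (q powi (r + v) * T v w r s)) x) L M) has_sum q * chain (Suc (k + m)) 1 0 m L M) UNIV"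
  proof -
    have "((\<lambda>x. q * (\<lambda>(v, w). c11 (Suc k) v w * q powi (- 2 * v - w) * q powi (int m * (nn v w - v)) * T v w L M) x)
       has_sum q * chain (Suc k + m) 1 0 m L M) UNIV"
      unfolding T_def by (rule has_sum_cmult_right) (rule chain_has_sum10[OF assms])
    also have "?this \<longleftrightarrow> ((\<lambda>x. bstep 0 0 (\<lambda>r s. (\<lambda>(v, w). A v w * (q powi (r + v) * T v w r s)) x) L M) has_sum q * chain (Suc k + m) 1 0 m L M) UNIV"
    proof (rule has_sum_cong, goal_cases)
      case (1 x)
      obtain v w where x: "x = (v, w)" by force
      have "bstep 0 0 (\<lambda>r s. A v w * (q powi (r + v) * T v w r s)) L M = A v w * bstep 0 0 (\<lambda>r s. q powi (r + v) * T v w r s) L M"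
        by (rule bstep_cmult)
      also have "bstep 0 0 (\<lambda>r s. q powi (r + v) * T v w r s) L M = bstep 1 0 (\<lambda>r s. q powi v * T v w r s) L M"
        by (rule bstep_cong) (simp add: powi_add)
      also have "\<dots> = q powi v * (q powi (nn v w - v) * T v w L M)"
        unfolding bstep_cmult T_def bstep_tri10 ..
      also have "A v w * \<dots> = A v w * (q powi v * q powi (nn v w - v)) * T v w L M" by (simp only: mult_ac)
      also have "q powi v * q powi (nn v w - v) = q * q powi (nn v w - 1)"
      proof -
        have "q powi v * q powi (nn v w - v) = q powi (1 + (nn v w - 1))" unfolding powi_add[symmetric] by simp
        thus ?thesis by (simp only: powi_add power_int_1_right)
      qed
      also have "A v w * (q * q powi (nn v w - 1)) * T v w L M = q * (c11 (Suc k) v w * q powi (- 2 * v - w) * q powi (int m * (nn v w - v)) * T v w L M)"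
        unfolding A_def c11_Suc by (simp only: mult_ac)
      finally show ?case unfolding x prod.case by simp
    qed
    finally show ?thesis by simp
  qed
  have 3: "((\<lambda>x. bstep 0 0 (\<lambda>r s. (\<lambda>(v, w). A v w * ((1 - q powi (r + v)) * T v w r s)) x) L M) has_sum bstep 0 0 h L M) UNIV"
    by (rule bstep_has_sum) (rule h)
  have "((\<lambda>x. bstep 0 0 (\<lambda>r s. (\<lambda>(v, w). A v w * T v w r s) x) L M - bstep 0 0 (\<lambda>r s. (\<lambda>(v, w). A v w * (q powi (r + v) * T v w r s)) x) L M)
     has_sum (bstep 0 0 (chain (k + m) 1 0 m) L M - q * chain (Suc (k + m)) 1 0 m L M)) UNIV"
    by (rule has_sum_minus[OF 1 2])
  also have "?this \<longleftrightarrow> ((\<lambda>x. bstep 0 0 (\<lambda>r s. (\<lambda>(v, w). A v w * ((1 - q powi (r + v)) * T v w r s)) x) L M)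
     has_sum (bstep 0 0 (chain (k + m) 1 0 m) L M - q * chain (Suc (k + m)) 1 0 m L M)) UNIV"
    by (rule has_sum_cong) (auto simp: bstep_diff[symmetric] algebra_simps)
  finally have "bstep 0 0 h L M = bstep 0 0 (chain (k + m) 1 0 m) L M - q * chain (Suc (k + m)) 1 0 m L M"
    using 3 has_sum_unique by blast
  hence e: "chain (Suc (k + m)) 1 1 (Suc m) L M - q * chain (Suc (k + m)) 1 0 m L M = bstep 0 0 h L M" by simp
  \<comment> \<open>The exponent splits into a part invariant under permutations and a part
    depending on \<open>v\<close> alone, the form that \<open>lower_tri10\<close> asks for.\<close>
  have A: "A v w = c11 k v w * q powi (int m * nn v w) * q powi (- 2 * v - w) * q powi (- int m * v)" for v w
  proof -
    have "q powi (int m * (nn v w - v)) = q powi (int m * nn v w) * q powi (- int m * v)"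
      unfolding powi_add[symmetric] by (simp add: algebra_simps)
    thus ?thesis unfolding A_def by (simp only: mult_ac)
  qed
  have h': "((\<lambda>(v, w). A v w * tri00 v w r s) has_sum h r s) UNIV" if "r \<ge> 0" "s \<ge> 0" for r s
    using lower_tri10[OF antisym_c11[of k "int m"], of r s "\<lambda>v. q powi (- int m * v)" "h r s"] h[of r s] that
    unfolding A T_def by simp
  have "((\<lambda>x. bstep 0 0 (\<lambda>r s. (\<lambda>(v, w). A v w * tri00 v w r s) x) L M) has_sum bstep 0 0 h L M) UNIV"
    by (rule bstep_has_sum) (rule h')
  thus ?thesis unfolding e
    by (rule has_sum_cong[THEN iffD1, rotated]) (auto simp: bstep_cmult bstep_tri00 A_def)
qed

text \<open>Further (0,0) steps act on the difference as a whole, each multiplying its terms by the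
  same eigenvalue.\<close>

lemma chain_diff_has_sum:
  assumes "L \<ge> 0" "M \<ge> 0"
  shows "((\<lambda>(v, w). c11 k v w * q powi (- 2 * v - w) * q powi (int m * (nn v w - v)) * q powi (int (Suc a) * (nn v w - 2 * v - w + 1))
      * tri00 v w L M)
     has_sum (chain (Suc (k + m) + a) 1 (Suc a) (Suc (m + a)) L M - q * chain (Suc (k + m) + a) 1 a (m + a) L M)) UNIV"
  using assms
proof (induction a arbitrary: L M)
  case 0
  thus ?case using chain_diff_base[of L M k m] by simp
next
  case (Suc a)
  define X where "X = Suc (k + m) + a"
  have "((\<lambda>x. bstep 0 0 (\<lambda>L M. (\<lambda>(v, w). c11 k v w * q powi (- 2 * v - w) * q powi (int m * (nn v w - v)) * q powi (int (Suc a) * (nn v w - 2 * v - w + 1))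
      * tri00 v w L M) x) L M)
     has_sum bstep 0 0 (\<lambda>L M. chain X 1 (Suc a) (Suc (m + a)) L M - q * chain X 1 a (m + a) L M) L M) UNIV"
    unfolding X_def by (rule bstep_has_sum) (rule Suc.IH)
  also have "bstep 0 0 (\<lambda>L M. chain X 1 (Suc a) (Suc (m + a)) L M - q * chain X 1 a (m + a) L M) L M
     = chain (Suc (k + m) + Suc a) 1 (Suc (Suc a)) (Suc (m + Suc a)) L M - q * chain (Suc (k + m) + Suc a) 1 (Suc a) (m + Suc a) L M"
    unfolding bstep_diff bstep_cmult by (simp add: X_def)
  also have "((\<lambda>x. bstep 0 0 (\<lambda>L M. (\<lambda>(v, w). c11 k v w * q powi (- 2 * v - w) * q powi (int m * (nn v w - v)) * q powi (int (Suc a) * (nn v w - 2 * v - w + 1))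
      * tri00 v w L M) x) L M) has_sum
      (chain (Suc (k + m) + Suc a) 1 (Suc (Suc a)) (Suc (m + Suc a)) L M - q * chain (Suc (k + m) + Suc a) 1 (Suc a) (m + Suc a) L M)) UNIV
    \<longleftrightarrow> ?case"
  proof (rule has_sum_cong, goal_cases)
    case (1 x)
    obtain v w where x: "x = (v, w)" by force
    have "q powi (int (Suc (Suc a)) * (nn v w - 2 * v - w + 1)) = q powi (int (Suc a) * (nn v w - 2 * v - w + 1)) * q powi (nn v w - 2 * v - w + 1)"
      unfolding powi_add[symmetric] by (simp add: algebra_simps)
    thus ?case unfolding x prod.case bstep_cmult bstep_tri00 by (simp only: mult_ac)
  qed
  finally show ?case .
qed

end

section \<open>The Jacobi triple product and the A2 Macdonald identity\<close>

text \<open>Dominated convergence for unordered sums: the majorant gives uniform convergence of the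
  partial sums, so the two limits may be exchanged.\<close>

lemma has_sum_dominated:
  fixes f :: "nat \<Rightarrow> 'a \<Rightarrow> complex"
  assumes g: "g summable_on A" and le: "\<And>n x. x \<in> A \<Longrightarrow> norm (f n x) \<le> g x"
    and lim: "\<And>x. x \<in> A \<Longrightarrow> (\<lambda>n. f n x) \<longlonglongrightarrow> f' x"
    and S: "\<And>n. (f n has_sum S n) A"
  shows "f' summable_on A" "S \<longlonglongrightarrow> infsum f' A"
proof -
  have le': "norm (f' x) \<le> g x" if "x \<in> A" for x
    using tendsto_norm[OF lim[OF that]] le[OF that] by (meson LIMSEQ_le_const2)
  show sum: "f' summable_on A"
    by (rule abs_summable_summable) (rule Infinite_Sum.abs_summable_on_comparison_test'[OF g le'])
  have 1: "uniform_limit UNIV (\<lambda>X n. \<Sum>x\<in>X. f n x) S (finite_subsets_at_top A)"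
    by (rule Weierstrass_m_test_general'[OF le S g])
  have 2: "\<forall>\<^sub>F X in finite_subsets_at_top A. (\<lambda>n. \<Sum>x\<in>X. f n x) \<longlonglongrightarrow> (\<Sum>x\<in>X. f' x)"
    by (rule eventually_finite_subsets_at_top_weakI) (auto intro!: tendsto_sum lim)
  have 3: "((\<lambda>X. \<Sum>x\<in>X. f' x) \<longlongrightarrow> infsum f' A) (finite_subsets_at_top A)"
    using sum by (rule infsum_tendsto)
  show "S \<longlonglongrightarrow> infsum f' A"
    by (rule swap_uniform_limit'[OF 2 3 1]) auto
qed

lemma summable_product:
  fixes f :: "'i \<Rightarrow> real" and g :: "'j \<Rightarrow> real"
  assumes "f summable_on A" "g summable_on B" "\<And>x. f x \<ge> 0" "\<And>x. g x \<ge> 0"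
  shows "(\<lambda>(i, j). f i * g j) summable_on A \<times> B"
proof (rule summable_on_SigmaI)
  show "((\<lambda>j. (\<lambda>(i, j). f i * g j) (i, j)) has_sum (f i * infsum g B)) B" for i
    using has_sum_cmult_right[OF has_sum_infsum[OF assms(2)], of "f i"] by simp
  show "(\<lambda>i. f i * infsum g B) summable_on A" by (rule summable_on_cmult_left[OF assms(1)])
qed (use assms in auto)

section \<open>The Jacobi triple product as a limit of finite identities\<close>

definition trg :: "int \<Rightarrow> int" where "trg j = j * (j - 1) div 2"

lemma trg_succ: "trg (j + 1) = trg j + j"
proof -
  have "(j + 1) * (j + 1 - 1) = j * (j - 1) + j * 2" by (simp add: algebra_simps)
  thus ?thesis unfolding trg_def by (simp only: div_mult_self1 zero_neq_numeral not_False_eq_True)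
qed

lemma trg_pred: "trg (j - 1) = trg j - (j - 1)"
  using trg_succ[of "j - 1"] by simp

lemma trg_double: "2 * trg j = j * (j - 1)"
proof -
  have "even (j * (j - 1))" by simp
  thus ?thesis by (simp add: trg_def)
qed

lemma trg_minus: "trg (- j) = trg j + j"
proof -
  have "2 * trg (- j) = 2 * (trg j + j)" unfolding distrib_left trg_double by (simp add: algebra_simps)
  thus ?thesis by simp
qed

lemma trg_0 [simp]: "trg 0 = 0" by (simp add: trg_def)

text \<open>The ratio of consecutive terms is \<open>y * p^n\<close>, which tends to 0. Reflecting
  \<open>j\<close> replaces \<open>y\<close> by \<open>p / y\<close>, so the same estimate covers
  the negative half.\<close>

lemma gauss_summable:
  fixes p y :: real
  assumes p: "0 < p" "p < 1" and y: "0 < y"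
  shows "(\<lambda>j. y powi j * p powi trg j) summable_on UNIV"
proof -
  have nat: "(\<lambda>n::nat. y powi int n * p powi trg (int n)) summable_on UNIV" if y: "0 < y" for y
  proof (rule norm_summable_imp_summable_on)
    define f where "f = (\<lambda>n::nat. y powi int n * p powi trg (int n))"
    have rec: "f (Suc n) = y * p ^ n * f n" for n
    proof -
      have "int (Suc n) = int n + 1" by simp
      hence "trg (int (Suc n)) = trg (int n) + int n" by (simp only: trg_succ)
      thus ?thesis unfolding f_def using p y by (simp only: power_int_add) (simp add: power_int_add)
    qed
    have "(\<lambda>n. y * p ^ n) \<longlonglongrightarrow> y * 0" using p by (intro tendsto_intros LIMSEQ_power_zero) auto
    hence "\<forall>\<^sub>F n in sequentially. y * p ^ n < 1/2" by (rule order_tendstoD) simp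
    then obtain N where N: "\<And>n. n \<ge> N \<Longrightarrow> y * p ^ n < 1/2" by (auto simp: eventually_at_top_linorder)
    have "summable f"
    proof (rule summable_ratio_test[of "1/2" N])
      fix n assume "n \<ge> N"
      have "norm (f (Suc n)) = y * p ^ n * norm (f n)" unfolding rec using p y by (simp add: abs_mult)
      also have "\<dots> \<le> 1/2 * norm (f n)" using N[OF \<open>n \<ge> N\<close>] by (intro mult_right_mono) auto
      finally show "norm (f (Suc n)) \<le> 1/2 * norm (f n)" .
    qed simp
    moreover have "norm (f n) = f n" for n using p y by (simp add: f_def)
    ultimately show "summable (\<lambda>n. norm (y powi int n * p powi trg (int n)))" unfolding f_def by simp
  qed
  have 1: "(\<lambda>j. y powi j * p powi trg j) summable_on range int"
    by (subst summable_on_reindex) (use nat[OF y] in \<open>auto simp: o_def\<close>)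
  have 2: "(\<lambda>j. y powi j * p powi trg j) summable_on range (\<lambda>n. - int n)"
  proof (subst summable_on_reindex)
    have "y powi (- int n) * p powi trg (- int n) = (p / y) powi int n * p powi trg (int n)" for n
      using p y by (simp add: trg_minus power_int_add power_int_minus power_int_divide_distrib field_simps)
    thus "((\<lambda>j. y powi j * p powi trg j) \<circ> (\<lambda>n. - int n)) summable_on UNIV"
      using nat[of "p / y"] p y by (simp add: o_def)
  qed (auto intro: injI)
  have "UNIV = range int \<union> range (\<lambda>n. - int n)" by (auto, metis int_cases2 rangeI)
  thus ?thesis using summable_on_union[OF 1 2] by simp
qed

context nome begin

lemma convergent_prod_qpoch: "convergent_prod (\<lambda>j. 1 - a * q ^ j)"
proof -
  have "summable (\<lambda>j. norm (- (a * q ^ j)))"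
    using q_lt by (auto simp: norm_mult norm_power intro!: summable_mult summable_geometric)
  hence "summable (\<lambda>j. norm ((1 - a * q ^ j) - 1))" by simp
  hence "abs_convergent_prod (\<lambda>j. 1 - a * q ^ j)" by (simp add: abs_convergent_prod_conv_summable)
  thus ?thesis by (rule abs_convergent_prod_imp_convergent_prod)
qed

lemma qpoch_tendsto: "(\<lambda>n. qpoch a q n) \<longlonglongrightarrow> qpoch_inf a q"
  using convergent_prod_LIMSEQ[OF convergent_prod_qpoch[of a]]
  unfolding qpoch_def qpoch_inf_def by (simp only: LIMSEQ_lessThan_iff_atMost)

definition qinf :: complex where "qinf = qpoch_inf q q"

lemma qinf_nz: "qinf \<noteq> 0"
proof -
  have "1 - q * q ^ j \<noteq> 0" for j
    using powi_neq_1[of "int (Suc j)"] unfolding power_int_of_nat by simp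
  thus ?thesis unfolding qinf_def qpoch_inf_def using prodinf_nonzero[OF convergent_prod_qpoch[of q]] by simp
qed

lemma filterlim_linear_int: "c > 0 \<Longrightarrow> filterlim (\<lambda>n. nat (c * int n + d)) at_top sequentially"
proof (subst filterlim_at_top, intro allI)
  fix Z assume c: "c > 0"
  show "\<forall>\<^sub>F n in sequentially. Z \<le> nat (c * int n + d)"
    unfolding eventually_at_top_linorder
  proof (intro exI allI impI)
    fix n assume n: "n \<ge> nat (int Z - d)"
    have "int n \<le> c * int n" using c by (simp add: mult_le_cancel_right1)
    thus "Z \<le> nat (c * int n + d)" using n by linarith
  qed
qed

lemma qfac_tendsto: "c > 0 \<Longrightarrow> (\<lambda>n. qfac q (c * int n + d)) \<longlonglongrightarrow> qinf"
  unfolding qfac_def qinf_def by (rule filterlim_compose[OF qpoch_tendsto filterlim_linear_int])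

lemma rq_tendsto:
  assumes "c > 0"
  shows "(\<lambda>n. rq q (c * int n + d)) \<longlonglongrightarrow> 1 / qinf"
proof -
  have "(\<lambda>n. 1 / qfac q (c * int n + d)) \<longlonglongrightarrow> 1 / qinf"
    by (intro tendsto_intros qfac_tendsto assms qinf_nz)
  moreover have "\<forall>\<^sub>F n in sequentially. 1 / qfac q (c * int n + d) = rq q (c * int n + d)"
    unfolding eventually_at_top_linorder
  proof (intro exI allI impI)
    fix n assume n: "n \<ge> nat (- d)"
    have "int n \<le> c * int n" using assms by (simp add: mult_le_cancel_right1)
    thus "1 / qfac q (c * int n + d) = rq q (c * int n + d)" using n by (simp add: rq_def qfac_def)
  qed
  ultimately show ?thesis by (rule Lim_transform_eventually)
qed

lemma qfac_bounded: "\<exists>B. \<forall>n. norm (qfac q n) \<le> B"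
proof -
  have "Bseq (\<lambda>n. qpoch q q n)" using qpoch_tendsto[of q] convergentI convergent_imp_Bseq by blast
  then obtain B where "\<And>n. norm (qpoch q q n) \<le> B" by (auto simp: Bseq_def)
  thus ?thesis unfolding qfac_def by blast
qed

lemma rq_bounded: "\<exists>B. \<forall>n. norm (rq q n) \<le> B"
proof -
  have "(\<lambda>n. 1 / qpoch q q n) \<longlonglongrightarrow> 1 / qinf"
    using qpoch_tendsto[of q] qinf_nz by (intro tendsto_intros) (auto simp: qinf_def)
  hence "Bseq (\<lambda>n. 1 / qpoch q q n)" using convergentI convergent_imp_Bseq by blast
  then obtain B where B: "\<And>n. norm (1 / qpoch q q n) \<le> B" by (auto simp: Bseq_def)
  have "norm (rq q n) \<le> max B 0" for n using B[of "nat n"] by (auto simp: rq_def)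
  thus ?thesis by blast
qed

text \<open>A finite form in which \<open>rq\<close> cuts the sum off at \<open>|j| > n\<close>.
  Passing from \<open>n\<close> to \<open>n + 1\<close> multiplies the product side by two linear
  factors over \<open>c\<close>, and on the sum side this is a three-term relation between
  neighbouring \<open>j\<close>.\<close>

lemma jtp_finite:
  assumes z: "z \<noteq> 0"
  shows "((\<lambda>j. (-z) powi j * q powi trg j * (rq q (int n + j) * rq q (int n - j)))
    has_sum (qpoch z q n * qpoch (q / z) q n / qfac q (2 * int n))) UNIV"
proof (induction n)
  case 0
  define f where "f = (\<lambda>j. (-z) powi j * q powi trg j * (rq q j * rq q (- j)))"
  have "(f has_sum f 0) UNIV \<longleftrightarrow> (f has_sum f 0) {0}"
    by (rule has_sum_cong_neutral) (auto simp: f_def rq_def)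
  moreover have "(f has_sum f 0) {0}" using has_sum_finite[of "{0}" f] by simp
  ultimately have "(f has_sum 1) UNIV" by (simp add: f_def)
  thus ?case by (simp add: qpoch_def qfac_def f_def)
next
  case (Suc n)
  define x where "x = - z"
  have x: "x \<noteq> 0" using z by (simp add: x_def)
  define a where "a = (\<lambda>j. x powi j * q powi trg j * (rq q (int n + j) * rq q (int n - j)))"
  define b where "b = (\<lambda>j. x powi j * q powi trg j * (rq q (int (Suc n) + j) * rq q (int (Suc n) - j)))"
  define s where "s = qpoch z q n * qpoch (q / z) q n / qfac q (2 * int n)"
  have a: "(a has_sum s) UNIV" using Suc by (simp add: a_def s_def x_def)
  have a1: "((\<lambda>j. a (j - 1)) has_sum s) UNIV"
    using a by (subst has_sum_reindex_bij_witness[of _ "\<lambda>j. j + 1" "\<lambda>j. j - 1" UNIV a _ s s]) auto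
  have a2: "((\<lambda>j. a (j + 1)) has_sum s) UNIV"
    using a by (subst has_sum_reindex_bij_witness[of _ "\<lambda>j. j - 1" "\<lambda>j. j + 1" UNIV a _ s s]) auto
  define N where "N = q powi int n"
  have N: "q ^ n = N" by (simp add: N_def)
  define c where "c = (1 - q powi (2 * int n + 1)) * (1 - q powi (2 * int n + 2))"
  have c_nz: "c \<noteq> 0" using powi_neq_1[of "2 * int n + 1"] powi_neq_1[of "2 * int n + 2"] by (auto simp: c_def)
  \<comment> \<open>The coefficients come from expanding
    \<open>(1 - z * N) * (1 - q / z * N)\<close> with \<open>x = -z\<close>; powers of
    \<open>z\<close> become shifts of \<open>j\<close>.\<close>
  have "((\<lambda>j. (1 + q * N * N) * a j + x * N * a (j - 1) + (q * N / x) * a (j + 1)) has_sum ((1 + q * N * N) * s + x * N * s + (q * N / x) * s)) UNIV"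
    by (intro has_sum_add has_sum_cmult_right a a1 a2)
  also have "(\<lambda>j. (1 + q * N * N) * a j + x * N * a (j - 1) + (q * N / x) * a (j + 1)) = (\<lambda>j. c * b j)"
  proof
    fix j
    define J where "J = q powi j"
    have J: "J \<noteq> 0" by (simp add: J_def)
    define u w where "u = q * N * J" and "w = q * N / J"
    define B where "B = rq q (int (Suc n) + j)"
    define B' where "B' = rq q (int (Suc n) - j)"
    define X where "X = x powi j * q powi trg j"
    have u: "q powi (int (Suc n) + j) = u" "q powi (int (Suc n) + j - 1) = u / q"
      unfolding u_def N_def J_def by (simp_all only: powi_add powi_diff of_nat_Suc) simp_all
    have w: "q powi (int (Suc n) - j) = w" "q powi (int (Suc n) - j - 1) = w / q"
      unfolding w_def N_def J_def by (simp_all only: powi_add powi_diff of_nat_Suc) simp_all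
    have i: "int (Suc n) + j - 1 = int n + j" "int (Suc n) - j - 1 = int n - j" by simp_all
    have r1: "rq q (int n + j) = (1 - u) * B" using rq_rec[of "int (Suc n) + j"] unfolding u B_def i .
    have r2: "rq q (int n + j - 1) = (1 - u / q) * (1 - u) * B"
      using rq_rec[of "int n + j"] u(2) unfolding i r1 by simp
    have r3: "rq q (int n - j) = (1 - w) * B'" using rq_rec[of "int (Suc n) - j"] unfolding w B'_def i .
    have r4: "rq q (int n - j - 1) = (1 - w / q) * (1 - w) * B'"
      using rq_rec[of "int n - j"] w(2) unfolding i r3 by simp
    have t0: "a j = X * ((1 - u) * (1 - w) * B * B')" unfolding a_def X_def r1 r3 by simp
    have t1: "x * N * a (j - 1) = X * (w * (1 - u) * (1 - u / q) * B * B')"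
    proof -
      have e1: "x powi (j - 1) = x powi j / x" using x by (simp add: power_int_diff)
      have e2: "q powi trg (j - 1) = q powi trg j * (q / J)"
        unfolding trg_pred J_def by (simp only: powi_diff) simp
      have k: "int n + (j - 1) = int n + j - 1" "int n - (j - 1) = int (Suc n) - j" by simp_all
      show ?thesis unfolding a_def k r2 e1 e2 X_def w_def B'_def[symmetric] using x J by (simp add: field_simps)
    qed
    have t2: "(q * N / x) * a (j + 1) = X * (u * (1 - w) * (1 - w / q) * B * B')"
    proof -
      have e1: "x powi (j + 1) = x powi j * x" using x by (simp add: power_int_add)
      have e2: "q powi trg (j + 1) = q powi trg j * J" unfolding trg_succ J_def by (simp only: powi_add)
      have k: "int n + (j + 1) = int (Suc n) + j" "int n - (j + 1) = int n - j - 1" by simp_all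
      show ?thesis unfolding a_def k r4 e1 e2 X_def u_def B_def[symmetric] using x J by (simp add: field_simps)
    qed
    have uw: "u * w = q * q * N * N" using J by (simp add: u_def w_def)
    have cu: "c = (1 - u * w / q) * (1 - u * w)"
    proof -
      have "2 * int n + 1 = 1 + int n + int n" "2 * int n + 2 = 1 + 1 + int n + int n" by simp_all
      hence "q powi (2 * int n + 1) = q * N * N" "q powi (2 * int n + 2) = q * q * N * N"
        unfolding N_def by (simp_all only: powi_add power_int_1_right)
      thus ?thesis unfolding c_def uw by simp
    qed
    have qN: "q * N * N = u * w / q" using uw by simp
    \<comment> \<open>The induction step reduces to this identity in \<open>u = q^(n+1+j)\<close>
      and \<open>w = q^(n+1-j)\<close>, whose product does not depend on \<open>j\<close>.\<close>
    have id: "(1 + u * w / q) * (1 - u) * (1 - w) + w * (1 - u) * (1 - u / q) + u * (1 - w) * (1 - w / q) = (1 - u * w / q) * (1 - u * w)"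
      by (simp add: field_simps)
    have "(1 + q * N * N) * a j + x * N * a (j - 1) + (q * N / x) * a (j + 1)
       = X * B * B' * ((1 + u * w / q) * (1 - u) * (1 - w) + w * (1 - u) * (1 - u / q) + u * (1 - w) * (1 - w / q))"
    proof -
      have "(1 + c) * (X * (a * b * B * B')) + X * (w * a * a2 * B * B') + X * (u * b * b2 * B * B')
        = X * B * B' * ((1 + c) * a * b + w * a * a2 + u * b * b2)" for a b c a2 b2
        by (simp add: algebra_simps)
      thus ?thesis unfolding t0 t1 t2 qN .
    qed
    also have "\<dots> = c * b j" unfolding id cu b_def X_def B_def B'_def by simp
    finally show "(1 + q * N * N) * a j + x * N * a (j - 1) + (q * N / x) * a (j + 1) = c * b j" .
  qed
  finally have "((\<lambda>j. 1 / c * (c * b j)) has_sum (1 / c * ((1 + q * N * N) * s + x * N * s + (q * N / x) * s))) UNIV"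
    by (rule has_sum_cmult_right)
  hence "(b has_sum (1 / c * ((1 + q * N * N) * s + x * N * s + (q * N / x) * s))) UNIV" using c_nz by simp
  moreover have "1 / c * ((1 + q * N * N) * s + x * N * s + (q * N / x) * s) = qpoch z q (Suc n) * qpoch (q / z) q (Suc n) / qfac q (2 * int (Suc n))"
  proof -
    have q1: "qfac q (2 * int n + 2) = (1 - q powi (2 * int n + 2)) * qfac q (2 * int n + 1)"
    proof -
      have "2 * int n + 2 - 1 = 2 * int n + 1" by simp
      moreover have "(1::int) \<le> 2 * int n + 2" by simp
      ultimately show ?thesis by (metis qfac_rec)
    qed
    have q2: "qfac q (2 * int n + 1) = (1 - q powi (2 * int n + 1)) * qfac q (2 * int n)"
      using qfac_rec[of "2 * int n + 1"] by simp
    have e: "2 * int (Suc n) = 2 * int n + 2" by simp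
    have "qfac q (2 * int (Suc n)) = c * qfac q (2 * int n)" unfolding e c_def q1 q2 by simp
    moreover have "(1 + q * N * N) * s + x * N * s + (q * N / x) * s = s * ((1 - z * N) * (1 - q / z * N))"
      unfolding x_def using z by (simp add: field_simps)
    ultimately show ?thesis unfolding s_def qpoch_Suc N using c_nz by simp
  qed
  ultimately show ?case unfolding b_def x_def by simp
qed

lemma norm_powi_summable:
  assumes "x \<noteq> 0"
  shows "(\<lambda>j. norm (x powi j * q powi trg j)) summable_on UNIV"
  using gauss_summable[of "norm q" "norm x"] assms q_lt by (simp add: norm_mult norm_power_int)

text \<open>As \<open>n\<close> grows, each term of the finite form acquires
  \<open>1 / qinf^2\<close> and the product side \<open>1 / qinf\<close>; one factor
  \<open>qinf\<close> remains.\<close>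

theorem jacobi_triple:
  assumes z: "z \<noteq> 0"
  shows "((\<lambda>j. (-z) powi j * q powi trg j) has_sum (qinf * theta z q)) UNIV"
proof -
  obtain B1 where B1: "\<And>n. norm (qfac q n) \<le> B1" using qfac_bounded by blast
  obtain B2 where B2: "\<And>n. norm (rq q n) \<le> B2" using rq_bounded by blast
  have B: "0 \<le> B1" "0 \<le> B2" using B1[of 0] B2[of 0] norm_ge_zero order_trans by blast+
  define f where "f = (\<lambda>n j. (-z) powi j * q powi trg j * (rq q (int n + j) * rq q (int n - j)))"
  have s: "(\<lambda>j. norm ((-z) powi j * q powi trg j) * (B2 * B2)) summable_on UNIV"
    by (intro summable_on_cmult_left norm_powi_summable) (use z in simp)
  have le: "norm (f n j) \<le> norm ((-z) powi j * q powi trg j) * (B2 * B2)" for n j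
    unfolding f_def norm_mult[of "(-z) powi j * q powi trg j"] norm_mult[of "rq q _"]
    by (intro mult_left_mono mult_mono B2 B) auto
  have lim: "(\<lambda>n. f n j) \<longlonglongrightarrow> (-z) powi j * q powi trg j * (1 / qinf * (1 / qinf))" for j
    unfolding f_def
    using rq_tendsto[of 1 j] rq_tendsto[of 1 "- j"] by (intro tendsto_intros) auto
  have fs: "(f n has_sum (qpoch z q n * qpoch (q / z) q n / qfac q (2 * int n))) UNIV" for n
    unfolding f_def by (rule jtp_finite[OF z])
  note D = has_sum_dominated[OF s le lim fs]
  have "(\<lambda>n. qpoch z q n * qpoch (q / z) q n / qfac q (2 * int n)) \<longlonglongrightarrow> qpoch_inf z q * qpoch_inf (q / z) q / qinf"
    using qfac_tendsto[of 2 0] by (intro tendsto_intros qpoch_tendsto qinf_nz) auto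
  with D(2) have "infsum (\<lambda>j. (-z) powi j * q powi trg j * (1 / qinf * (1 / qinf))) UNIV = theta z q / qinf"
    using LIMSEQ_unique unfolding theta_def by blast
  hence "((\<lambda>j. (-z) powi j * q powi trg j * (1 / qinf * (1 / qinf))) has_sum theta z q / qinf) UNIV"
    using has_sum_infsum[OF D(1)] by simp
  from has_sum_cmult_left[OF this, of "qinf * qinf"] show ?thesis using qinf_nz by (simp add: mult_ac)
qed

end

lemma qpoch_inf_triple:
  assumes "nome q"
  shows "qpoch_inf q q = qpoch_inf q (q^3) * qpoch_inf (q^2) (q^3) * qpoch_inf (q^3) (q^3)"
proof -
  interpret nome q by fact
  interpret p: nome "q^3" by unfold_locales (use q_lt in \<open>auto simp: norm_power power_less_one_iff\<close>)
  have fin: "qpoch q q (3 * n) = qpoch q (q^3) n * qpoch (q^2) (q^3) n * qpoch (q^3) (q^3) n" for n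
  proof (induction n)
    case (Suc n)
    have e: "3 * Suc n = Suc (Suc (Suc (3 * n)))" by simp
    have "qpoch q q (3 * Suc n) = qpoch q q (3 * n) * ((1 - q * q ^ (3 * n)) * (1 - q^2 * q ^ (3 * n)) * (1 - q^3 * q ^ (3 * n)))"
      unfolding e qpoch_Suc by (simp add: power2_eq_square power3_eq_cube mult_ac)
    moreover have "q ^ (3 * n) = (q^3) ^ n" by (rule power_mult)
    ultimately show ?case unfolding Suc.IH qpoch_Suc by (simp only: mult_ac)
  qed (simp add: qpoch_def)
  have "filterlim (\<lambda>n::nat. 3 * n) at_top sequentially"
    by (rule filterlim_subseq) (auto simp: strict_mono_def)
  hence "(\<lambda>n. qpoch q q (3 * n)) \<longlonglongrightarrow> qpoch_inf q q"
    by (rule filterlim_compose[OF qpoch_tendsto])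
  moreover have "(\<lambda>n. qpoch q q (3 * n)) \<longlonglongrightarrow> qpoch_inf q (q^3) * qpoch_inf (q^2) (q^3) * qpoch_inf (q^3) (q^3)"
    unfolding fin by (intro tendsto_intros p.qpoch_tendsto)
  ultimately show ?thesis by (rule LIMSEQ_unique)
qed

section \<open>The A2 Macdonald identity\<close>

context nome begin

text \<open>The inner sum that appears when three triple products are multiplied and collected by
  powers of \<open>x\<close> and \<open>y\<close>; it depends only on the sum \<open>c\<close> of
  the two exponents.\<close>

definition gsum :: "int \<Rightarrow> complex" where
  "gsum c = (\<Sum>\<^sub>\<infinity>l. (-1) powi l * q powi (3 * trg l + (2 - c) * l))"

lemma powi_powi: "(q ^ n) powi m = q powi (int n * m)"
  by (simp add: power_int_mult flip: power_int_of_nat)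

lemma minus_powi: "(- x) powi (n::int) = (-1) powi n * x powi n" for x :: complex
  using power_int_mult_distrib[of "-1" x n] by simp

lemma gsum_theta: "((\<lambda>l. (-1) powi l * q powi (3 * trg l + (2 - c) * l)) has_sum qpoch_inf (q^3) (q^3) * theta (q powi (2 - c)) (q^3)) UNIV"
proof -
  interpret p: nome "q^3" by unfold_locales (use q_lt in \<open>auto simp: norm_power power_less_one_iff\<close>)
  have "((\<lambda>l. (- (q powi (2 - c))) powi l * (q^3) powi trg l) has_sum qpoch_inf (q^3) (q^3) * theta (q powi (2 - c)) (q^3)) UNIV"
    using p.jacobi_triple[of "q powi (2 - c)"] by (simp add: p.qinf_def)
  moreover have "(- (q powi (2 - c))) powi l * (q^3) powi trg l = (-1) powi l * q powi (3 * trg l + (2 - c) * l)" for l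
  proof -
    have "(- (q powi (2 - c))) powi l * (q^3) powi trg l = (-1) powi l * (q powi ((2 - c) * l) * q powi (3 * trg l))"
      unfolding minus_powi[of "q powi (2 - c)"] powi_powi by (simp add: power_int_mult)
    thus ?thesis unfolding powi_add[symmetric] by (simp add: add.commute)
  qed
  ultimately show ?thesis by simp
qed

lemma gsum_has_sum: "((\<lambda>l. (-1) powi l * q powi (3 * trg l + (2 - c) * l)) has_sum gsum c) UNIV"
  unfolding gsum_def by (rule has_sum_infsum) (use gsum_theta has_sum_imp_summable in blast)

text \<open>Euler's pentagonal number theorem: the triple product in base \<open>q^3\<close> and the
  residue classes modulo 3 give (q)_infinity.\<close>

lemma gsum_1: "gsum 1 = qinf"
proof -
  have "gsum 1 = qpoch_inf (q^3) (q^3) * theta q (q^3)"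
    using has_sum_unique[OF gsum_has_sum gsum_theta, of 1] by simp
  moreover have "q^3 / q = q^2" by (simp add: power3_eq_cube power2_eq_square)
  ultimately show ?thesis unfolding qinf_def qpoch_inf_triple[OF nome_axioms] theta_def by simp
qed

lemma gsum_0: "gsum 0 = gsum 1"
proof -
  have "((\<lambda>l. (-1) powi l * q powi (3 * trg l + (2 - 0) * l)) has_sum gsum 0) UNIV" by (rule gsum_has_sum)
  also have "?this \<longleftrightarrow> ((\<lambda>l. (-1) powi l * q powi (3 * trg l + (2 - 1) * l)) has_sum gsum 0) UNIV"
    by (rule has_sum_reindex_bij_witness[of _ uminus uminus]) (auto simp: trg_minus power_int_minus_one_minus algebra_simps)
  finally show ?thesis using gsum_has_sum[of 1] has_sum_unique by blast
qed

lemma gsum_2: "gsum 2 = 0"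
proof -
  have "((\<lambda>l. (-1) powi l * q powi (3 * trg l + (2 - 2) * l)) has_sum gsum 2) UNIV" by (rule gsum_has_sum)
  also have "?this \<longleftrightarrow> ((\<lambda>l. - ((-1) powi l * q powi (3 * trg l + (2 - 2) * l))) has_sum gsum 2) UNIV"
  proof (rule has_sum_reindex_bij_witness[of _ "\<lambda>l. 1 - l" "\<lambda>l. 1 - l"], goal_cases)
    case (5 l)
    have "trg (1 - l) = trg l" using trg_succ[of "- l"] trg_minus[of l] by simp
    moreover have "(-1) powi (1 - l) = - ((-1) powi l :: complex)"
      by (simp add: power_int_diff divide_simps flip: power_int_add)
    ultimately show ?case by simp
  qed auto
  finally have "gsum 2 = - gsum 2" using has_sum_uminusI[OF gsum_has_sum[of 2]] has_sum_unique by blast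
  thus ?thesis by (simp add: equal_neg_zero)
qed

lemma gsum_rec: "gsum c = - (q powi (2 - c)) * gsum (c - 3)"
proof -
  have "((\<lambda>l. (-1) powi l * q powi (3 * trg l + (2 - c) * l)) has_sum gsum c) UNIV" by (rule gsum_has_sum)
  also have "?this \<longleftrightarrow> ((\<lambda>l. - (q powi (2 - c)) * ((-1) powi l * q powi (3 * trg l + (2 - (c - 3)) * l))) has_sum gsum c) UNIV"
  proof (rule has_sum_reindex_bij_witness[of _ "\<lambda>l. l + 1" "\<lambda>l. l - 1"], goal_cases)
    case (5 l)
    have "3 * trg l + (2 - c) * l = (2 - c) + (3 * trg (l - 1) + (2 - (c - 3)) * (l - 1))"
      using trg_succ[of "l - 1"] by (simp add: algebra_simps)
    moreover have "(-1) powi (l - 1) = - ((-1) powi l :: complex)"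
      by (simp add: power_int_diff)
    ultimately show ?case by (simp only: powi_add) simp
  qed auto
  finally show ?thesis using has_sum_cmult_right[OF gsum_has_sum[of "c - 3"], of "- (q powi (2 - c))"] has_sum_unique by blast
qed

text \<open>The division by 6 is exact whenever the character is nonzero, that is, for
  \<open>c\<close> congruent to 0 or 1 modulo 3.\<close>

definition gval :: "int \<Rightarrow> complex" where
  "gval c = chi3 (1 + c) * (-1) powi c * q powi (- ((c\<^sup>2 - c) div 6))"

lemma gval_rec: "gval c = - (q powi (2 - c)) * gval (c - 3)"
proof -
  have "c\<^sup>2 - c = ((c - 3)\<^sup>2 - (c - 3)) + (c - 2) * 6" by (simp add: algebra_simps power2_eq_square)
  hence "(c\<^sup>2 - c) div 6 = ((c - 3)\<^sup>2 - (c - 3)) div 6 + (c - 2)" by simp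
  hence "- ((c\<^sup>2 - c) div 6) = (2 - c) + - (((c - 3)\<^sup>2 - (c - 3)) div 6)" by simp
  moreover have "chi3 (1 + c) = chi3 (1 + (c - 3))" using chi3_add_mult[of "1 + (c - 3)" 1] by simp
  moreover have "(-1) powi c = - ((-1) powi (c - 3) :: complex)" by (simp add: power_int_diff)
  ultimately show ?thesis unfolding gval_def by (simp only: powi_add) simp
qed

text \<open>Both sides satisfy the same recurrence with step 3 and a nonzero factor, so agreement at
  0, 1, 2 spreads in both directions.\<close>

lemma gsum_eq_gval: "gsum c = qinf * gval c"
proof -
  have base: "gsum 0 = qinf * gval 0" "gsum 1 = qinf * gval 1" "gsum 2 = qinf * gval 2"
    by (simp_all add: gsum_0 gsum_1 gsum_2 gval_def chi3_def)
  have step: "gsum c = qinf * gval c \<longleftrightarrow> gsum (c - 3) = qinf * gval (c - 3)" for c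
    unfolding gsum_rec[of c] gval_rec[of c] by simp
  have all: "gsum (3 * m + d) = qinf * gval (3 * m + d) \<longleftrightarrow> gsum d = qinf * gval d" for m d
  proof (induction m rule: int_induct[of _ 0])
    case (step1 i)
    have "3 * (i + 1) + d - 3 = 3 * i + d" by simp
    thus ?case using step1 step[of "3 * (i + 1) + d"] by simp
  next
    case (step2 i)
    have e: "3 * (i - 1) + d = 3 * i + d - 3" by simp
    show ?case unfolding e using step2 step[of "3 * i + d"] by simp
  qed simp
  have "c mod 3 \<in> {0, 1, 2}" by auto
  hence "gsum (c mod 3) = qinf * gval (c mod 3)" using base by auto
  thus ?thesis using all[of "c div 3" "c mod 3"] by simp
qed

text \<open>The product of the triple products for \<open>x\<close>, \<open>y\<close> and
  \<open>x * y\<close> carries \<open>qinf^3\<close>. Summing out one of the three indices gives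
  \<open>qinf * gval\<close>, and one factor \<open>qinf\<close> cancels.\<close>

theorem macdonald_A2:
  assumes xy: "x \<noteq> 0" "y \<noteq> 0"
  shows "((\<lambda>(v, w). chi3 (v - w) * q powi ((v\<^sup>2 + v * w + w\<^sup>2 - 1) div 3) * x powi (1 - v - w) * y powi (1 - v))
     has_sum (qinf\<^sup>2 * (theta x q * theta y q * theta (x * y) q))) UNIV"
proof -
  define J where "J = (\<lambda>z j. (-z) powi j * q powi trg j)"
  have J: "(J z has_sum (qinf * theta z q)) UNIV" if "z \<noteq> 0" for z unfolding J_def by (rule jacobi_triple[OF that])
  have Jabs: "(\<lambda>j. norm (J z j)) summable_on UNIV" if "z \<noteq> 0" for z unfolding J_def by (rule norm_powi_summable) (use that in simp)
  define P where "P = qinf * theta x q * (qinf * theta y q) * (qinf * theta (x * y) q)"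
  have prod2: "((\<lambda>(i, j). f i * g j) has_sum (a * b)) (UNIV \<times> UNIV) \<and> (\<lambda>z. norm ((\<lambda>(i, j). f i * g j) z)) summable_on (UNIV \<times> UNIV)"
    if f: "(f has_sum a) UNIV" "(\<lambda>i. norm (f i)) summable_on UNIV" and g: "(g has_sum b) UNIV" "(\<lambda>i. norm (g i)) summable_on UNIV"
    for f :: "'i \<Rightarrow> complex" and g :: "'j \<Rightarrow> complex" and a b
  proof -
    have abs: "(\<lambda>z. norm ((\<lambda>(i, j). f i * g j) z)) summable_on (UNIV \<times> UNIV)"
      using summable_product[OF f(2) g(2)] by (simp add: case_prod_unfold norm_mult)
    have "((\<lambda>(i, j). f i * g j) has_sum (a * b)) (UNIV \<times> UNIV)"
    proof (rule has_sum_SigmaI)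
      show "((\<lambda>j. (\<lambda>(i, j). f i * g j) (i, j)) has_sum (f i * b)) UNIV" for i
        using has_sum_cmult_right[OF g(1), of "f i"] by simp
      show "((\<lambda>i. f i * b) has_sum a * b) UNIV" by (rule has_sum_cmult_left[OF f(1)])
      show "(\<lambda>(i, j). f i * g j) summable_on UNIV \<times> UNIV" using abs by (rule abs_summable_summable)
    qed
    with abs show ?thesis by blast
  qed
  have 2: "((\<lambda>(i, j). J x i * J y j) has_sum (qinf * theta x q * (qinf * theta y q))) UNIV"
     "(\<lambda>z. norm ((\<lambda>(i, j). J x i * J y j) z)) summable_on UNIV"
    using prod2[OF J[OF xy(1)] Jabs[OF xy(1)] J[OF xy(2)] Jabs[OF xy(2)]] by simp_all
  have xy': "x * y \<noteq> 0" using xy by simp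
  have 3: "((\<lambda>(ij, l). (\<lambda>(i, j). J x i * J y j) ij * J (x * y) l) has_sum P) UNIV"
    using prod2[OF 2 J[OF xy'] Jabs[OF xy']] by (simp add: P_def)
  define F where "F = (\<lambda>(A, B, l). (- x) powi A * (- y) powi B * q powi (trg A + trg B) * ((-1) powi l * q powi (3 * trg l + (2 - (A + B)) * l)))"
  have 4: "((\<lambda>((A, B), l). F (A, B, l)) has_sum P) (UNIV \<times> UNIV)"
  proof -
    \<comment> \<open>\<open>A = i + l\<close> and \<open>B = j + l\<close> are the total exponents
      of \<open>x\<close> and \<open>y\<close>.\<close>
    have "((\<lambda>((A, B), l). F (A, B, l)) has_sum P) UNIV \<longleftrightarrow> ((\<lambda>(ij, l). (\<lambda>(i, j). J x i * J y j) ij * J (x * y) l) has_sum P) UNIV"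
    proof (rule has_sum_reindex_bij_witness[of _ "\<lambda>((i, j), l). ((i + l, j + l), l)" "\<lambda>((A, B), l). ((A - l, B - l), l)"], goal_cases)
      case (5 z)
      obtain A B l where z: "z = ((A, B), l)" by (metis prod.exhaust)
      have "trg (A - l) + trg (B - l) + trg l = trg A + trg B + (3 * trg l + (2 - (A + B)) * l)"
      proof -
        have "2 * (trg (A - l) + trg (B - l) + trg l) = 2 * (trg A + trg B + (3 * trg l + (2 - (A + B)) * l))"
          unfolding distrib_left mult.left_commute[of 2 3] trg_double by (simp add: algebra_simps)
        thus ?thesis by simp
      qed
      hence e: "q powi trg (A - l) * q powi trg (B - l) * q powi trg l = q powi (trg A + trg B) * q powi (3 * trg l + (2 - (A + B)) * l)"
        by (simp only: powi_add[symmetric])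
      have s: "(- x) powi (A - l) * (- y) powi (B - l) * (- (x * y)) powi l = (- x) powi A * (- y) powi B * (-1) powi l"
      proof -
        have "(- (x * y)) powi l = (-1) powi l * ((- x) powi l * (- y) powi l)"
          unfolding power_int_mult_distrib[symmetric] by simp
        thus ?thesis using xy by (simp add: power_int_diff field_simps)
      qed
      have "J x (A - l) * J y (B - l) * J (x * y) l = ((- x) powi (A - l) * (- y) powi (B - l) * (- (x * y)) powi l) * (q powi trg (A - l) * q powi trg (B - l) * q powi trg l)"
        unfolding J_def by (simp only: mult_ac)
      also have "\<dots> = F (A, B, l)" unfolding s e F_def by (simp add: mult_ac)
      finally show ?case unfolding z by simp
    qed auto
    thus ?thesis using 3 by simp
  qed
  have "((\<lambda>(A, B). (- x) powi A * (- y) powi B * q powi (trg A + trg B) * gsum (A + B)) has_sum P) UNIV"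
  proof (rule has_sum_SigmaD[OF 4])
    fix AB :: "int \<times> int"
    obtain A B where AB: "AB = (A, B)" by force
    show "((\<lambda>l. (\<lambda>((A, B), l). F (A, B, l)) (AB, l)) has_sum (case AB of (A, B) \<Rightarrow> (- x) powi A * (- y) powi B * q powi (trg A + trg B) * gsum (A + B))) UNIV"
      unfolding AB F_def using has_sum_cmult_right[OF gsum_has_sum[of "A + B"], of "(- x) powi A * (- y) powi B * q powi (trg A + trg B)"]
      by simp
  qed
  hence "((\<lambda>AB. 1 / qinf * (\<lambda>(A, B). (- x) powi A * (- y) powi B * q powi (trg A + trg B) * gsum (A + B)) AB) has_sum (1 / qinf * P)) UNIV"
    by (rule has_sum_cmult_right)
  moreover have "1 / qinf * P = qinf\<^sup>2 * (theta x q * theta y q * theta (x * y) q)"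
    using qinf_nz by (simp add: P_def power2_eq_square)
  ultimately have 5: "((\<lambda>AB. 1 / qinf * (\<lambda>(A, B). (- x) powi A * (- y) powi B * q powi (trg A + trg B) * gsum (A + B)) AB) has_sum (qinf\<^sup>2 * (theta x q * theta y q * theta (x * y) q))) UNIV"
    by simp
  show ?thesis
  proof (subst has_sum_reindex_bij_witness[of _ "\<lambda>(A, B). (1 - B, B - A)" "\<lambda>(v, w). (1 - v - w, 1 - v)" _ _ _ _ "qinf\<^sup>2 * (theta x q * theta y q * theta (x * y) q)"])
    fix z :: "int \<times> int" assume "z \<in> UNIV"
    obtain v w where z: "z = (v, w)" by force
    define A B c where "A = 1 - v - w" and "B = 1 - v" and "c = A + B"
    have chi: "chi3 (1 + c) = chi3 (v - w)"
    proof -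
      have "1 + c = (v - w) + 3 * (1 - v)" by (simp add: c_def A_def B_def)
      thus ?thesis by (simp only: chi3_add_mult)
    qed
    \<comment> \<open>Only where the character is nonzero are the divisions by 6 and 3 exact, and
      only there is equality of the exponents needed.\<close>
    have ex: "trg A + trg B - ((c\<^sup>2 - c) div 6) = (v\<^sup>2 + v * w + w\<^sup>2 - 1) div 3" if "chi3 (v - w) \<noteq> 0"
    proof -
      have "(1 + c) mod 3 \<noteq> 0" using that unfolding chi[symmetric] by (auto simp: chi3_def)
      hence "c mod 3 = 0 \<or> c mod 3 = 1" by presburger
      hence "3 dvd c \<or> 3 dvd c - 1" by presburger
      hence "3 dvd c * (c - 1)" by auto
      moreover have "2 dvd c * (c - 1)" by simp
      moreover have "6 dvd x" if "3 dvd x" "2 dvd x" for x :: int using that by presburger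
      ultimately have "6 dvd c * (c - 1)" by blast
      hence d6: "6 * ((c\<^sup>2 - c) div 6) = c\<^sup>2 - c" by (simp add: power2_eq_square algebra_simps)
      have "6 * (trg A + trg B - ((c\<^sup>2 - c) div 6)) = 3 * (2 * trg A) + 3 * (2 * trg B) - 6 * ((c\<^sup>2 - c) div 6)" by simp
      also have "\<dots> = 2 * (v\<^sup>2 + v * w + w\<^sup>2 - 1)"
        unfolding trg_double d6 unfolding c_def A_def B_def by (simp add: algebra_simps power2_eq_square)
      finally have "3 * (trg A + trg B - ((c\<^sup>2 - c) div 6)) = v\<^sup>2 + v * w + w\<^sup>2 - 1" by simp
      thus ?thesis by (metis nonzero_mult_div_cancel_left zero_neq_numeral)
    qed
    have sg: "(- x) powi A * (- y) powi B * (-1) powi c = x powi A * y powi B"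
    proof -
      have "(-1) powi A * (-1) powi B * (-1) powi c = (((-1) powi c)\<^sup>2 :: complex)"
        unfolding c_def by (simp add: power_int_add power2_eq_square)
      also have "\<dots> = 1" by (simp add: power2_eq_square)
      finally have "(-1) powi A * (-1) powi B * (-1) powi c = (1::complex)" .
      thus ?thesis unfolding minus_powi[of x A] minus_powi[of y B]
        by (metis (no_types, lifting) mult.assoc mult.commute mult.right_neutral)
    qed
    have "1 / qinf * ((- x) powi A * (- y) powi B * q powi (trg A + trg B) * gsum c)
       = chi3 (v - w) * ((- x) powi A * (- y) powi B * (-1) powi c) * (q powi (trg A + trg B) * q powi (- ((c\<^sup>2 - c) div 6)))"
      unfolding gsum_eq_gval gval_def chi using qinf_nz by simp
    also have "q powi (trg A + trg B) * q powi (- ((c\<^sup>2 - c) div 6)) = q powi (trg A + trg B - ((c\<^sup>2 - c) div 6))"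
      unfolding powi_add[symmetric] by simp
    finally show "1 / qinf * (case (case z of (v, w) \<Rightarrow> (1 - v - w, 1 - v)) of (A, B) \<Rightarrow> (- x) powi A * (- y) powi B * q powi (trg A + trg B) * gsum (A + B))
       = (case z of (v, w) \<Rightarrow> chi3 (v - w) * q powi ((v\<^sup>2 + v * w + w\<^sup>2 - 1) div 3) * x powi (1 - v - w) * y powi (1 - v))"
      unfolding sg z prod.case unfolding A_def[symmetric] unfolding B_def[symmetric] unfolding c_def[symmetric] using ex by (cases "chi3 (v - w) = 0") (simp_all add: mult_ac)
  qed (use 5 in auto)
qed


section \<open>From the Bailey chain to the multisums\<close>

lemma qbinom_rq: "qbinom q n m = qfac q n * rq q m * rq q (n - m)"
  by (auto simp: qbinom_def qfac_def rq_def)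

lemma qfac_rq: "n \<ge> 0 \<Longrightarrow> qfac q n * rq q n = 1"
  using qfac_nz[of n] by (simp add: rq_def qfac_def)

lemma qbinom_pascal:
  assumes "n \<ge> 0"
  shows "qbinom q (n + 1) m = q powi m * qbinom q n m + qbinom q n (m - 1)"
proof -
  have a: "rq q (n - m) = (1 - q powi (n + 1 - m)) * rq q (n + 1 - m)" using rq_rec[of "n + 1 - m"] by (simp add: algebra_simps)
  have b: "qfac q (n + 1) = (1 - q powi (n + 1)) * qfac q n" using qfac_rec[of "n + 1"] assms by simp
  have c: "n - (m - 1) = n + 1 - m" by simp
  have d: "q powi m * q powi (n + 1 - m) = q powi (n + 1)" unfolding powi_add[symmetric] by simp
  have "q powi m * qbinom q n m + qbinom q n (m - 1) = qfac q n * rq q m * rq q (n + 1 - m) * (q powi m - q powi m * q powi (n + 1 - m) + (1 - q powi m))"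
    unfolding qbinom_rq c a rq_rec[of m] by (simp add: algebra_simps)
  thus ?thesis unfolding d qbinom_rq b by (simp add: algebra_simps)
qed

text \<open>q-Chu-Vandermonde in a form valid for negative \<open>e\<close> too, where
  \<open>rq\<close> suppresses terms. Pascal's rule splits the sum for \<open>A + 1\<close> so that
  neighbouring terms merge into the sum for \<open>A\<close> with \<open>e + 1\<close>; hence
  \<open>e\<close> is arbitrary in the induction.\<close>

lemma qchu:
  "(\<Sum>m\<in>{0..int A}. qbinom q (int A) m * (q powi (m * (m + e)) * rq q (m + e))) = rq q (int A + e)"
proof (induction A arbitrary: e)
  case 0
  show ?case by (simp add: qbinom_def qpoch_def)
next
  case (Suc A)
  define w where "w = (\<lambda>m e. q powi (m * (m + e)) * rq q (m + e))"
  have sA: "int (Suc A) = int A + 1" by simp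
  have z: "qbinom q (int A) (int A + 1) = 0" "qbinom q (int A) (-1) = 0" by (simp_all add: qbinom_def)
  have "(\<Sum>m\<in>{0..int (Suc A)}. qbinom q (int (Suc A)) m * w m e)
     = (\<Sum>m\<in>{0..int A + 1}. q powi m * qbinom q (int A) m * w m e) + (\<Sum>m\<in>{0..int A + 1}. qbinom q (int A) (m - 1) * w m e)"
    unfolding sA by (simp add: qbinom_pascal distrib_right sum.distrib)
  also have "(\<Sum>m\<in>{0..int A + 1}. q powi m * qbinom q (int A) m * w m e) = (\<Sum>m\<in>{0..int A}. q powi m * qbinom q (int A) m * w m e)"
    by (rule sum.mono_neutral_right) (auto simp: qbinom_def)
  also have "(\<Sum>m\<in>{0..int A + 1}. qbinom q (int A) (m - 1) * w m e) = (\<Sum>m\<in>{1..int A + 1}. qbinom q (int A) (m - 1) * w m e)"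
    by (rule sum.mono_neutral_right) (auto simp: qbinom_def)
  also have "\<dots> = (\<Sum>m\<in>{0..int A}. qbinom q (int A) m * w (m + 1) e)"
    by (rule sum.reindex_bij_witness[of _ "\<lambda>m. m + 1" "\<lambda>m. m - 1"]) auto
  also have "(\<Sum>m\<in>{0..int A}. q powi m * qbinom q (int A) m * w m e) + (\<Sum>m\<in>{0..int A}. qbinom q (int A) m * w (m + 1) e)
     = (\<Sum>m\<in>{0..int A}. qbinom q (int A) m * w m (e + 1))"
    unfolding sum.distrib[symmetric]
  proof (rule sum.cong[OF refl])
    fix m
    have 1: "rq q (m + e) = (1 - q powi (m + (e + 1))) * rq q (m + (e + 1))" using rq_rec[of "m + (e + 1)"] by (simp add: algebra_simps)
    have 2: "q powi m * q powi (m * (m + e)) = q powi (m * (m + (e + 1)))" unfolding powi_add[symmetric] by (simp add: algebra_simps)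
    have 3: "q powi ((m + 1) * (m + 1 + e)) = q powi (m * (m + (e + 1))) * q powi (m + (e + 1))" unfolding powi_add[symmetric] by (simp add: algebra_simps)
    have 4: "m + 1 + e = m + (e + 1)" by simp
    have "q powi m * qbinom q (int A) m * w m e + qbinom q (int A) m * w (m + 1) e
        = qbinom q (int A) m * ((q powi m * q powi (m * (m + e))) * rq q (m + e) + q powi ((m + 1) * (m + 1 + e)) * rq q (m + 1 + e))"
      unfolding w_def by (simp add: algebra_simps)
    also have "\<dots> = qbinom q (int A) m * w m (e + 1)"
      unfolding 2 3 unfolding 4 1 w_def by (simp add: algebra_simps)
    finally show "q powi m * qbinom q (int A) m * w m e + qbinom q (int A) m * w (m + 1) e = qbinom q (int A) m * w m (e + 1)" .
  qed
  also have "\<dots> = rq q (int (Suc A) + e)" unfolding w_def Suc.IH by (simp add: algebra_simps)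
  finally show ?case unfolding w_def .
qed

lemma qconv_chu:
  assumes "M \<ge> 0"
  shows "qconv (\<lambda>s. q powi (s * (s + c)) * (rq q s * rq q (s + c))) M = rq q M * rq q (M + c)"
proof -
  obtain A where A: "M = int A" using assms nonneg_int_cases by blast
  have "qconv (\<lambda>s. q powi (s * (s + c)) * (rq q s * rq q (s + c))) M
     = (\<Sum>s\<in>{0..int A}. rq q M * (qbinom q (int A) s * (q powi (s * (s + c)) * rq q (s + c))))"
    unfolding qconv_def A
  proof (rule sum.cong[OF refl])
    fix s
    have "qbinom q (int A) s * rq q (int A) = rq q s * rq q (int A - s)"
      using qfac_rq[of "int A"] unfolding qbinom_rq by (simp add: mult_ac)
    hence "(rq q s * rq q (int A - s)) * (q powi (s * (s + c)) * rq q (s + c)) = (qbinom q (int A) s * rq q (int A)) * (q powi (s * (s + c)) * rq q (s + c))"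
      by (simp only:)
    thus "rq q (int A - s) * (q powi (s * (s + c)) * (rq q s * rq q (s + c))) = rq q (int A) * (qbinom q (int A) s * (q powi (s * (s + c)) * rq q (s + c)))"
      by (simp only: mult_ac)
  qed
  thus ?thesis unfolding sum_distrib_left[symmetric] qchu A .
qed

section \<open>The summand of the multisum, peeled off from the outermost variables\<close>

definition cons1 :: "nat \<Rightarrow> (nat \<Rightarrow> nat) \<Rightarrow> nat \<Rightarrow> nat" where
  "cons1 r l i = (if i = 0 then 0 else if i = 1 then r else l (i - 1))"

lemma cons1_simps [simp]: "cons1 r l 0 = 0" "cons1 r l (Suc 0) = r" "i \<ge> 1 \<Longrightarrow> cons1 r l (Suc i) = l i"
  by (auto simp: cons1_def)

lemma sum_cons1: "(\<Sum>i\<in>{a+1..Suc n}. cons1 r l i) = (if a = 0 then r else 0) + (\<Sum>i\<in>{a-1+1..n}. l i)"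
proof -
  have shift: "(\<Sum>i\<in>{Suc (Suc c)..Suc n}. cons1 r l i) = (\<Sum>i\<in>{Suc c..n}. l i)" for c
    by (subst sum.shift_bounds_cl_Suc_ivl) (auto intro!: sum.cong)
  show ?thesis
  proof (cases a)
    case 0
    have "(\<Sum>i\<in>{1..Suc n}. cons1 r l i) = cons1 r l 1 + (\<Sum>i\<in>{Suc 1..Suc n}. cons1 r l i)"
      by (rule sum.atLeast_Suc_atMost) simp
    thus ?thesis using 0 shift[of 0] by simp
  next
    case (Suc c)
    thus ?thesis using shift[of c] by simp
  qed
qed

text \<open>For \<open>a, b > 0\<close> the summand of the subtracted multisum is \<open>q\<close>
  times this one at \<open>a - 1\<close>, \<open>b - 1\<close>.\<close>

definition mterm :: "nat \<Rightarrow> nat \<Rightarrow> nat \<Rightarrow> (nat \<Rightarrow> nat) \<Rightarrow> (nat \<Rightarrow> nat) \<Rightarrow> complex" where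
  "mterm k a b l m = q ^ (l k ^ 2 + (\<Sum>i\<in>{a+1..k}. l i) + (\<Sum>i\<in>{b+1..k-1}. m i)) * core k q (kdelta b) l m"

abbreviation ind0 :: "nat \<Rightarrow> int" where
  "ind0 a \<equiv> (if a = 0 then 1 else 0)"

definition weight :: "nat \<Rightarrow> nat \<Rightarrow> nat \<Rightarrow> nat \<Rightarrow> nat \<Rightarrow> int \<Rightarrow> complex" where
  "weight a b r u l1 c = q powi (int r^2 - int r * int u + int u^2 + ind0 a * int r + ind0 b * int u)
     * rq q (int r - int l1) * qbinom q (int r - int l1 + c) (int u)"

text \<open>Dividing the binomial of \<open>r\<close> over \<open>l 1\<close> by (q)_r leaves the
  two factors \<open>rq q (l 1)\<close> and \<open>rq q (r - l 1)\<close>: the first belongs to the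
  shorter multisum, the second is the kernel of a Bailey step. All positions move by one, so
  \<open>a\<close> and \<open>b\<close> drop by one.\<close>

lemma mterm_cons:
  assumes "k \<ge> 1"
  shows "mterm (Suc k) a b (cons1 r l) (cons1 u m) =
    weight a b r u (l 1) (int (mu_ext k l m 1) + kdelta b 1) * mterm k (a - 1) (b - 1) l m"
proof -
  define fac where "fac = (\<lambda>k d l m i. q powi (int (l i)^2 - int (l i) * int (m i) + int (m i)^2)
        * qbinom q (int (l i)) (int (l (i + 1)))
        * qbinom q (int (l i) - int (l (i + 1)) + int (mu_ext k l m (i + 1)) + d i) (int (m i)))"
  have core: "core k q d l m = (\<Prod>i\<in>{1..k-1}. fac k d l m i) / qpoch q q (l 1)" for k d l m
    by (simp add: core_def fac_def)
  have mu: "mu_ext (Suc k) (cons1 r l) (cons1 u m) (Suc i) = mu_ext k l m i" if "i \<ge> 1" for i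
    using that assms by (auto simp: mu_ext_def)
  have "(\<Prod>i\<in>{1..k}. fac (Suc k) (kdelta b) (cons1 r l) (cons1 u m) i) =
     fac (Suc k) (kdelta b) (cons1 r l) (cons1 u m) 1 * (\<Prod>i\<in>{Suc 1..k}. fac (Suc k) (kdelta b) (cons1 r l) (cons1 u m) i)"
    by (rule prod.atLeast_Suc_atMost) (use assms in simp)
  also have "(\<Prod>i\<in>{Suc 1..k}. fac (Suc k) (kdelta b) (cons1 r l) (cons1 u m) i) = (\<Prod>i\<in>{1..k-1}. fac (Suc k) (kdelta b) (cons1 r l) (cons1 u m) (Suc i))"
    using prod.shift_bounds_cl_Suc_ivl[of "fac (Suc k) (kdelta b) (cons1 r l) (cons1 u m)" 1 "k - 1"] assms by simp
  also have "\<dots> = (\<Prod>i\<in>{1..k-1}. fac k (kdelta (b - 1)) l m i)"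
  proof (rule prod.cong[OF refl])
    fix i assume i: "i \<in> {1..k-1}"
    have "kdelta b (Suc i) = kdelta (b - 1) i" using i by (auto simp: kdelta_def)
    thus "fac (Suc k) (kdelta b) (cons1 r l) (cons1 u m) (Suc i) = fac k (kdelta (b - 1)) l m i"
      using i mu[of "i + 1"] by (simp add: fac_def)
  qed
  finally have P: "(\<Prod>i\<in>{1..Suc k - 1}. fac (Suc k) (kdelta b) (cons1 r l) (cons1 u m) i) =
    fac (Suc k) (kdelta b) (cons1 r l) (cons1 u m) 1 * (\<Prod>i\<in>{1..k-1}. fac k (kdelta (b - 1)) l m i)" by simp
  have F: "fac (Suc k) (kdelta b) (cons1 r l) (cons1 u m) 1 = q powi (int r^2 - int r * int u + int u^2)
     * (qfac q (int r) * rq q (int (l 1)) * rq q (int r - int (l 1)))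
     * qbinom q (int r - int (l 1) + (int (mu_ext k l m 1) + kdelta b 1)) (int u)"
    using mu[of 1] by (simp add: fac_def qbinom_rq[of "int r"] add.assoc)
  have r: "1 / qpoch q q r = rq q (int r)" "1 / qpoch q q (l 1) = rq q (int (l 1))" by (simp_all add: rq_def)
  have e1: "(\<Sum>i\<in>{a+1..Suc k}. cons1 r l i) = (if a = 0 then r else 0) + (\<Sum>i\<in>{a-1+1..k}. l i)"
    by (rule sum_cons1)
  have e2: "(\<Sum>i\<in>{b+1..Suc k - 1}. cons1 u m i) = (if b = 0 then u else 0) + (\<Sum>i\<in>{b-1+1..k-1}. m i)"
    using sum_cons1[of u m b "k - 1"] assms by simp
  have e3: "cons1 r l (Suc k) = l k" using assms by simp
  have e4: "q ^ (if a = 0 then r else 0) = q powi (ind0 a * int r)" "q ^ (if b = 0 then u else 0) = q powi (ind0 b * int u)" by auto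
  define E where "E = q ^ (l k ^ 2 + (\<Sum>i\<in>{a-1+1..k}. l i) + (\<Sum>i\<in>{b-1+1..k-1}. m i))"
  define PP where "PP = (\<Prod>i\<in>{1..k-1}. fac k (kdelta (b - 1)) l m i)"
  have "mterm (Suc k) a b (cons1 r l) (cons1 u m) =
     (E * (q powi (ind0 a * int r) * q powi (ind0 b * int u))) * (fac (Suc k) (kdelta b) (cons1 r l) (cons1 u m) 1 * PP * (1 / qpoch q q r))"
    unfolding mterm_def core P e1 e2 e3 PP_def[symmetric] E_def e4[symmetric] by (simp add: power_add mult_ac)
  also have "\<dots> = (q powi (int r^2 - int r * int u + int u^2) * q powi (ind0 a * int r) * q powi (ind0 b * int u))
      * rq q (int r - int (l 1)) * qbinom q (int r - int (l 1) + (int (mu_ext k l m 1) + kdelta b 1)) (int u)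
      * (E * (PP * (1 / qpoch q q (l 1)))) * (qfac q (int r) * rq q (int r))"
    unfolding F r by (simp only: mult_ac)
  also have "qfac q (int r) * rq q (int r) = 1" by (rule qfac_rq) simp
  finally show ?thesis unfolding weight_def powi_add mterm_def core PP_def E_def by simp
qed

lemma summable_geometric_nat:
  fixes c :: real
  assumes "0 \<le> c" "c < 1"
  shows "(\<lambda>n. c ^ n) summable_on UNIV"
  by (rule norm_summable_imp_summable_on) (use assms in \<open>auto intro: summable_geometric simp: norm_power\<close>)

lemma bij_cons1:
  assumes "k \<ge> 1"
  shows "bij_betw (\<lambda>((l, m), (r, u)). (cons1 r l, cons1 u m)) (idx k \<times> UNIV) (idx (Suc k))"
proof (rule bij_betwI[where g = "\<lambda>(l, m). ((\<lambda>i. if i = 0 then 0 else l (Suc i), \<lambda>i. if i = 0 then 0 else m (Suc i)), (l 1, m 1))"])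
  show "(\<lambda>((l, m), (r, u)). (cons1 r l, cons1 u m)) \<in> idx k \<times> UNIV \<rightarrow> idx (Suc k)"
    using assms by (auto simp: idx_def cons1_def)
  show "(\<lambda>(l, m). ((\<lambda>i. if i = 0 then 0 else l (Suc i), \<lambda>i. if i = 0 then 0 else m (Suc i)), (l 1, m 1))) \<in> idx (Suc k) \<rightarrow> idx k \<times> UNIV"
    by (auto simp: idx_def)
qed (auto simp: idx_def cons1_def fun_eq_iff)

lemma idx_1: "idx 1 = (\<lambda>n. (cons1 n (\<lambda>_. 0), \<lambda>_. 0)) ` UNIV"
proof (intro subset_antisym subsetI)
  fix x assume "x \<in> idx 1"
  moreover obtain l m where x: "x = (l, m)" by force
  ultimately have l: "l i = 0" if "i < 1 \<or> 1 < i" for i using that by (auto simp: idx_def)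
  have m: "m i = 0" for i using \<open>x \<in> idx 1\<close> by (cases "i < 1") (auto simp: idx_def x)
  have "l = cons1 (l 1) (\<lambda>_. 0)" using l by (auto simp: fun_eq_iff cons1_def)
  moreover have "m = (\<lambda>_. 0)" using m by auto
  ultimately show "x \<in> (\<lambda>n. (cons1 n (\<lambda>_. 0), \<lambda>_. 0)) ` UNIV" unfolding x by (metis rangeI)
qed (auto simp: idx_def cons1_def)

lemma inj_idx_1: "inj (\<lambda>n. (cons1 n (\<lambda>_. 0), \<lambda>_. 0 :: nat))"
  by (rule injI) (metis cons1_simps(2) prod.inject)

lemma mterm_1: "mterm 1 a b (cons1 n (\<lambda>_. 0)) (\<lambda>_. 0) = q powi (int n^2 + ind0 a * int n) * rq q (int n)"
proof -
  have "(\<Sum>i\<in>{a+1..Suc 0}. cons1 n (\<lambda>_. 0) i) = (if a = 0 then n else 0)" using sum_cons1[of n "\<lambda>_. 0" a 0] by simp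
  moreover have "q ^ n\<^sup>2 = q powi (int n)\<^sup>2" by (metis of_nat_power power_int_of_nat)
  ultimately show ?thesis by (simp add: mterm_def core_def rq_def power_add powi_add)
qed

text \<open>The quadratic form is bounded below only by half the sum of its variables; the square
  root of the norm absorbs the half.\<close>

lemma norm_powi_le:
  assumes "0 \<le> j" "2 * e \<ge> j"
  shows "norm (q powi e) \<le> sqrt (norm q) ^ nat j"
proof -
  have e: "e \<ge> 0" using assms by simp
  have s: "0 \<le> sqrt (norm q)" "sqrt (norm q) \<le> 1" using q_lt by auto
  have "norm (q powi e) = norm q ^ nat e" using e by (simp add: power_int_def norm_power)
  also have "\<dots> = sqrt (norm q) ^ (2 * nat e)" by (simp add: power_mult)
  also have "\<dots> \<le> sqrt (norm q) ^ nat j" by (rule power_decreasing) (use assms s in auto)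
  finally show ?thesis .
qed

text \<open>Twice the form is \<open>(r-u)^2 + r^2 + u^2\<close>, hence at least
  \<open>r + u\<close>. The bound is uniform in \<open>l1\<close> and \<open>c\<close>, so
  summability of the multisum follows by induction from products of geometric series.\<close>

lemma weight_bound: "\<exists>C\<ge>0. \<forall>a b r u l1 c. norm (weight a b r u l1 c) \<le> C * (sqrt (norm q) ^ r * sqrt (norm q) ^ u)"
proof -
  obtain B1 where B1: "\<And>n. norm (qfac q n) \<le> B1" using qfac_bounded by blast
  obtain B2 where B2: "\<And>n. norm (rq q n) \<le> B2" using rq_bounded by blast
  have B: "0 \<le> B1" "0 \<le> B2" using B1[of 0] B2[of 0] norm_ge_zero order_trans by blast+
  have "norm (weight a b r u l1 c) \<le> (B2 * (B1 * B2 * B2)) * (sqrt (norm q) ^ r * sqrt (norm q) ^ u)" for a b r u l1 c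
  proof -
    define e where "e = int r^2 - int r * int u + int u^2 + ind0 a * int r + ind0 b * int u"
    have "2 * e \<ge> int r + int u"
    proof -
      define P X Y where "P = int r^2 - int r * int u + int u^2" and "X = ind0 a * int r" and "Y = ind0 b * int u"
      have "2 * P = (int r - int u)^2 + int r^2 + int u^2"
        by (simp add: P_def algebra_simps power2_eq_square)
      moreover have "int r^2 \<ge> int r" "int u^2 \<ge> int u" by (simp_all add: power2_eq_square flip: of_nat_mult)
      moreover have "(int r - int u)^2 \<ge> 0" by simp
      moreover have "X \<ge> 0" "Y \<ge> 0" by (auto simp: X_def Y_def)
      moreover have "e = P + X + Y" by (simp add: e_def P_def X_def Y_def)
      ultimately show ?thesis by linarith
    qed
    hence "norm (q powi e) \<le> sqrt (norm q) ^ nat (int r + int u)" by (intro norm_powi_le) auto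
    hence 1: "norm (q powi e) \<le> sqrt (norm q) ^ r * sqrt (norm q) ^ u" by (simp add: nat_add_distrib power_add)
    have 2: "norm (qbinom q n m) \<le> B1 * B2 * B2" for n m
      unfolding qbinom_rq norm_mult by (intro mult_mono B1 B2 mult_nonneg_nonneg B norm_ge_zero)
    have "norm (weight a b r u l1 c) \<le> (sqrt (norm q) ^ r * sqrt (norm q) ^ u) * B2 * (B1 * B2 * B2)"
      unfolding weight_def e_def[symmetric] norm_mult by (intro mult_mono 1 2 B2 mult_nonneg_nonneg B norm_ge_zero) auto
    thus ?thesis by (simp only: mult_ac)
  qed
  thus ?thesis using B by (intro exI[of _ "B2 * (B1 * B2 * B2)"]) auto
qed

lemma mterm_summable:
  assumes "k \<ge> 1"
  shows "(\<lambda>(l, m). norm (mterm k a b l m)) summable_on idx k"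
  using assms
proof (induction k arbitrary: a b rule: nat_induct_at_least)
  case base
  obtain B2 where B2: "\<And>n. norm (rq q n) \<le> B2" using rq_bounded by blast
  have "(\<lambda>n. sqrt (norm q) ^ n * B2) summable_on UNIV"
    by (intro summable_on_cmult_left summable_geometric_nat) (use q_lt in auto)
  hence "(\<lambda>n::nat. norm (q powi (int n^2 + ind0 a * int n) * rq q (int n))) summable_on UNIV"
  proof (rule summable_on_comparison_test)
    fix n :: nat
    define P X where "P = int n^2" and "X = ind0 a * int n"
    have "P \<ge> int n" by (simp add: P_def power2_eq_square flip: of_nat_mult)
    moreover have "X \<ge> 0" by (auto simp: X_def)
    moreover have "int n \<ge> 0" by simp
    ultimately have "int n \<le> P + X + (P + X)" by linarith
    hence "2 * (P + X) \<ge> int n" by (simp only: mult_2)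
    hence "norm (q powi (int n^2 + ind0 a * int n)) \<le> sqrt (norm q) ^ nat (int n)"
      unfolding P_def X_def by (intro norm_powi_le) auto
    thus "norm (q powi (int n^2 + ind0 a * int n) * rq q (int n)) \<le> sqrt (norm q) ^ n * B2"
      unfolding norm_mult by (intro mult_mono B2) auto
  qed simp
  thus ?case unfolding idx_1 by (subst summable_on_reindex[OF inj_idx_1]) (simp only: o_def prod.case mterm_1)
next
  case (Suc k)
  obtain C where C: "C \<ge> 0" "\<And>a b r u l1 c. norm (weight a b r u l1 c) \<le> C * (sqrt (norm q) ^ r * sqrt (norm q) ^ u)"
    using weight_bound by blast
  have geo: "(\<lambda>n. sqrt (norm q) ^ n) summable_on UNIV" by (rule summable_geometric_nat) (use q_lt in auto)
  have "(\<lambda>(r::nat, u::nat). sqrt (norm q) ^ r * sqrt (norm q) ^ u) summable_on UNIV"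
    using summable_product[OF geo geo] by simp
  hence "(\<lambda>(lm, ru). (\<lambda>(l, m). norm (mterm k (a - 1) (b - 1) l m)) lm * (\<lambda>(r, u). sqrt (norm q) ^ r * sqrt (norm q) ^ u) ru) summable_on idx k \<times> UNIV"
    by (intro summable_product Suc.IH) auto
  hence "(\<lambda>x. C * (\<lambda>(lm, ru). (\<lambda>(l, m). norm (mterm k (a - 1) (b - 1) l m)) lm * (\<lambda>(r, u). sqrt (norm q) ^ r * sqrt (norm q) ^ u) ru) x) summable_on idx k \<times> UNIV"
    by (rule summable_on_cmult_right)
  hence "(\<lambda>x. (\<lambda>(l, m). norm (mterm (Suc k) a b l m)) ((\<lambda>((l, m), (r, u)). (cons1 r l, cons1 u m)) x)) summable_on idx k \<times> UNIV"
  proof (rule summable_on_comparison_test)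
    fix x assume "x \<in> idx k \<times> (UNIV :: (nat \<times> nat) set)"
    obtain l m r u where x: "x = ((l, m), (r, u))" by (metis prod.exhaust)
    have "norm (mterm (Suc k) a b (cons1 r l) (cons1 u m)) \<le> C * (sqrt (norm q) ^ r * sqrt (norm q) ^ u) * norm (mterm k (a - 1) (b - 1) l m)"
      unfolding mterm_cons[OF Suc.hyps] norm_mult by (intro mult_right_mono C) auto
    thus "(\<lambda>(l, m). norm (mterm (Suc k) a b l m)) ((\<lambda>((l, m), (r, u)). (cons1 r l, cons1 u m)) x)
       \<le> C * (\<lambda>(lm, ru). (\<lambda>(l, m). norm (mterm k (a - 1) (b - 1) l m)) lm * (\<lambda>(r, u). sqrt (norm q) ^ r * sqrt (norm q) ^ u) ru) x"
      unfolding x by (simp add: mult_ac)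
    show "0 \<le> (\<lambda>(l, m). norm (mterm (Suc k) a b l m)) ((\<lambda>((l, m), (r, u)). (cons1 r l, cons1 u m)) x)"
      unfolding x by simp
  qed
  thus ?case by (subst (asm) summable_on_reindex_bij_betw[OF bij_cons1[OF Suc.hyps]])
qed

end

section \<open>Finite chains as multisums with boundary factors\<close>

lemma has_sum_nat_of_int:
  fixes g :: "int \<Rightarrow> complex"
  assumes "\<And>r. r > L \<Longrightarrow> g r = 0"
  shows "((\<lambda>n. g (int n)) has_sum (\<Sum>r\<in>{0..L}. g r)) UNIV"
proof -
  have "(g has_sum (\<Sum>r\<in>{0..L}. g r)) {0..L}" by simp
  also have "?this \<longleftrightarrow> (g has_sum (\<Sum>r\<in>{0..L}. g r)) (range int)"
  proof (rule has_sum_cong_neutral)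
    show "g x = 0" if "x \<in> range int - {0..L}" for x using that assms[of x] by auto
    show "g x = 0" if "x \<in> {0..L} - range int" for x
    proof -
      from that have "x \<ge> 0" by simp
      hence "x \<in> range int" by (metis nonneg_int_cases rangeI)
      thus ?thesis using that by simp
    qed
  qed simp
  finally show ?thesis by (subst (asm) has_sum_reindex) (auto simp: o_def)
qed

context nome begin

lemma qconv_sum: "finite U \<Longrightarrow> qconv (\<lambda>s. \<Sum>u\<in>U. f u s) M = (\<Sum>u\<in>U. qconv (f u) M)"
  unfolding qconv_def sum_distrib_left by (rule sum.swap)

text \<open>The origin of the Kronecker delta: the second component of the type goes from 0 to 1
  between step \<open>b\<close> and step \<open>b + 1\<close>. Natural subtraction keeps
  \<open>b = 0\<close> at 0.\<close>

lemma ind0_pred: "ind0 (b - 1) = ind0 b + kdelta b 1"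
  by (auto simp: kdelta_def)

text \<open>The Bailey variable \<open>s\<close> is traded for the multisum variable
  \<open>u\<close> by using q-Chu-Vandermonde twice: expand the last \<open>rq\<close> as a sum over
  \<open>u\<close>, exchange the sums, and evaluate the sum over \<open>s\<close>, whose exponent
  has become \<open>s * (s + (u - r + j))\<close>.\<close>

lemma inner_sum:
  fixes r l1 mu d j i M :: int
  assumes M: "M \<ge> 0" and mud: "mu + d \<ge> 0"
  shows "(\<Sum>u\<in>{0..r - l1 + (mu + d)}. rq q M * rq q (M + u - r + j) *
      (q powi (r^2 - r * u + u^2 + i * r + j * u) * rq q (r - l1) * qbinom q (r - l1 + (mu + d)) u)) =
    qconv (\<lambda>s. q powi (r\<^sup>2 - r * s + s\<^sup>2 + i * r + j * s) * (rq q (r - l1) * (rq q s * rq q (s + mu - l1 + (j + d))))) M"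
proof (cases "r < l1")
  case True
  thus ?thesis by (simp add: qconv_def)
next
  case False
  define A where "A = nat (r - l1 + (mu + d))"
  have A: "r - l1 + (mu + d) = int A" using False mud by (simp add: A_def)
  define K where "K = q powi (r\<^sup>2 + i * r) * rq q (r - l1)"
  have "qconv (\<lambda>s. q powi (r\<^sup>2 - r * s + s\<^sup>2 + i * r + j * s) * (rq q (r - l1) * (rq q s * rq q (s + mu - l1 + (j + d))))) M
     = qconv (\<lambda>s. \<Sum>u\<in>{0..int A}. K * qbinom q (int A) u * q powi (u^2 - r * u + j * u) * (q powi (s * (s + (u - r + j))) * (rq q s * rq q (s + (u - r + j))))) M"
  proof (rule qconv_cong)
    fix s
    \<comment> \<open>\<open>s - r + j\<close> is the offset for which the expansion produces
      q-binomials over \<open>r - l1 + mu + d\<close>, as the multisum has them.\<close>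
    have "s + mu - l1 + (j + d) = int A + (s - r + j)" unfolding A[symmetric] by simp
    hence "rq q (s + mu - l1 + (j + d)) = (\<Sum>u\<in>{0..int A}. qbinom q (int A) u * (q powi (u * (u + (s - r + j))) * rq q (u + (s - r + j))))"
      by (simp only: qchu)
    hence "q powi (r\<^sup>2 - r * s + s\<^sup>2 + i * r + j * s) * (rq q (r - l1) * (rq q s * rq q (s + mu - l1 + (j + d))))
       = (\<Sum>u\<in>{0..int A}. q powi (r\<^sup>2 - r * s + s\<^sup>2 + i * r + j * s) * (rq q (r - l1) * (rq q s * (qbinom q (int A) u * (q powi (u * (u + (s - r + j))) * rq q (u + (s - r + j)))))))"
      by (simp only: sum_distrib_left)
    also have "\<dots> = (\<Sum>u\<in>{0..int A}. K * qbinom q (int A) u * q powi (u^2 - r * u + j * u) * (q powi (s * (s + (u - r + j))) * (rq q s * rq q (s + (u - r + j)))))"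
    proof (rule sum.cong[OF refl])
      fix u
      have e: "q powi (r\<^sup>2 - r * s + s\<^sup>2 + i * r + j * s) * q powi (u * (u + (s - r + j))) = q powi (r\<^sup>2 + i * r) * q powi (u^2 - r * u + j * u) * q powi (s * (s + (u - r + j)))"
        unfolding powi_add[symmetric] by (simp add: algebra_simps power2_eq_square)
      have f: "u + (s - r + j) = s + (u - r + j)" by simp
      have "q powi (r\<^sup>2 - r * s + s\<^sup>2 + i * r + j * s) * (rq q (r - l1) * (rq q s * (qbinom q (int A) u * (q powi (u * (u + (s - r + j))) * rq q (u + (s - r + j))))))
        = (q powi (r\<^sup>2 - r * s + s\<^sup>2 + i * r + j * s) * q powi (u * (u + (s - r + j)))) * rq q (r - l1) * qbinom q (int A) u * (rq q s * rq q (u + (s - r + j)))"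
        by (simp only: mult_ac)
      thus "q powi (r\<^sup>2 - r * s + s\<^sup>2 + i * r + j * s) * (rq q (r - l1) * (rq q s * (qbinom q (int A) u * (q powi (u * (u + (s - r + j))) * rq q (u + (s - r + j))))))
        = K * qbinom q (int A) u * q powi (u^2 - r * u + j * u) * (q powi (s * (s + (u - r + j))) * (rq q s * rq q (s + (u - r + j))))"
        unfolding e unfolding f K_def by (simp only: mult_ac)
    qed
    finally show "q powi (r\<^sup>2 - r * s + s\<^sup>2 + i * r + j * s) * (rq q (r - l1) * (rq q s * rq q (s + mu - l1 + (j + d)))) = \<dots>" .
  qed
  also have "\<dots> = (\<Sum>u\<in>{0..int A}. K * qbinom q (int A) u * q powi (u^2 - r * u + j * u) * (rq q M * rq q (M + (u - r + j))))"
    unfolding qconv_sum[OF finite_atLeastAtMost_int] qconv_cmult qconv_chu[OF M] ..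
  also have "\<dots> = (\<Sum>u\<in>{0..int A}. rq q M * rq q (M + u - r + j) *
      (q powi (r^2 - r * u + u^2 + i * r + j * u) * rq q (r - l1) * qbinom q (int A) u))"
  proof (rule sum.cong[OF refl])
    fix u
    have e: "q powi (r^2 - r * u + u^2 + i * r + j * u) = q powi (r\<^sup>2 + i * r) * q powi (u^2 - r * u + j * u)"
      unfolding powi_add[symmetric] by (simp add: algebra_simps)
    have f: "M + u - r + j = M + (u - r + j)" by simp
    show "K * qbinom q (int A) u * q powi (u^2 - r * u + j * u) * (rq q M * rq q (M + (u - r + j))) = rq q M * rq q (M + u - r + j) *
      (q powi (r^2 - r * u + u^2 + i * r + j * u) * rq q (r - l1) * qbinom q (int A) u)"
      unfolding e f K_def by (simp only: mult_ac)
  qed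
  finally show ?thesis unfolding A ..
qed

text \<open>The boundary factors make the induction work: a further Bailey step acts on them alone,
  through \<open>inner_sum\<close>, and reproduces them for the new outermost pair. The sum with
  \<open>k + 1\<close> levels is then the old one with an inner double sum.\<close>

lemma chain_eq_sum:
  assumes "k \<ge> 1" "M \<ge> 0"
  shows "((\<lambda>(l, m). rq q (L - int (l 1)) * (rq q M * rq q (M + int (mu_ext k l m 1) - int (l 1) + ind0 b)) * mterm k a b l m)
     has_sum chain k (if b < k then 1 else 0) a b L M) (idx k)"
  using assms
proof (induction k arbitrary: a b L M rule: nat_induct_at_least)
  case (base a b L M)
  define i j where "i = ind0 a" and "j = ind0 b"
  define g where "g = (\<lambda>r. rq q (L - r) * (q powi (r^2 + i * r) * rq q r * (rq q M * rq q (M + (r + j)))))"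
  have "chain 1 (if b < 1 then 1 else 0) a b L M = bstep i j (seed j) L M"
    by (simp add: i_def j_def)
  also have "\<dots> = (\<Sum>r\<in>{0..L}. g r)"
    unfolding bstep_def qconv_def[of _ L]
  proof (rule sum.cong[OF refl])
    fix r
    have "qconv (\<lambda>s. q powi (r\<^sup>2 - r * s + s\<^sup>2 + i * r + j * s) * seed j r s) M
      = qconv (\<lambda>s. (q powi (r^2 + i * r) * rq q r) * (q powi (s * (s + (r + j))) * (rq q s * rq q (s + (r + j))))) M"
    proof (rule qconv_cong)
      fix s
      \<comment> \<open>The mixed term \<open>-r * s\<close> of the step and
        \<open>2 * r * s\<close> of the seed add up to \<open>r * s\<close>. Together with
        \<open>j * s\<close> this is the exponent for q-Chu-Vandermonde, provided the seed parameter
        is \<open>j\<close>.\<close>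
      have e: "q powi (r\<^sup>2 - r * s + s\<^sup>2 + i * r + j * s) * q powi (2 * r * s) = q powi (r^2 + i * r) * q powi (s * (s + (r + j)))"
        unfolding powi_add[symmetric] by (simp add: algebra_simps power2_eq_square)
      have f: "r + s + j = s + (r + j)" by simp
      have "q powi (r\<^sup>2 - r * s + s\<^sup>2 + i * r + j * s) * seed j r s = (q powi (r\<^sup>2 - r * s + s\<^sup>2 + i * r + j * s) * q powi (2 * r * s)) * (rq q r * rq q s * rq q (r + s + j))"
        unfolding seed_def by (simp only: mult_ac)
      thus "q powi (r\<^sup>2 - r * s + s\<^sup>2 + i * r + j * s) * seed j r s = (q powi (r^2 + i * r) * rq q r) * (q powi (s * (s + (r + j))) * (rq q s * rq q (s + (r + j))))"
        unfolding e f by (simp only: mult_ac)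
    qed
    also have "\<dots> = (q powi (r^2 + i * r) * rq q r) * (rq q M * rq q (M + (r + j)))"
      unfolding qconv_cmult qconv_chu[OF base] ..
    finally show "rq q (L - r) * qconv (\<lambda>s. q powi (r\<^sup>2 - r * s + s\<^sup>2 + i * r + j * s) * seed j r s) M = g r"
      by (simp add: g_def)
  qed
  finally have ch: "chain 1 (if b < 1 then 1 else 0) a b L M = (\<Sum>r\<in>{0..L}. g r)" .
  have "((\<lambda>n. g (int n)) has_sum (\<Sum>r\<in>{0..L}. g r)) UNIV"
    by (rule has_sum_nat_of_int) (simp add: g_def)
  moreover have "rq q (L - int n) * (rq q M * rq q (M + int (mu_ext 1 (cons1 n (\<lambda>_. 0)) (\<lambda>_. 0) 1) - int n + j)) * mterm 1 a b (cons1 n (\<lambda>_. 0)) (\<lambda>_. 0) = g (int n)" for n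
  proof -
    have "mu_ext 1 (cons1 n (\<lambda>_. 0)) (\<lambda>_. 0) 1 = 2 * n" by (simp add: mu_ext_def)
    hence "M + int (mu_ext 1 (cons1 n (\<lambda>_. 0)) (\<lambda>_. 0) 1) - int n + j = M + (int n + j)" by simp
    thus ?thesis unfolding mterm_1 g_def i_def by (simp only: mult_ac)
  qed
  ultimately show ?case unfolding ch idx_1
    by (subst has_sum_reindex[OF inj_idx_1]) (simp add: o_def j_def)
next
  case (Suc k a b L M)
  define i j where "i = ind0 a" and "j = ind0 b"
  define j' where "j' = ind0 (b - 1)"
  have j': "j' = j + kdelta b 1" unfolding j_def j'_def by (rule ind0_pred)
  define H where "H = (\<lambda>lm ru. case (lm, ru) of ((l, m), (r, u)) \<Rightarrow> rq q (L - int r) * (rq q M * rq q (M + int u - int r + j)) * mterm (Suc k) a b (cons1 r l) (cons1 u m))"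
  define G where "G = (\<lambda>(l, m). bstep i j (\<lambda>r s. rq q (r - int (l 1)) * (rq q s * rq q (s + int (mu_ext k l m 1) - int (l 1) + j')) * mterm k (a - 1) (b - 1) l m) L M)"
  have t: "(if b < Suc k then 1 else 0) = (if b - 1 < k then 1 else (0::int))" using Suc.hyps by auto
  have G: "(G has_sum chain (Suc k) (if b < Suc k then 1 else 0) a b L M) (idx k)"
    unfolding t chain.simps i_def[symmetric] j_def[symmetric]
  proof -
    have "((\<lambda>x. bstep i j (\<lambda>r s. (\<lambda>(l, m). rq q (r - int (l 1)) * (rq q s * rq q (s + int (mu_ext k l m 1) - int (l 1) + ind0 (b - 1))) * mterm k (a - 1) (b - 1) l m) x) L M)
      has_sum bstep i j (chain k (if b - 1 < k then 1 else 0) (a - 1) (b - 1)) L M) (idx k)"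
      by (rule bstep_has_sum) (rule Suc.IH)
    thus "(G has_sum bstep i j (chain k (if b - 1 < k then 1 else 0) (a - 1) (b - 1)) L M) (idx k)"
      unfolding G_def j'_def by (simp add: case_prod_unfold)
  qed
  obtain B where B: "\<And>n. norm (rq q n) \<le> B" using rq_bounded by blast
  have B0: "0 \<le> B" using B[of 0] norm_ge_zero order_trans by blast
  \<comment> \<open>Absolute summability over all levels at once, needed to combine the inner and
    outer sums; the boundary factors are bounded, so \<open>mterm_summable\<close>
    dominates.\<close>
  have Hs: "(\<lambda>(lm, ru). H lm ru) summable_on idx k \<times> UNIV"
  proof (rule abs_summable_summable)
    have "(\<lambda>(l, m). norm (mterm (Suc k) a b l m)) summable_on idx (Suc k)" by (rule mterm_summable) simp
    hence "(\<lambda>x. (\<lambda>(l, m). norm (mterm (Suc k) a b l m)) ((\<lambda>((l, m), (r, u)). (cons1 r l, cons1 u m)) x)) summable_on idx k \<times> UNIV"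
      by (subst summable_on_reindex_bij_betw[OF bij_cons1[OF Suc.hyps]])
    hence "(\<lambda>x. (B * (B * B)) * (\<lambda>(l, m). norm (mterm (Suc k) a b l m)) ((\<lambda>((l, m), (r, u)). (cons1 r l, cons1 u m)) x)) summable_on idx k \<times> UNIV"
      by (rule summable_on_cmult_right)
    thus "(\<lambda>x. norm ((\<lambda>(lm, ru). H lm ru) x)) summable_on idx k \<times> UNIV"
    proof (rule summable_on_comparison_test)
      fix x :: "((nat \<Rightarrow> nat) \<times> (nat \<Rightarrow> nat)) \<times> (nat \<times> nat)"
      obtain l m r u where x: "x = ((l, m), (r, u))" by (metis prod.exhaust)
      show "norm ((\<lambda>(lm, ru). H lm ru) x) \<le> (B * (B * B)) * (\<lambda>(l, m). norm (mterm (Suc k) a b l m)) ((\<lambda>((l, m), (r, u)). (cons1 r l, cons1 u m)) x)"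
        unfolding x H_def prod.case norm_mult by (intro mult_mono B mult_nonneg_nonneg norm_ge_zero B0 order_refl)
    qed simp
  qed
  have inner: "(H lm has_sum G lm) UNIV" if "lm \<in> idx k" for lm
  proof -
    obtain l m where lm: "lm = (l, m)" by force
    define l1 mu d where "l1 = int (l 1)" and "mu = int (mu_ext k l m 1)" and "d = kdelta b 1"
    have mud: "mu + d \<ge> 0" by (simp add: mu_def d_def kdelta_def)
    define mt where "mt = mterm k (a - 1) (b - 1) l m"
    define g where "g = (\<lambda>r u. rq q (L - r) * (rq q M * rq q (M + u - r + j) *
      (q powi (r^2 - r * u + u^2 + i * r + j * u) * rq q (r - l1) * qbinom q (r - l1 + (mu + d)) u)) * mt)"
    have Hg: "H lm (r, u) = g (int r) (int u)" for r u
      unfolding H_def lm prod.case mterm_cons[OF Suc.hyps] weight_def g_def mt_def l1_def mu_def d_def i_def j_def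
      by (simp only: mult_ac)
    define h where "h = (\<lambda>r. rq q (L - r) * qconv (\<lambda>s. q powi (r\<^sup>2 - r * s + s\<^sup>2 + i * r + j * s) * (rq q (r - l1) * (rq q s * rq q (s + mu - l1 + (j + d))))) M * mt)"
    have 1: "((\<lambda>u. H lm (r, u)) has_sum h (int r)) UNIV" for r
    proof -
      have "((\<lambda>u. g (int r) (int u)) has_sum (\<Sum>u\<in>{0..int r - l1 + (mu + d)}. g (int r) u)) UNIV"
        by (rule has_sum_nat_of_int) (simp add: g_def qbinom_def)
      also have "(\<Sum>u\<in>{0..int r - l1 + (mu + d)}. g (int r) u) = h (int r)"
        unfolding g_def h_def inner_sum[OF Suc.prems mud, symmetric] sum_distrib_left sum_distrib_right ..
      finally show ?thesis unfolding Hg .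
    qed
    have 2: "((\<lambda>r. h (int r)) has_sum (\<Sum>r\<in>{0..L}. h r)) UNIV"
      by (rule has_sum_nat_of_int) (simp add: h_def)
    have "H lm summable_on UNIV"
      using summable_on_SigmaD1[OF Hs that] .
    hence "(H lm has_sum (\<Sum>r\<in>{0..L}. h r)) (UNIV \<times> UNIV)"
      by (intro has_sum_SigmaI[OF 1 2]) simp
    moreover have "G lm = (\<Sum>r\<in>{0..L}. h r)"
    proof -
      have "G lm = qconv (\<lambda>r. qconv (\<lambda>s. mt * (q powi (r\<^sup>2 - r * s + s\<^sup>2 + i * r + j * s) * (rq q (r - l1) * (rq q s * rq q (s + mu - l1 + (j + d)))))) M) L"
        unfolding G_def lm prod.case bstep_def mt_def[symmetric] l1_def[symmetric] mu_def[symmetric] j' d_def[symmetric]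
        by (simp only: mult_ac)
      thus ?thesis unfolding qconv_cmult unfolding qconv_def[of _ L] h_def by (simp only: sum_distrib_left mult_ac)
    qed
    ultimately show ?thesis by simp
  qed
  have "((\<lambda>(lm, ru). H lm ru) has_sum chain (Suc k) (if b < Suc k then 1 else 0) a b L M) (idx k \<times> UNIV)"
    by (rule has_sum_SigmaI[OF _ G Hs]) (simp add: inner)
  also have "?this \<longleftrightarrow> ((\<lambda>x. (\<lambda>(l, m). rq q (L - int (l 1)) * (rq q M * rq q (M + int (mu_ext (Suc k) l m 1) - int (l 1) + ind0 b)) * mterm (Suc k) a b l m)
      ((\<lambda>((l, m), (r, u)). (cons1 r l, cons1 u m)) x)) has_sum chain (Suc k) (if b < Suc k then 1 else 0) a b L M) (idx k \<times> UNIV)"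
  proof (rule has_sum_cong, goal_cases)
    case (1 x)
    obtain l m r u where x: "x = ((l, m), (r, u))" by (metis prod.exhaust)
    show ?case unfolding x H_def j_def using Suc.hyps by (simp add: mu_ext_def)
  qed
  also have "\<dots> \<longleftrightarrow> ?case"
    by (rule has_sum_reindex_bij_betw[OF bij_cons1[OF Suc.hyps]])
  finally show ?case .
qed


section \<open>The limit of the chain\<close>

text \<open>\<open>seed 0\<close> is \<open>(1 - q^(r+s+1)) * seed 1\<close>, and the factor
  \<open>q^(r+s)\<close> turns the innermost (0,0) step into a (1,1) step. The difference is exactly
  the one that tends to \<open>chitilde\<close> at a = b = k.\<close>

lemma chain_seed0_eq_diff:
  assumes "k \<ge> 1"
  shows "chain k 0 k k L M = chain k 1 k k L M - q * chain k 1 (k - 1) (k - 1) L M"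
  using assms
proof (induction k arbitrary: L M rule: nat_induct_at_least)
  case (base L M)
  have e: "seed 0 r s = seed 1 r s - q powi (r + s + 1) * seed 1 r s" for r s
  proof -
    have "rq q (r + s + 0) = (1 - q powi (r + s + 1)) * rq q (r + s + 1)" using rq_rec[of "r + s + 1"] by simp
    thus ?thesis unfolding seed_def by (simp only:) (simp add: left_diff_distrib right_diff_distrib mult_ac)
  qed
  have "bstep 0 0 (seed 0) L M = bstep 0 0 (seed 1) L M - bstep 0 0 (\<lambda>r s. q powi (r + s + 1) * seed 1 r s) L M"
    unfolding e[abs_def] by (rule bstep_diff)
  also have "bstep 0 0 (\<lambda>r s. q powi (r + s + 1) * seed 1 r s) L M = bstep 1 1 (\<lambda>r s. q * seed 1 r s) L M"
    by (rule bstep_cong) (simp add: powi_add mult_ac)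
  also have "\<dots> = q * bstep 1 1 (seed 1) L M" by (rule bstep_cmult)
  finally show ?case by simp
next
  case (Suc k L M)
  have "chain k 0 k k = (\<lambda>r s. chain k 1 k k r s - q * chain k 1 (k - 1) (k - 1) r s)"
    by (intro ext Suc.IH)
  hence "bstep 0 0 (chain k 0 k k) L M = bstep 0 0 (chain k 1 k k) L M - q * bstep 0 0 (chain k 1 (k - 1) (k - 1)) L M"
    by (simp only: bstep_diff bstep_cmult)
  thus ?case using Suc.hyps by simp
qed

text \<open>One factorial in the numerator against six reciprocals leaves the fifth power.\<close>

lemma tri_tendsto:
  "(\<lambda>n. tri q (int n + int n + d) (int n + x) (int n + y) (int n + z)) \<longlonglongrightarrow> 1 / qinf ^ 5"
proof -
  have "(\<lambda>n. qfac q (2 * int n + d) * (rq q (1 * int n + x) * rq q (1 * int n + (d - x))) * (rq q (1 * int n + y) * rq q (1 * int n + (d - y)))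
     * (rq q (1 * int n + z) * rq q (1 * int n + (d - z)))) \<longlonglongrightarrow> qinf * (1 / qinf * (1 / qinf)) * (1 / qinf * (1 / qinf)) * (1 / qinf * (1 / qinf))"
    by (intro tendsto_mult qfac_tendsto rq_tendsto) auto
  moreover have "qinf * (1 / qinf * (1 / qinf)) * (1 / qinf * (1 / qinf)) * (1 / qinf * (1 / qinf)) = 1 / qinf ^ 5"
    using qinf_nz by (simp add: field_simps eval_nat_numeral)
  moreover have "int n + int n + d - (int n + t) = 1 * int n + (d - t)" "int n + int n + d = 2 * int n + d" for n t by simp_all
  ultimately show ?thesis unfolding tri_def by (simp add: algebra_simps)
qed

lemma tri_bounded: "\<exists>B. \<forall>n x y z. norm (tri q n x y z) \<le> B"
proof -
  obtain B1 where B1: "\<And>n. norm (qfac q n) \<le> B1" using qfac_bounded by blast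
  obtain B2 where B2: "\<And>n. norm (rq q n) \<le> B2" using rq_bounded by blast
  have B: "0 \<le> B1" "0 \<le> B2" using B1[of 0] B2[of 0] norm_ge_zero order_trans by blast+
  have "norm (tri q n x y z) \<le> B1 * (B2 * B2) * (B2 * B2) * (B2 * B2)" for n x y z
    unfolding tri_def norm_mult by (intro mult_mono B1 B2 mult_nonneg_nonneg B norm_ge_zero)
  thus ?thesis by blast
qed

lemma tri_sum_tendsto:
  assumes cf: "((\<lambda>(v, w). cf v w) has_sum X) UNIV"
    and D: "\<And>n. ((\<lambda>(v, w). cf v w * tri q (int n + int n + d) (int n + f v) (int n + g w) (int n + h v w)) has_sum D n) UNIV"
  shows "D \<longlonglongrightarrow> X / qinf ^ 5"
proof -
  obtain B where B: "\<And>n x y z. norm (tri q n x y z) \<le> B" using tri_bounded by blast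
  have "(\<lambda>x. norm ((\<lambda>(v, w). cf v w) x)) summable_on UNIV"
    using cf has_sum_imp_summable summable_on_iff_abs_summable_on_complex by blast
  hence s: "(\<lambda>x. norm ((\<lambda>(v, w). cf v w) x) * B) summable_on UNIV" by (rule summable_on_cmult_left)
  define F where "F = (\<lambda>n. \<lambda>(v, w). cf v w * tri q (int n + int n + d) (int n + f v) (int n + g w) (int n + h v w))"
  have le: "norm (F n x) \<le> norm ((\<lambda>(v, w). cf v w) x) * B" for n x
    unfolding F_def case_prod_unfold norm_mult by (intro mult_left_mono B) simp
  have lim: "(\<lambda>n. F n x) \<longlonglongrightarrow> (\<lambda>(v, w). cf v w) x * (1 / qinf ^ 5)" for x
    unfolding F_def case_prod_unfold by (intro tendsto_mult tendsto_const tri_tendsto)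
  have "(\<lambda>n. D n) \<longlonglongrightarrow> infsum (\<lambda>x. (\<lambda>(v, w). cf v w) x * (1 / qinf ^ 5)) UNIV"
  proof (rule has_sum_dominated(2)[OF s le lim])
    show "(F n has_sum D n) UNIV" for n unfolding F_def by (rule D)
  qed
  also have "infsum (\<lambda>x. (\<lambda>(v, w). cf v w) x * (1 / qinf ^ 5)) UNIV = X * (1 / qinf ^ 5)"
    by (rule infsumI[OF has_sum_cmult_left[OF cf]])
  finally show ?thesis by simp
qed

text \<open>The Macdonald identity in base \<open>q^K\<close> with \<open>x = q^(a+1)\<close> and
  \<open>y = q^(b+1)\<close>. Writing \<open>nn v w = 3 * t + 1\<close>, the \<open>k\<close> steps
  give \<open>3 * k * t\<close> and the seed \<open>2 * t\<close>, together \<open>K * t\<close>;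
  the linear parts match those of \<open>x\<close> and \<open>y\<close>.\<close>

lemma chitilde_has_sum:
  assumes "a \<le> b" "b \<le> k"
  shows "((\<lambda>(v, w). c11 (k - b) v w * q powi (- 2 * v - w) * q powi (int (b - a) * (nn v w - v)) * q powi (int a * (nn v w - 2 * v - w + 1)))
     has_sum (qinf\<^sup>2 * chitilde (3 * k + 2) a b q)) UNIV"
proof -
  define K where "K = 3 * k + 2"
  have "K > 0" by (simp add: K_def)
  interpret p: nome "q ^ K"
    by unfold_locales (use q_lt \<open>K > 0\<close> in \<open>auto simp: norm_power power_less_one_iff\<close>)
  have "((\<lambda>(v, w). chi3 (v - w) * (q ^ K) powi ((v\<^sup>2 + v * w + w\<^sup>2 - 1) div 3) * (q ^ (a + 1)) powi (1 - v - w) * (q ^ (b + 1)) powi (1 - v))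
     has_sum (p.qinf\<^sup>2 * (theta (q ^ (a + 1)) (q ^ K) * theta (q ^ (b + 1)) (q ^ K) * theta (q ^ (a + 1) * q ^ (b + 1)) (q ^ K)))) UNIV"
    by (rule p.macdonald_A2) auto
  also have "p.qinf\<^sup>2 * (theta (q ^ (a + 1)) (q ^ K) * theta (q ^ (b + 1)) (q ^ K) * theta (q ^ (a + 1) * q ^ (b + 1)) (q ^ K)) = qinf\<^sup>2 * chitilde (3 * k + 2) a b q"
  proof -
    have e: "q ^ (a + 1) * q ^ (b + 1) = q ^ (a + b + 2)" by (simp add: power_add power2_eq_square)
    show ?thesis using qinf_nz unfolding e chitilde_def K_def[symmetric] p.qinf_def qinf_def by simp
  qed
  also have "((\<lambda>(v, w). chi3 (v - w) * (q ^ K) powi ((v\<^sup>2 + v * w + w\<^sup>2 - 1) div 3) * (q ^ (a + 1)) powi (1 - v - w) * (q ^ (b + 1)) powi (1 - v))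
      has_sum (qinf\<^sup>2 * chitilde (3 * k + 2) a b q)) UNIV \<longleftrightarrow> ?thesis"
  proof (rule has_sum_cong, goal_cases)
    case (1 x)
    obtain v w where x: "x = (v, w)" by force
    show ?case
    proof (cases "chi3 (v - w) = 0")
      case True
      thus ?thesis unfolding x by (simp add: c11_def seed_coeff_def)
    next
      case False
      define t where "t = (v\<^sup>2 + v * w + w\<^sup>2 - 1) div 3"
      have "(v - w) mod 3 \<noteq> 0" using False by (auto simp: chi3_def)
      hence "(v - w) mod 3 = 1 \<or> (v - w) mod 3 = 2" by presburger
      hence "3 dvd (v - w - 1) \<or> 3 dvd (v - w + 1)" by presburger
      hence "3 dvd (v - w - 1) * (v - w + 1) + 3 * (v * w)" by auto
      also have "(v - w - 1) * (v - w + 1) + 3 * (v * w) = v\<^sup>2 + v * w + w\<^sup>2 - 1" by (simp add: algebra_simps power2_eq_square)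
      finally have nn: "nn v w = 3 * t + 1" unfolding t_def nn_def by simp
      hence t2: "(2 * (v\<^sup>2 + v * w + w\<^sup>2) - 2) div 3 = 2 * t" unfolding nn_def by simp
      have ints: "int (k - b) = int k - int b" "int (b - a) = int b - int a" using assms by auto
      have "q^2 * q powi (2 * t) * q powi (int (k - b) * (nn v w - 1)) * q powi (- 2 * v - w) * q powi (int (b - a) * (nn v w - v)) * q powi (int a * (nn v w - 2 * v - w + 1))
         = q powi (2 + 2 * t + int (k - b) * (nn v w - 1) + (- 2 * v - w) + int (b - a) * (nn v w - v) + int a * (nn v w - 2 * v - w + 1))"
        by (simp only: powi_add) simp
      also have "2 + 2 * t + int (k - b) * (nn v w - 1) + (- 2 * v - w) + int (b - a) * (nn v w - v) + int a * (nn v w - 2 * v - w + 1)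
          = int K * t + int (a + 1) * (1 - v - w) + int (b + 1) * (1 - v)"
        unfolding nn ints K_def by (simp add: algebra_simps)
      also have "q powi \<dots> = (q ^ K) powi t * (q ^ (a + 1)) powi (1 - v - w) * (q ^ (b + 1)) powi (1 - v)"
        unfolding powi_powi powi_add ..
      finally have "(q ^ K) powi t * (q ^ (a + 1)) powi (1 - v - w) * (q ^ (b + 1)) powi (1 - v) =
         q^2 * q powi (2 * t) * q powi (int (k - b) * (nn v w - 1)) * q powi (- 2 * v - w) * q powi (int (b - a) * (nn v w - v)) * q powi (int a * (nn v w - 2 * v - w + 1))" ..
      hence "chi3 (v - w) * ((q ^ K) powi t * (q ^ (a + 1)) powi (1 - v - w) * (q ^ (b + 1)) powi (1 - v)) = chi3 (v - w) * 
         (q^2 * q powi (2 * t) * q powi (int (k - b) * (nn v w - 1)) * q powi (- 2 * v - w) * q powi (int (b - a) * (nn v w - v)) * q powi (int a * (nn v w - 2 * v - w + 1)))"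
        by (simp only:)
      thus ?thesis unfolding x prod.case c11_def seed_coeff_def t2 t_def[symmetric] by (simp only: mult_ac)
    qed
  qed
  finally show ?thesis .
qed

text \<open>For \<open>a = 0\<close> there is no step of type (0,0): the expansion of type (1,0) is
  final and nothing is subtracted. Otherwise the expansion of the difference is used. Both limits
  carry \<open>qinf^2 / qinf^5\<close>.\<close>

lemma chain_tendsto_chitilde:
  assumes ab: "a \<le> b" "b \<le> k"
  shows "(\<lambda>n. chain k 1 a b (int n) (int n) - (if a = 0 then 0 else q * chain k 1 (a - 1) (b - 1) (int n) (int n)))
    \<longlonglongrightarrow> chitilde (3 * k + 2) a b q / qinf ^ 3"
proof -
  have "(\<lambda>n. chain k 1 a b (int n) (int n) - (if a = 0 then 0 else q * chain k 1 (a - 1) (b - 1) (int n) (int n)))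
    \<longlonglongrightarrow> qinf\<^sup>2 * chitilde (3 * k + 2) a b q / qinf ^ 5"
  proof (cases a)
    case 0
    show ?thesis
    proof (rule tri_sum_tendsto[OF chitilde_has_sum[OF ab], where d = 1 and f = "\<lambda>v. v" and g = "\<lambda>w. 1 + w" and h = "\<lambda>v w. 1 - v - w"])
      fix n
      show "((\<lambda>(v, w). c11 (k - b) v w * q powi (- 2 * v - w) * q powi (int (b - a) * (nn v w - v)) * q powi (int a * (nn v w - 2 * v - w + 1))
          * tri q (int n + int n + 1) (int n + v) (int n + (1 + w)) (int n + (1 - v - w))) has_sum
          (chain k 1 a b (int n) (int n) - (if a = 0 then 0 else q * chain k 1 (a - 1) (b - 1) (int n) (int n)))) UNIV"
        using chain_has_sum10[of "int n" "int n" "k - b" b] ab 0 by (simp add: add.assoc add_diff_eq)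
    qed
  next
    case (Suc a')
    show ?thesis
    proof (rule tri_sum_tendsto[OF chitilde_has_sum[OF ab], where d = 0 and f = "\<lambda>v. v - 1" and g = "\<lambda>w. w" and h = "\<lambda>v w. 1 - v - w"])
      fix n
      have e: "Suc (k - b + (b - a)) + a' = k" "b - a + a' = b - 1" "Suc (b - 1) = b" using ab Suc by auto
      show "((\<lambda>(v, w). c11 (k - b) v w * q powi (- 2 * v - w) * q powi (int (b - a) * (nn v w - v)) * q powi (int a * (nn v w - 2 * v - w + 1))
          * tri q (int n + int n + 0) (int n + (v - 1)) (int n + w) (int n + (1 - v - w))) has_sum
          (chain k 1 a b (int n) (int n) - (if a = 0 then 0 else q * chain k 1 (a - 1) (b - 1) (int n) (int n)))) UNIV"
        using chain_diff_has_sum[of "int n" "int n" "k - b" "b - a" a'] unfolding e Suc[symmetric] using Suc by (simp add: add_diff_eq)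
    qed
  qed
  moreover have "qinf\<^sup>2 * chitilde (3 * k + 2) a b q / qinf ^ 5 = chitilde (3 * k + 2) a b q / qinf ^ 3"
    using qinf_nz by (simp add: field_simps eval_nat_numeral)
  ultimately show ?thesis by simp
qed

text \<open>The three boundary factors are bounded and each tends to \<open>1 / qinf\<close>, the
  same power of \<open>qinf\<close> as on the theta side.\<close>

lemma chain_tendsto_sum:
  assumes k: "k \<ge> 1"
  shows "(\<lambda>(l, m). mterm k a b l m) summable_on idx k"
    "(\<lambda>n. chain k (if b < k then 1 else 0) a b (int n) (int n)) \<longlonglongrightarrow> infsum (\<lambda>(l, m). mterm k a b l m) (idx k) / qinf ^ 3"
proof -
  have abs: "(\<lambda>x. norm ((\<lambda>(l, m). mterm k a b l m) x)) summable_on idx k"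
    using mterm_summable[OF k, of a b] by (simp add: case_prod_unfold)
  thus sum: "(\<lambda>(l, m). mterm k a b l m) summable_on idx k" by (rule abs_summable_summable)
  obtain B where B: "\<And>n. norm (rq q n) \<le> B" using rq_bounded by blast
  have B0: "0 \<le> B" using B[of 0] norm_ge_zero order_trans by blast
  define F where "F = (\<lambda>n. \<lambda>(l, m). rq q (int n - int (l 1)) * (rq q (int n) * rq q (int n + int (mu_ext k l m 1) - int (l 1) + ind0 b)) * mterm k a b l m)"
  have s: "(\<lambda>x. (B * (B * B)) * norm ((\<lambda>(l, m). mterm k a b l m) x)) summable_on idx k"
    by (rule summable_on_cmult_right[OF abs])
  have le: "norm (F n x) \<le> (B * (B * B)) * norm ((\<lambda>(l, m). mterm k a b l m) x)" for n x
    unfolding F_def case_prod_unfold norm_mult by (intro mult_mono B mult_nonneg_nonneg norm_ge_zero B0 order_refl)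
  have lim: "(\<lambda>n. F n x) \<longlonglongrightarrow> (1 / qinf * (1 / qinf * (1 / qinf))) * (\<lambda>(l, m). mterm k a b l m) x" for x
  proof -
    obtain l m where x: "x = (l, m)" by force
    have "(\<lambda>n. rq q (1 * int n + - int (l 1)) * (rq q (1 * int n + 0) * rq q (1 * int n + (int (mu_ext k l m 1) - int (l 1) + ind0 b))) * mterm k a b l m)
      \<longlonglongrightarrow> (1 / qinf * (1 / qinf * (1 / qinf))) * mterm k a b l m"
      by (intro tendsto_mult tendsto_const rq_tendsto) auto
    thus ?thesis unfolding x F_def prod.case by (simp add: algebra_simps)
  qed
  have "(\<lambda>n. chain k (if b < k then 1 else 0) a b (int n) (int n)) \<longlonglongrightarrow> infsum (\<lambda>x. (1 / qinf * (1 / qinf * (1 / qinf))) * (\<lambda>(l, m). mterm k a b l m) x) (idx k)"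
  proof (rule has_sum_dominated(2)[OF s le lim])
    show "(F n has_sum chain k (if b < k then 1 else 0) a b (int n) (int n)) (idx k)" for n
      unfolding F_def by (rule chain_eq_sum[OF k]) simp
  qed
  also have "infsum (\<lambda>x. (1 / qinf * (1 / qinf * (1 / qinf))) * (\<lambda>(l, m). mterm k a b l m) x) (idx k) = (1 / qinf * (1 / qinf * (1 / qinf))) * infsum (\<lambda>(l, m). mterm k a b l m) (idx k)"
    by (rule infsumI[OF has_sum_cmult_right[OF has_sum_infsum[OF sum]]])
  also have "\<dots> = infsum (\<lambda>(l, m). mterm k a b l m) (idx k) / qinf ^ 3"
    by (simp add: power3_eq_cube)
  finally show "(\<lambda>n. chain k (if b < k then 1 else 0) a b (int n) (int n)) \<longlonglongrightarrow> infsum (\<lambda>(l, m). mterm k a b l m) (idx k) / qinf ^ 3" .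
qed

lemma chitilde_commute: "chitilde K a b q = chitilde K b a q"
  by (simp add: chitilde_def mult_ac add_ac)

lemma chitilde_eq:
  assumes "a \<le> k" "b < k"
  shows "chitilde (3 * k + 2) a b q = infsum (\<lambda>(l, m). mterm k a b l m) (idx k)
    - (if a * b > 0 then q * infsum (\<lambda>(l, m). mterm k (a - 1) (b - 1) l m) (idx k) else 0)"
proof -
  define S where "S = (\<lambda>a b. infsum (\<lambda>(l, m). mterm k a b l m) (idx k))"
  have k: "k \<ge> 1" using assms by simp
  have S: "(\<lambda>n. chain k 1 a b (int n) (int n)) \<longlonglongrightarrow> S a b / qinf ^ 3"
    "(\<lambda>n. chain k 1 (a - 1) (b - 1) (int n) (int n)) \<longlonglongrightarrow> S (a - 1) (b - 1) / qinf ^ 3"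
    using chain_tendsto_sum(2)[OF k, of b a] chain_tendsto_sum(2)[OF k, of "b - 1" "a - 1"] assms
    unfolding S_def by (auto split: if_splits)
  have 1: "(\<lambda>n. chain k 1 a b (int n) (int n) - (if a = 0 \<or> b = 0 then 0 else q * chain k 1 (a - 1) (b - 1) (int n) (int n)))
      \<longlonglongrightarrow> S a b / qinf ^ 3 - (if a = 0 \<or> b = 0 then 0 else q * (S (a - 1) (b - 1) / qinf ^ 3))"
    using S(1) tendsto_diff[OF S(1) tendsto_mult_left[OF S(2), of q]] by (cases "a = 0 \<or> b = 0") simp_all
  have 2: "(\<lambda>n. chain k 1 a b (int n) (int n) - (if a = 0 \<or> b = 0 then 0 else q * chain k 1 (a - 1) (b - 1) (int n) (int n)))
      \<longlonglongrightarrow> chitilde (3 * k + 2) a b q / qinf ^ 3"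
  proof (cases "a \<le> b")
    case True
    moreover have "(a = 0 \<or> b = 0) = (a = 0)" using True by auto
    ultimately show ?thesis using chain_tendsto_chitilde[of a b k] assms by simp
  next
    \<comment> \<open>The expansions assume \<open>a <= b\<close>. The chain with
      \<open>seed 1\<close> and \<open>chitilde\<close> are both symmetric in \<open>a\<close> and
      \<open>b\<close>, although the multisum visibly is not.\<close>
    case False
    have e: "(a = 0 \<or> b = 0) = (b = 0)" using False by auto
    have "(\<lambda>n. chain k 1 b a (int n) (int n) - (if b = 0 then 0 else q * chain k 1 (b - 1) (a - 1) (int n) (int n)))
      \<longlonglongrightarrow> chitilde (3 * k + 2) b a q / qinf ^ 3"
      by (rule chain_tendsto_chitilde) (use False assms in auto)
    thus ?thesis unfolding e chitilde_commute[of _ b a] chain_swap[of k 1 b a] chain_swap[of k 1 "b - 1" "a - 1"] .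
  qed
  have "(S a b - (if a = 0 \<or> b = 0 then 0 else q * S (a - 1) (b - 1))) / qinf ^ 3
     = S a b / qinf ^ 3 - (if a = 0 \<or> b = 0 then 0 else q * (S (a - 1) (b - 1) / qinf ^ 3))"
    by (cases "a = 0 \<or> b = 0") (simp_all add: diff_divide_distrib)
  hence "chitilde (3 * k + 2) a b q / qinf ^ 3 = (S a b - (if a = 0 \<or> b = 0 then 0 else q * S (a - 1) (b - 1))) / qinf ^ 3"
    using LIMSEQ_unique[OF 2 1] by (simp only:)
  hence "chitilde (3 * k + 2) a b q = S a b - (if a = 0 \<or> b = 0 then 0 else q * S (a - 1) (b - 1))"
    using qinf_nz by simp
  thus ?thesis unfolding S_def by simp
qed

lemma chitilde_k_k_eq:
  assumes k: "k \<ge> 1"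
  shows "chitilde (3 * k + 2) k k q = infsum (\<lambda>(l, m). mterm k k k l m) (idx k)"
proof -
  have "(\<lambda>n. chain k 0 k k (int n) (int n)) \<longlonglongrightarrow> infsum (\<lambda>(l, m). mterm k k k l m) (idx k) / qinf ^ 3"
    using chain_tendsto_sum(2)[OF k, of k k] by simp
  moreover have "(\<lambda>n. chain k 0 k k (int n) (int n)) \<longlonglongrightarrow> chitilde (3 * k + 2) k k q / qinf ^ 3"
    using chain_tendsto_chitilde[of k k k] k unfolding chain_seed0_eq_diff[OF k] by simp
  ultimately have "infsum (\<lambda>(l, m). mterm k k k l m) (idx k) / qinf ^ 3 = chitilde (3 * k + 2) k k q / qinf ^ 3"
    by (rule LIMSEQ_unique)
  thus ?thesis using qinf_nz by simp
qed

end

section \<open>The degenerate case q = 0\<close>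

lemma core_at_zero:
  assumes "(l, m) \<in> idx k" "\<And>i. d i \<in> {0, 1}"
  shows "0 ^ (l k ^ 2 + n) * core k 0 d l m = (if (l, m) = (\<lambda>_. 0, \<lambda>_. 0) then 0 ^ n else 0)"
proof -
  have qp: "qpoch 0 0 n = 1" for n by (simp add: qpoch_def)
  show ?thesis
  proof (cases "(l, m) = (\<lambda>_. 0, \<lambda>_. 0)")
    case True
    have "qbinom 0 x 0 = (if x \<ge> 0 then 1 else 0)" for x by (simp add: qbinom_def qp)
    moreover have "d i \<ge> 0" for i using assms(2)[of i] by auto
    ultimately have "core k 0 d (\<lambda>_. 0) (\<lambda>_. 0) = 1" by (simp add: core_def mu_ext_def qp)
    thus ?thesis using True by simp
  next
    case False
    show ?thesis
    proof (cases "l k = 0")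
      case True
      obtain i where i: "l i \<noteq> 0 \<or> m i \<noteq> 0" using False by fastforce
      have "i \<in> {1..k-1}"
      proof -
        have "i \<ge> 1" using i assms(1) by (cases "i < 1") (auto simp: idx_def)
        moreover have "i < k" using i assms(1) True by (cases "i < k"; cases "i = k") (auto simp: idx_def)
        ultimately show ?thesis by simp
      qed
      \<comment> \<open>The exponent is a positive definite form, four times it being
        \<open>(2 * l i - m i)^2 + 3 * (m i)^2\<close>, so a nonzero index pair brings in a nonzero
        power of 0.\<close>
      moreover have "int (l i)^2 - int (l i) * int (m i) + int (m i)^2 \<noteq> 0"
      proof
        assume "int (l i)^2 - int (l i) * int (m i) + int (m i)^2 = 0"
        hence "(2 * int (l i) - int (m i))^2 + 3 * int (m i)^2 = 0" by (simp add: algebra_simps power2_eq_square)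
        hence "int (m i)^2 = 0" "(2 * int (l i) - int (m i))^2 = 0"
          using zero_le_power2[of "2 * int (l i) - int (m i)"] zero_le_power2[of "int (m i)"] by linarith+
        thus False using i by simp
      qed
      ultimately have "core k 0 d l m = 0" unfolding core_def by (subst prod_zero) (auto intro!: bexI[of _ i])
      thus ?thesis unfolding if_not_P[OF False] by simp
    next
      case False': False
      thus ?thesis unfolding if_not_P[OF False] by simp
    qed
  qed
qed

lemma has_sum_single_idx:
  assumes "\<And>l m. (l, m) \<in> idx k \<Longrightarrow> f (l, m) = (if (l, m) = (\<lambda>_. 0, \<lambda>_. 0) then c else (0::complex))"
  shows "(f has_sum c) (idx k)"
proof -
  have "(f has_sum c) {(\<lambda>_. 0, \<lambda>_. 0)}"
    using has_sum_finite[of "{(\<lambda>_. 0, \<lambda>_. 0)}" f] assms[of "\<lambda>_. 0" "\<lambda>_. 0"] by (simp add: idx_def)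
  also have "?this \<longleftrightarrow> ?thesis"
  proof (rule has_sum_cong_neutral)
    show "f x = 0" if "x \<in> idx k - {(\<lambda>_. 0, \<lambda>_. 0)}" for x
    proof -
      obtain l m where x: "x = (l, m)" by force
      show ?thesis using assms[of l m] that unfolding x by (metis DiffE singletonI)
    qed
    show "f x = 0" if "x \<in> {(\<lambda>_. 0, \<lambda>_. 0)} - idx k" for x using that by (auto simp: idx_def)
  qed simp
  finally show ?thesis .
qed

text \<open>Every argument of \<open>qpoch_inf\<close> becomes 0, also the quotient in
  \<open>theta\<close>, by the convention \<open>0 / 0 = 0\<close>.\<close>

lemma chitilde_at_zero: "chitilde (3 * k + 2) a b 0 = 1"
proof -
  have "qpoch_inf 0 0 = 1" by (simp add: qpoch_inf_def)
  thus ?thesis by (simp add: chitilde_def theta_def)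
qed

theorem theorem7p3:
  fixes k a b :: nat and q :: complex
  assumes "k \<ge> 1" and "a \<le> k" and "b < k" and "norm q < 1"
  shows "(\<exists>S1 S2.
            ((\<lambda>(l, m). q ^ (l k ^ 2 + (\<Sum>i\<in>{a+1..k}. l i) + (\<Sum>i\<in>{b+1..k-1}. m i))
                 * core k q (kdelta b) l m) has_sum S1) (idx k)
          \<and> (a * b > 0 \<longrightarrow>
              ((\<lambda>(l, m). q ^ (1 + l k ^ 2 + (\<Sum>i\<in>{a..k}. l i) + (\<Sum>i\<in>{b..k-1}. m i))
                 * core k q (kdelta (b - 1)) l m) has_sum S2) (idx k))
          \<and> chitilde (3 * k + 2) a b q = S1 - (if a * b > 0 then S2 else 0))
        \<and> ((\<lambda>(l, m). q ^ (l k ^ 2) * core k q (\<lambda>_. 0) l m) has_sum chitilde (3 * k + 2) k k q) (idx k)"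
proof (cases "q = 0")
  case True
  have kd: "kdelta c i \<in> {0, 1}" for c i by (simp add: kdelta_def)
  have "((\<lambda>(l, m). q ^ (l k ^ 2 + (\<Sum>i\<in>{a+1..k}. l i) + (\<Sum>i\<in>{b+1..k-1}. m i)) * core k q (kdelta b) l m) has_sum 1) (idx k)"
    unfolding True by (rule has_sum_single_idx) (use core_at_zero[of _ _ k "kdelta b"] kd in \<open>simp add: add.assoc\<close>)
  moreover have "((\<lambda>(l, m). q ^ (1 + l k ^ 2 + (\<Sum>i\<in>{a..k}. l i) + (\<Sum>i\<in>{b..k-1}. m i)) * core k q (kdelta (b - 1)) l m) has_sum 0) (idx k)"
    unfolding True by (rule has_sum_single_idx) simp
  \<comment> \<open>The additional 1 in the exponent kills every term, including the one at the zero
    index.\<close>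
  moreover have "((\<lambda>(l, m). q ^ (l k ^ 2) * core k q (\<lambda>_. 0) l m) has_sum 1) (idx k)"
    unfolding True by (rule has_sum_single_idx) (use core_at_zero[of _ _ k "\<lambda>_. 0" 0] in simp)
  ultimately show ?thesis unfolding True chitilde_at_zero by (intro conjI exI[of _ 1] exI[of _ 0]) auto
next
  case False
  interpret nome q by unfold_locales (use False assms in auto)
  define S where "S = (\<lambda>a b. infsum (\<lambda>(l, m). mterm k a b l m) (idx k))"
  have hs: "((\<lambda>(l, m). mterm k a b l m) has_sum S a b) (idx k)" for a b
    unfolding S_def by (rule has_sum_infsum[OF chain_tendsto_sum(1)[OF assms(1)]])
  have 1: "((\<lambda>(l, m). q ^ (l k ^ 2 + (\<Sum>i\<in>{a+1..k}. l i) + (\<Sum>i\<in>{b+1..k-1}. m i)) * core k q (kdelta b) l m) has_sum S a b) (idx k)"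
    using hs[of a b] by (simp add: mterm_def)
  have 2: "((\<lambda>(l, m). q ^ (1 + l k ^ 2 + (\<Sum>i\<in>{a..k}. l i) + (\<Sum>i\<in>{b..k-1}. m i)) * core k q (kdelta (b - 1)) l m) has_sum q * S (a - 1) (b - 1)) (idx k)"
    if "a * b > 0"
  proof -
    have "a - 1 + 1 = a" "b - 1 + 1 = b" using that by auto
    thus ?thesis using has_sum_cmult_right[OF hs[of "a - 1" "b - 1"], of q] unfolding mterm_def
      by (simp add: case_prod_unfold mult.assoc)
  qed
  have 3: "((\<lambda>(l, m). q ^ (l k ^ 2) * core k q (\<lambda>_. 0) l m) has_sum chitilde (3 * k + 2) k k q) (idx k)"
  proof -
    \<comment> \<open>With a = b = k the linear sums are empty, and the delta at \<open>k\<close>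
      never meets an index \<open>i <= k - 1\<close>.\<close>
    have "mterm k k k l m = q ^ (l k ^ 2) * core k q (\<lambda>_. 0) l m" for l m
    proof -
      have "core k q (kdelta k) l m = core k q (\<lambda>_. 0) l m"
        unfolding core_def by (intro arg_cong2[where f="(/)"] prod.cong refl) (auto simp: kdelta_def)
      thus ?thesis by (simp add: mterm_def)
    qed
    thus ?thesis using hs[of k k] unfolding chitilde_k_k_eq[OF assms(1)] S_def by simp
  qed
  have 4: "chitilde (3 * k + 2) a b q = S a b - (if a * b > 0 then q * S (a - 1) (b - 1) else 0)"
    unfolding S_def by (rule chitilde_eq[OF assms(2,3)])
  show ?thesis
    by (rule conjI[OF exI[of _ "S a b", OF exI[of _ "q * S (a - 1) (b - 1)"]] 3]) (intro conjI impI 1 2 4)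
qed

end
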